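(* Let $a,b,c:\mathbb{R}\to\mathbb{R}$ be the homeomorphisms \[ a(t)=t+1,\qquad b(t)=\begin{cases} t&\text{if } t\le 0\\ \frac{t}{1-t}&\text{if } 0\le t\le \frac12\\ 3-\frac1t&\text{if } \frac12\le t\le 1\\ t+1&\text{if } 1\le t\end{cases} \qquad c(t)=\begin{cases}\frac{2t}{1+t}&\text{if } 0\le t\le 1\\ t&\text{otherwise.}\end{cases} \] Then the group $G_0=\langle a,b,c\rangle$ of homeomorphisms of $\mathbb{R}$ (under composition) generated by $a$, $b$ and $c$ is nonamenable and finitely presented.
   Context: A discrete group is amenable if it admits a finitely additive translation invariant probability measure (defined on all of its subsets); it is nonamenable otherwise. *)

theory Defs
  imports "HOL-Analysis.Analysis" "HOL-Algebra.Elementary_Groups"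
begin

section \<open>Amenable groups\<close>

text \<open>A group is viewed as a discrete group, so the mean is defined on all subsets of the
  carrier. Only the values of \<open>\<mu>\<close> on subsets of the carrier matter.\<close>

definition amenable :: "('a, 'b) monoid_scheme \<Rightarrow> bool" where
  "amenable G \<longleftrightarrow> (\<exists>\<mu> :: 'a set \<Rightarrow> real.
     (\<forall>A. A \<subseteq> carrier G \<longrightarrow> 0 \<le> \<mu> A) \<and>
     \<mu> (carrier G) = 1 \<and>
     (\<forall>A B. A \<subseteq> carrier G \<longrightarrow> B \<subseteq> carrier G \<longrightarrow> A \<inter> B = {} \<longrightarrow> \<mu> (A \<union> B) = \<mu> A + \<mu> B) \<and>
     (\<forall>g \<in> carrier G. \<forall>A. A \<subseteq> carrier G \<longrightarrow> \<mu> (g <#\<^bsub>G\<^esub> A) = \<mu> A))"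


section \<open>Free groups and finite presentations\<close>

text \<open>A letter \<open>(x, True)\<close> stands for the generator \<open>x\<close> and \<open>(x, False)\<close> for its formal inverse.\<close>

type_synonym 'x word = "('x \<times> bool) list"

definition words :: "'x set \<Rightarrow> 'x word set" where
  "words S = lists (S \<times> UNIV)"

inductive free_equiv :: "'x set \<Rightarrow> 'x word \<Rightarrow> 'x word \<Rightarrow> bool" for S where
  cancel: "\<lbrakk>u \<in> words S; v \<in> words S; x \<in> S\<rbrakk>
             \<Longrightarrow> free_equiv S (u @ [(x, e), (x, \<not> e)] @ v) (u @ v)"
| refl: "u \<in> words S \<Longrightarrow> free_equiv S u u"
| sym: "free_equiv S u v \<Longrightarrow> free_equiv S v u"
| trans: "\<lbrakk>free_equiv S u v; free_equiv S v w\<rbrakk> \<Longrightarrow> free_equiv S u w"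

definition free_rel :: "'x set \<Rightarrow> ('x word \<times> 'x word) set" where
  "free_rel S = {(u, v). free_equiv S u v}"

definition free_group :: "'x set \<Rightarrow> 'x word set monoid" where
  "free_group S = \<lparr>carrier = words S // free_rel S,
                   mult = (\<lambda>A B. \<Union>u\<in>A. \<Union>v\<in>B. free_rel S `` {u @ v}),
                   one = free_rel S `` {[]}\<rparr>"

definition normal_closure :: "('a, 'b) monoid_scheme \<Rightarrow> 'a set \<Rightarrow> 'a set" where
  "normal_closure G R = \<Inter>{N. N \<lhd> G \<and> R \<subseteq> N}"

text \<open>Generators may be taken from the initial segments of the naturals, since the free group
  depends only on the cardinality of its basis.\<close>

definition finitely_presented :: "('a, 'b) monoid_scheme \<Rightarrow> bool" where
  "finitely_presented G \<longleftrightarrow> (\<exists>(n :: nat) R. finite R \<and> R \<subseteq> carrier (free_group {..<n}) \<and>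
     G \<cong> free_group {..<n} Mod normal_closure (free_group {..<n}) R)"

lemma free_equiv_words:
  assumes "free_equiv S u v"
  shows "u \<in> words S \<and> v \<in> words S"
  using assms by induction (auto simp: words_def)

lemma free_equiv_append_left:
  assumes "free_equiv S u v" "w \<in> words S"
  shows "free_equiv S (w @ u) (w @ v)"
  using assms
proof (induction)
  case (cancel u v x e)
  then have "free_equiv S ((w @ u) @ [(x, e), (x, \<not> e)] @ v) ((w @ u) @ v)"
    by (intro free_equiv.cancel) (auto simp: words_def)
  then show ?case by simp
next
  case (refl u)
  then show ?case by (intro free_equiv.refl) (simp add: words_def)
next
  case (sym u v)
  then show ?case by (simp add: free_equiv.sym)
next
  case (trans u v w')
  from trans.IH(1)[OF trans.prems] trans.IH(2)[OF trans.prems]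
  show ?case by (rule free_equiv.trans)
qed

lemma free_equiv_append_right:
  assumes "free_equiv S u v" "w \<in> words S"
  shows "free_equiv S (u @ w) (v @ w)"
  using assms
proof (induction)
  case (cancel u v x e)
  then have "free_equiv S (u @ [(x, e), (x, \<not> e)] @ (v @ w)) (u @ (v @ w))"
    by (intro free_equiv.cancel) (auto simp: words_def)
  then show ?case by simp
next
  case (refl u)
  then show ?case by (intro free_equiv.refl) (simp add: words_def)
next
  case (sym u v)
  then show ?case by (simp add: free_equiv.sym)
next
  case (trans u v w')
  from trans.IH(1)[OF trans.prems] trans.IH(2)[OF trans.prems]
  show ?case by (rule free_equiv.trans)
qed

lemma free_equiv_append:
  assumes "free_equiv S u u'" "free_equiv S v v'"
  shows "free_equiv S (u @ v) (u' @ v')"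
proof (rule free_equiv.trans)
  show "free_equiv S (u @ v) (u' @ v)"
    using assms free_equiv_words by (intro free_equiv_append_right) auto
  show "free_equiv S (u' @ v) (u' @ v')"
    using assms free_equiv_words by (intro free_equiv_append_left) auto
qed

lemma equiv_free_rel: "equiv (words S) (free_rel S)"
proof (rule equivI)
  show "free_rel S \<subseteq> words S \<times> words S"
    by (auto simp: free_rel_def dest: free_equiv_words)
  show "refl_on (words S) (free_rel S)"
    by (auto simp: refl_on_def free_rel_def dest: free_equiv_words intro: free_equiv.refl)
  show "sym (free_rel S)"
    by (rule symI) (simp add: free_rel_def free_equiv.sym)
  show "trans (free_rel S)"
    by (rule transI) (simp add: free_rel_def, rule free_equiv.trans)
qed

lemma free_rel_class_eq_iff:
  assumes "u \<in> words S" "v \<in> words S"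
  shows "free_rel S `` {u} = free_rel S `` {v} \<longleftrightarrow> free_equiv S u v"
  using eq_equiv_class_iff[OF equiv_free_rel assms] by (simp add: free_rel_def)

lemma free_group_mult:
  assumes "u \<in> words S" "v \<in> words S"
  shows "free_rel S `` {u} \<otimes>\<^bsub>free_group S\<^esub> free_rel S `` {v} = free_rel S `` {u @ v}"
proof -
  have "congruent2 (free_rel S) (free_rel S) (\<lambda>u v. free_rel S `` {u @ v})"
  proof (rule congruent2I')
    fix u u' v v' assume "(u, u') \<in> free_rel S" "(v, v') \<in> free_rel S"
    then have "free_equiv S (u @ v) (u' @ v')"
      by (simp add: free_rel_def free_equiv_append)
    then show "free_rel S `` {u @ v} = free_rel S `` {u' @ v'}"
      using free_equiv_words free_rel_class_eq_iff by blast
  qed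
  then show ?thesis
    using UN_equiv_class2[OF equiv_free_rel equiv_free_rel] assms
    by (simp add: free_group_def)
qed

lemma carrier_free_group: "carrier (free_group S) = (\<lambda>u. free_rel S `` {u}) ` words S"
  by (auto simp: free_group_def quotient_def)

lemma one_free_group: "\<one>\<^bsub>free_group S\<^esub> = free_rel S `` {[]}"
  by (simp add: free_group_def)

lemma free_equiv_inverse:
  assumes "u \<in> words S"
  shows "free_equiv S (rev (map (\<lambda>(x, e). (x, \<not> e)) u) @ u) []"
  using assms
proof (induction u)
  case Nil
  then show ?case by (auto intro: free_equiv.refl simp: words_def)
next
  case (Cons l u)
  obtain x e where l: "l = (x, e)" by (cases l)
  let ?v = "rev (map (\<lambda>(x, e). (x, \<not> e)) u)"
  have u: "u \<in> words S" "?v \<in> words S" and x: "x \<in> S"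
    using Cons.prems l by (auto simp: words_def)
  have "free_equiv S (?v @ [(x, \<not> e), (x, \<not> \<not> e)] @ u) (?v @ u)"
    by (rule free_equiv.cancel[OF u(2,1) x])
  then have "free_equiv S (?v @ [(x, \<not> e), (x, \<not> \<not> e)] @ u) []"
    using Cons.IH[OF u(1)] by (rule free_equiv.trans)
  then show ?case by (simp add: l)
qed

lemma group_free_group: "group (free_group S)"
proof (rule groupI)
  have app: "u @ v \<in> words S" if "u \<in> words S" "v \<in> words S" for u v :: "'a word"
    using that by (simp add: words_def)
  have Nil: "[] \<in> words S" by (simp add: words_def)
  show "A \<otimes>\<^bsub>free_group S\<^esub> B \<in> carrier (free_group S)"
    if "A \<in> carrier (free_group S)" "B \<in> carrier (free_group S)" for A B
    using that app by (auto simp: carrier_free_group free_group_mult)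
  show "\<one>\<^bsub>free_group S\<^esub> \<in> carrier (free_group S)"
    using Nil by (auto simp: carrier_free_group one_free_group)
  show "A \<otimes>\<^bsub>free_group S\<^esub> B \<otimes>\<^bsub>free_group S\<^esub> C = A \<otimes>\<^bsub>free_group S\<^esub> (B \<otimes>\<^bsub>free_group S\<^esub> C)"
    if "A \<in> carrier (free_group S)" "B \<in> carrier (free_group S)" "C \<in> carrier (free_group S)"
    for A B C
    using that app by (auto simp: carrier_free_group free_group_mult)
  show "\<one>\<^bsub>free_group S\<^esub> \<otimes>\<^bsub>free_group S\<^esub> A = A" if "A \<in> carrier (free_group S)" for A
    using that Nil by (auto simp: carrier_free_group free_group_mult one_free_group)
  show "\<exists>B\<in>carrier (free_group S). B \<otimes>\<^bsub>free_group S\<^esub> A = \<one>\<^bsub>free_group S\<^esub>"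
    if A: "A \<in> carrier (free_group S)" for A
  proof -
    obtain u where u: "u \<in> words S" "A = free_rel S `` {u}"
      using A by (auto simp: carrier_free_group)
    let ?v = "rev (map (\<lambda>(x, e). (x, \<not> e)) u)"
    have v: "?v \<in> words S" using u(1) by (auto simp: words_def)
    have "free_rel S `` {?v} \<otimes>\<^bsub>free_group S\<^esub> A = free_rel S `` {?v @ u}"
      by (simp only: u(2) free_group_mult[OF v u(1)])
    also have "\<dots> = \<one>\<^bsub>free_group S\<^esub>"
      using free_equiv_inverse[OF u(1)]
      by (simp add: one_free_group free_rel_class_eq_iff[OF app[OF v u(1)] Nil])
    finally show ?thesis using v by (auto simp: carrier_free_group)
  qed
qed

lemma (in group) normal_carrier: "carrier G \<lhd> G"
  by (rule normal_invI) (auto simp: subgroup_self)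

lemma (in group) normal_closure_normal:
  assumes "R \<subseteq> carrier G"
  shows "normal_closure G R \<lhd> G" and "R \<subseteq> normal_closure G R"
proof -
  show "normal_closure G R \<lhd> G"
  proof (rule normal_invI)
    show "subgroup (normal_closure G R) G"
      unfolding normal_closure_def
      using assms normal_carrier by (intro subgroups_Inter) (auto simp: normal_imp_subgroup)
    show "x \<otimes> h \<otimes> inv x \<in> normal_closure G R"
      if "x \<in> carrier G" "h \<in> normal_closure G R" for x h
      using that normal_invE(2) by (auto simp: normal_closure_def)
  qed
  show "R \<subseteq> normal_closure G R"
    by (auto simp: normal_closure_def)
qed


section \<open>The group \<open>G\<^sub>0\<close> of homeomorphisms of the line\<close>

definition homeo_group :: "('a :: topological_space \<Rightarrow> 'a) monoid" where
  "homeo_group = \<lparr>carrier = {f. \<exists>g. homeomorphism UNIV UNIV f g}, mult = (\<circ>), one = id\<rparr>"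

definition map_a :: "real \<Rightarrow> real" where
  "map_a t = t + 1"

definition map_b :: "real \<Rightarrow> real" where
  "map_b t = (if t \<le> 0 then t
              else if t \<le> 1/2 then t / (1 - t)
              else if t \<le> 1 then 3 - 1 / t
              else t + 1)"

definition map_c :: "real \<Rightarrow> real" where
  "map_c t = (if 0 \<le> t \<and> t \<le> 1 then 2 * t / (1 + t) else t)"

definition G0 :: "(real \<Rightarrow> real) monoid" where
  "G0 = subgroup_generated homeo_group {map_a, map_b, map_c}"

lemma group_homeo_group: "group (homeo_group :: ('a :: topological_space \<Rightarrow> 'a) monoid)"
proof (rule groupI)
  fix f g h :: "'a \<Rightarrow> 'a"
  assume f: "f \<in> carrier homeo_group"
  then obtain f' where f': "homeomorphism UNIV UNIV f f'"
    by (auto simp: homeo_group_def)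
  show "\<one>\<^bsub>homeo_group\<^esub> \<otimes>\<^bsub>homeo_group\<^esub> f = f"
    by (simp add: homeo_group_def)
  show "\<exists>g\<in>carrier homeo_group. g \<otimes>\<^bsub>homeo_group\<^esub> f = \<one>\<^bsub>homeo_group\<^esub>"
  proof (rule bexI)
    show "f' \<in> carrier homeo_group"
      using homeomorphism_symD[OF f'] by (auto simp: homeo_group_def)
    show "f' \<otimes>\<^bsub>homeo_group\<^esub> f = \<one>\<^bsub>homeo_group\<^esub>"
      using homeomorphism_apply1[OF f'] by (simp add: homeo_group_def fun_eq_iff)
  qed
  assume "g \<in> carrier homeo_group"
  then obtain g' where g': "homeomorphism UNIV UNIV g g'"
    by (auto simp: homeo_group_def)
  show "f \<otimes>\<^bsub>homeo_group\<^esub> g \<in> carrier homeo_group"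
    using homeomorphism_compose[OF g' f'] by (auto simp: homeo_group_def)
  show "f \<otimes>\<^bsub>homeo_group\<^esub> g \<otimes>\<^bsub>homeo_group\<^esub> h = f \<otimes>\<^bsub>homeo_group\<^esub> (g \<otimes>\<^bsub>homeo_group\<^esub> h)"
    by (simp add: homeo_group_def comp_assoc)
next
  show "\<one>\<^bsub>homeo_group\<^esub> \<in> carrier (homeo_group :: ('a \<Rightarrow> 'a) monoid)"
    using homeomorphism_ident[of "UNIV :: 'a set"] by (auto simp: homeo_group_def id_def)
qed

lemma homeo_groupI:
  fixes f :: "'a :: topological_space \<Rightarrow> 'a"
  assumes "continuous_on UNIV f" "continuous_on UNIV g" "\<And>t. g (f t) = t" "\<And>t. f (g t) = t"
  shows "f \<in> carrier homeo_group"
proof -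
  have "homeomorphism UNIV UNIV f g"
    using assms by (intro homeomorphismI) auto
  then show ?thesis by (auto simp: homeo_group_def)
qed

lemma map_a_homeo: "map_a \<in> carrier homeo_group"
  by (rule homeo_groupI[where g = "\<lambda>t. t - 1"])
     (auto simp: map_a_def[abs_def] intro!: continuous_intros)

lemma map_b_homeo: "map_b \<in> carrier homeo_group"
proof (rule homeo_groupI)
  let ?g = "\<lambda>s::real. if s \<le> 0 then s else if s \<le> 1 then s / (1 + s)
              else if s \<le> 2 then 1 / (3 - s) else s - 1"
  have half: "x / (1 - x) = 3 - 1 / x" if "x * 2 = 1" for x :: real
  proof -
    have "x = 1/2" using that by simp
    then show ?thesis by (simp only:) simp
  qed
  show "continuous_on UNIV map_b"
    unfolding map_b_def[abs_def]
    by (intro continuous_on_cases_le continuous_intros) (auto simp: half)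
  show "continuous_on UNIV ?g"
    by (intro continuous_on_cases_le continuous_intros) auto
  show "?g (map_b t) = t" for t
  proof -
    consider "t \<le> 0" | "0 < t" "t \<le> 1/2" | "1/2 < t" "t \<le> 1" | "1 < t" by linarith
    then show ?thesis
    proof cases
      case 2
      define r where "r = t / (1 - t)"
      have "0 < r" "r \<le> 1" "1 + r = 1 / (1 - t)" "map_b t = r"
        using 2 by (auto simp: r_def map_b_def divide_simps)
      moreover have "r / (1 / (1 - t)) = t"
        using 2 by (simp add: r_def)
      ultimately show ?thesis by simp
    next
      case 3
      define r where "r = 3 - 1 / t"
      have "1 < r" "r \<le> 2" "1 / (3 - r) = t" "map_b t = r"
        using 3 by (auto simp: r_def map_b_def divide_simps)
      then show ?thesis by simp
    qed (auto simp: map_b_def)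
  qed
  show "map_b (?g t) = t" for t
  proof -
    consider "t \<le> 0" | "0 < t" "t \<le> 1" | "1 < t" "t \<le> 2" | "2 < t" by linarith
    then show ?thesis
    proof cases
      case 2
      define r where "r = t / (1 + t)"
      have "0 < r" "r \<le> 1/2" "1 - r = 1 / (1 + t)" "?g t = r"
        using 2 by (auto simp: r_def divide_simps)
      moreover have "r / (1 / (1 + t)) = t"
        using 2 by (simp add: r_def)
      ultimately show ?thesis by (simp add: map_b_def)
    next
      case 3
      define r where "r = 1 / (3 - t)"
      have "1/2 < r" "r \<le> 1" "3 - 1 / r = t" "?g t = r"
        using 3 by (auto simp: r_def divide_simps)
      then show ?thesis by (simp add: map_b_def)
    qed (auto simp: map_b_def)
  qed
qed

lemma map_c_homeo: "map_c \<in> carrier homeo_group"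
proof (rule homeo_groupI)
  let ?g = "\<lambda>s::real. if s \<le> 0 then s else if s \<le> 1 then s / (2 - s) else s"
  have c: "map_c = (\<lambda>t. if t \<le> 0 then t else if t \<le> 1 then 2 * t / (1 + t) else t)"
    by (auto simp: map_c_def fun_eq_iff)
  show "continuous_on UNIV map_c"
    unfolding c by (intro continuous_on_cases_le continuous_intros) auto
  show "continuous_on UNIV ?g"
    by (intro continuous_on_cases_le continuous_intros) auto
  show "?g (map_c t) = t" for t
  proof (cases "0 < t \<and> t \<le> 1")
    case True
    define r where "r = 2 * t / (1 + t)"
    have "0 < r" "r \<le> 1" "2 - r = 2 / (1 + t)" "map_c t = r"
      using True by (auto simp: r_def c divide_simps)
    moreover have "r / (2 / (1 + t)) = t"
      using True by (simp add: r_def)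
    ultimately show ?thesis by simp
  qed (auto simp: c)
  show "map_c (?g t) = t" for t
  proof (cases "0 < t \<and> t \<le> 1")
    case True
    define r where "r = t / (2 - t)"
    have "0 < r" "r \<le> 1" "1 + r = 2 / (2 - t)" "?g t = r"
      using True by (auto simp: r_def divide_simps)
    moreover have "2 * r / (2 / (2 - t)) = t"
      using True by (simp add: r_def)
    ultimately show ?thesis by (simp add: c)
  qed (auto simp: c)
qed

lemma carrier_G0: "carrier G0 = generate homeo_group {map_a, map_b, map_c}"
  by (simp add: G0_def carrier_subgroup_generated map_a_homeo map_b_homeo map_c_homeo)

lemma group_G0: "group G0"
  unfolding G0_def by (rule group.group_subgroup_generated[OF group_homeo_group])

end

theory Submission
  imports Defs
begin

text \<open>Both halves rest on one invariant. An element \<open>g\<close> of \<open>G\<^sub>0\<close> is given near a generic point by a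
  primitive integer matrix, whose determinant is a power of \<open>2\<close>, and the kernel of that matrix
  mod \<open>2\<close> is either trivial or one of three lines: it records the first edge of the path from the base
  vertex in the 3-regular tree of \<open>PGL\<^sub>2(\<rat>\<^sub>2)\<close>.

  Nonamenability: on a Foelner set \<open>F\<close>, the proportions of those \<open>g \<in> F\<close> for which the kernel of
  \<open>g\<^sup>-\<^sup>1\<close> at \<open>x\<close> is a given line are almost invariant functions of \<open>x\<close>. As the group contains elements acting
  on parts of \<open>(0, 1)\<close> as \<open>x / 2\<close> and \<open>(x + 1) / 2\<close>, one of these functions satisfies, up to a small error,
  \<open>f (x / 2) + f ((x + 1) / 2) \<ge> 1 + f x\<close> with \<open>0 \<le> f \<le> 1\<close>; integrating over the doubling map gives
  \<open>f \<approx> 1\<close> in the mean, which moving by \<open>b\<close> contradicts because it permutes the three lines.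

  Finite presentation: the presented group is generated by Thompson's group \<open>\<langle>a, b\<rangle>\<close> and the conjugates of
  \<open>c\<close> and its inverse attached to the Farey intervals. Such a letter moves every point of its interval along
  one edge of the tree. After subdivision to a common level, letters that move towards the base vertex cancel
  against earlier ones, so every element is a product in which all letters move away from it. If such an
  element acts trivially then no letter occurs, and it lies in Thompson's group, where normal forms in positive
  words are faithful.\<close>

section \<open>Integer fractional linear maps\<close>

text \<open>If \<open>K\<close> has determinant 2, precomposing with it replaces the kernel line by
  the kernel of \<open>K\<close> mod 2, unless the old line is the image of \<open>K\<close> mod 2.
  The two branches of the doubling map have the line of \<open>(1, 0)\<close> as common kernel and
  the other two lines as images; since an element has at most one kernel line, this produces the
  term \<open>1 + f x\<close> of the inequality.

  The obstacle in the second half is that a subdivided letter consists of letters of both signs and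
  of uneven length, so it is not evident that two letters undoing each other on a common interval
  have matching pieces. The end point at which a letter is anchored, reduced mod 2, decides this.
  All pieces of a letter have the class of its anchor, and this class together with the depth
  determines the pieces (\<open>lev\<close>, \<open>set_expand\<close>). Letters that move towards
  the base vertex after the same element are anchored in the kernel of that element; so they have
  the same class wherever they overlap, and their pieces agree there. Hence one subdivision
  relation, the commutation of letters with disjoint intervals and the conjugation of letters by
  \<open>a\<close> and \<open>b\<close> are enough.\<close>

datatype mat = Mat int int int int

fun mmul :: "mat \<Rightarrow> mat \<Rightarrow> mat" where
  "mmul (Mat a b c d) (Mat a' b' c' d') =
     Mat (a * a' + b * c') (a * b' + b * d') (c * a' + d * c') (c * b' + d * d')"

fun mdet :: "mat \<Rightarrow> int" where
  "mdet (Mat a b c d) = a * d - b * c"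

text \<open>Only reduction mod 2 is ever used, so primitivity is required at the prime 2
  alone.\<close>

fun odd_mat :: "mat \<Rightarrow> bool" where
  "odd_mat (Mat a b c d) \<longleftrightarrow> \<not> (even a \<and> even b \<and> even c \<and> even d)"

fun mker :: "mat \<Rightarrow> int \<times> int \<Rightarrow> bool" where
  "mker (Mat a b c d) (u, v) \<longleftrightarrow> even (a * u + b * v) \<and> even (c * u + d * v)"

text \<open>The formula is stated without division, which keeps compositions and comparisons
  polynomial identities.\<close>

fun moebius_on :: "(real \<Rightarrow> real) \<Rightarrow> real set \<Rightarrow> mat \<Rightarrow> bool" where
  "moebius_on g U (Mat a b c d) \<longleftrightarrow> a * d \<noteq> b * c \<and>
     (\<forall>t\<in>U. of_int c * t + of_int d \<noteq> 0 \<and> g t * (of_int c * t + of_int d) = of_int a * t + of_int b)"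

lemma moebius_on_subset: "moebius_on g U M \<Longrightarrow> V \<subseteq> U \<Longrightarrow> moebius_on g V M"
  by (cases M) auto

lemma moebius_on_cong: "(\<And>t. t \<in> U \<Longrightarrow> g t = h t) \<Longrightarrow> moebius_on g U M = moebius_on h U M"
  by (cases M) auto

lemma moebius_on_compose:
  assumes "moebius_on h U H" "moebius_on g V K" "h ` U \<subseteq> V"
  shows "moebius_on (g \<circ> h) U (mmul K H)"
proof -
  obtain a b c d where H: "H = Mat a b c d" by (cases H)
  obtain a' b' c' d' where K: "K = Mat a' b' c' d'" by (cases K)
  have "(a' * a + b' * c) * (c' * b + d' * d) - (a' * b + b' * d) * (c' * a + d' * c)
      = (a' * d' - b' * c') * (a * d - b * c)" by algebra
  also have "\<dots> \<noteq> 0" using assms(1,2) by (simp add: H K)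
  finally have det: "(a' * a + b' * c) * (c' * b + d' * d) \<noteq> (a' * b + b' * d) * (c' * a + d' * c)"
    by simp
  have "of_int (c' * a + d' * c) * t + of_int (c' * b + d' * d) \<noteq> 0 \<and>
      g (h t) * (of_int (c' * a + d' * c) * t + of_int (c' * b + d' * d))
        = of_int (a' * a + b' * c) * t + of_int (a' * b + b' * d)" if t: "t \<in> U" for t
  proof -
    have 1: "of_int c * t + of_int d \<noteq> 0" "h t * (of_int c * t + of_int d) = of_int a * t + of_int b"
      using assms(1) t by (auto simp: H)
    have 2: "of_int c' * h t + of_int d' \<noteq> 0"
      "g (h t) * (of_int c' * h t + of_int d') = of_int a' * h t + of_int b'"
      using assms(2,3) t by (auto simp: K)
    have 3: "of_int (c' * a + d' * c) * t + of_int (c' * b + d' * d)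
        = (of_int c' * h t + of_int d') * (of_int c * t + of_int d)"
      unfolding distrib_right[of "of_int c' * h t"] mult.assoc 1(2) by (simp add: algebra_simps)
    have 4: "of_int (a' * a + b' * c) * t + of_int (a' * b + b' * d)
        = (of_int a' * h t + of_int b') * (of_int c * t + of_int d)"
      unfolding distrib_right[of "of_int a' * h t"] mult.assoc 1(2) by (simp add: algebra_simps)
    show ?thesis
      unfolding 3 4 using 1(1) 2 by (simp add: mult.assoc[symmetric])
  qed
  then show ?thesis
    using det by (simp add: H K)
qed

text \<open>Halving an even matrix keeps the map and divides the determinant by 4, so it can be
  repeated only finitely often.\<close>

lemma moebius_on_odd_mat:
  assumes "moebius_on g U M"
  shows "\<exists>M'. moebius_on g U M' \<and> odd_mat M'"
  using assms
proof (induction "nat \<bar>mdet M\<bar>" arbitrary: M rule: less_induct)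
  case less
  obtain a b c d where M: "M = Mat a b c d" by (cases M)
  show ?case
  proof (cases "odd_mat M")
    case False
    then obtain a' b' c' d' where e: "a = 2 * a'" "b = 2 * b'" "c = 2 * c'" "d = 2 * d'"
      by (auto simp: M elim!: evenE)
    have det: "a' * d' \<noteq> b' * c'"
      using less.prems by (auto simp: M e)
    have "moebius_on g U (Mat a' b' c' d')"
      using less.prems det by (auto simp: M e algebra_simps)
    moreover have "nat \<bar>mdet (Mat a' b' c' d')\<bar> < nat \<bar>mdet M\<bar>"
    proof -
      have "mdet M = 4 * mdet (Mat a' b' c' d')" by (simp add: M e)
      moreover have "mdet (Mat a' b' c' d') \<noteq> 0" using det by simp
      ultimately show ?thesis by (simp add: abs_mult)
    qed
    ultimately show ?thesis using less.hyps by blast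
  qed (use less.prems in blast)
qed

lemma quadratic_zero_on_infinite:
  fixes p q r :: real
  assumes "infinite U" "\<And>t. t \<in> U \<Longrightarrow> p * t\<^sup>2 + q * t + r = 0"
  shows "p = 0 \<and> q = 0 \<and> r = 0"
proof -
  have "U \<subseteq> {t. poly [:r, q, p:] t = 0}"
    using assms(2) by (auto simp: power2_eq_square algebra_simps)
  then have "[:r, q, p:] = 0"
    using assms(1) poly_roots_finite finite_subset by blast
  then show ?thesis by simp
qed

text \<open>Cross-multiplying the two formulas for \<open>g t\<close> gives a polynomial of degree
  at most 2 that vanishes on the infinite set \<open>U\<close>, so its coefficients vanish.\<close>

lemma moebius_on_proportional:
  assumes "moebius_on g U (Mat a b c d)" "moebius_on g U (Mat a' b' c' d')" "infinite U"
  shows "\<exists>x y. x \<noteq> 0 \<and> y \<noteq> 0 \<and> x * a' = y * a \<and> x * b' = y * b \<and> x * c' = y * c \<and> x * d' = y * d"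
proof -
  have "real_of_int (a * c' - a' * c) * t\<^sup>2 + real_of_int (a * d' + b * c' - a' * d - b' * c) * t
      + real_of_int (b * d' - b' * d) = 0" if "t \<in> U" for t
  proof -
    have 1: "of_int c * t + of_int d \<noteq> 0" "g t * (of_int c * t + of_int d) = of_int a * t + of_int b"
      "of_int c' * t + of_int d' \<noteq> 0" "g t * (of_int c' * t + of_int d') = of_int a' * t + of_int b'"
      using assms(1,2) that by auto
    have "(of_int a * t + of_int b) * (of_int c' * t + of_int d')
        = (of_int a' * t + of_int b') * (of_int c * t + of_int d)"
      unfolding 1(2)[symmetric] 1(4)[symmetric] by simp
    then show ?thesis by (simp add: algebra_simps power2_eq_square)
  qed
  from quadratic_zero_on_infinite[OF assms(3) this]
  have "real_of_int (a * c' - a' * c) = 0" "real_of_int (a * d' + b * c' - a' * d - b' * c) = 0"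
    "real_of_int (b * d' - b' * d) = 0" by auto
  then have e: "a * c' = a' * c" "a * d' + b * c' = a' * d + b' * c" "b * d' = b' * d"
    unfolding of_int_eq_0_iff by auto
  \<comment> \<open>If the second matrix is \<open>r\<close> times the first, then
    \<open>?y = r * ?x\<close>: the scalar is a mixed determinant over the determinant.\<close>
  let ?x = "a * d - b * c" and ?y = "a' * d - b' * c"
  have x: "?x \<noteq> 0" using assms(1) by simp
  have ab: "a * b' * ?x = a' * b * ?x" using e by algebra
  have cd: "c * d' * ?x = c' * d * ?x" using e by algebra
  have ab: "a * b' = a' * b" and cd: "c * d' = c' * d" using ab cd x by auto
  have p: "?x * a' = ?y * a" "?x * b' = ?y * b" "?x * c' = ?y * c" "?x * d' = ?y * d"
    using e ab cd by algebra+
  moreover have "?y \<noteq> 0"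
  proof
    assume "?y = 0"
    then have "a' = 0" "b' = 0" "c' = 0" "d' = 0" using p x by auto
    then show False using assms(2) by simp
  qed
  ultimately show ?thesis using x by blast
qed

text \<open>After division by the gcd the scalars are coprime, so one is odd. If the other were
  even, one of the two matrices would be even. So both are odd and the matrices agree mod 2.\<close>

lemma mker_scaled:
  fixes x y :: int
  assumes "x \<noteq> 0" "y \<noteq> 0" "x * a' = y * a" "x * b' = y * b" "x * c' = y * c" "x * d' = y * d"
    and "odd_mat (Mat a b c d)" "odd_mat (Mat a' b' c' d')"
  shows "mker (Mat a b c d) v = mker (Mat a' b' c' d') v"
proof -
  obtain x' y' where xy: "x = gcd x y * x'" "y = gcd x y * y'" "coprime x' y'"
    using gcd_coprime_exists[of x y] assms(1) by (metis gcd_eq_0_iff mult.commute)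
  let ?g = "gcd x y"
  have g: "?g \<noteq> 0" using assms(1) by simp
  have cancel: "x' * m' = y' * m" if "x * m' = y * m" for m m' :: int
  proof -
    have "?g * (x' * m') = ?g * (y' * m)" using that xy(1,2) by (metis mult.assoc)
    then show ?thesis using g by (metis mult_cancel_left)
  qed
  have p: "x' * a' = y' * a" "x' * b' = y' * b" "x' * c' = y' * c" "x' * d' = y' * d"
    using assms(3-6) cancel by auto
  have "even (x' * a') = even (y' * a)" "even (x' * b') = even (y' * b)" 
    "even (x' * c') = even (y' * c)" "even (x' * d') = even (y' * d)" using p by auto
  moreover have "odd x' \<or> odd y'"
    using xy(3) by (meson coprime_common_divisor odd_one)
  ultimately have "even a' = even a" "even b' = even b" "even c' = even c" "even d' = even d"
    using assms(7,8) by auto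
  then show ?thesis by (cases v) simp
qed

lemma mker_unique:
  assumes "moebius_on g U M" "moebius_on g U M'" "odd_mat M" "odd_mat M'" "infinite U"
  shows "mker M v = mker M' v"
proof -
  obtain a b c d where M: "M = Mat a b c d" by (cases M)
  obtain a' b' c' d' where M': "M' = Mat a' b' c' d'" by (cases M')
  from moebius_on_proportional[of g U a b c d a' b' c' d'] assms
  obtain x y where "x \<noteq> 0" "y \<noteq> 0" "x * a' = y * a" "x * b' = y * b" "x * c' = y * c" "x * d' = y * d"
    by (auto simp: M M')
  from mker_scaled[OF this] show ?thesis using assms by (simp add: M M')
qed

section \<open>The kernel line of a map near a point\<close>

definition ker_at :: "(real \<Rightarrow> real) \<Rightarrow> real \<Rightarrow> int \<times> int \<Rightarrow> bool" where
  "ker_at g x v \<longleftrightarrow> (\<exists>U M. open U \<and> x \<in> U \<and> moebius_on g U M \<and> odd_mat M \<and> mker M v)"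

lemma ker_at_unique:
  assumes "open U" "x \<in> U" "moebius_on g U M" "odd_mat M" "ker_at g x v"
  shows "mker M v"
proof -
  obtain V M' where V: "open V" "x \<in> V" "moebius_on g V M'" "odd_mat M'" "mker M' v"
    using assms(5) unfolding ker_at_def by blast
  have "infinite (U \<inter> V)"
    using finite_imp_not_open[of "U \<inter> V"] open_Int[OF assms(1) V(1)] assms(2) V(2) by blast
  moreover have "moebius_on g (U \<inter> V) M" "moebius_on g (U \<inter> V) M'"
    using moebius_on_subset[OF assms(3)] moebius_on_subset[OF V(3)] by auto
  ultimately show ?thesis
    using mker_unique[of g "U \<inter> V" M M' v] assms(4) V(4,5) by simp
qed

text \<open>Two distinct nonzero vectors span the plane mod 2, so a matrix that kills both is
  even.\<close>

lemma ker_at_not_both: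
  assumes "ker_at g x (1, 0)" "ker_at g x (0, 1)" shows False
proof -
  obtain U M where U: "open U" "x \<in> U" "moebius_on g U M" "odd_mat M" "mker M (1, 0)"
    using assms(1) unfolding ker_at_def by blast
  with ker_at_unique[OF U(1-4) assms(2)] show False by (cases M) auto
qed

lemma ker_at_not_both':
  assumes "ker_at g x (1, 1)" "ker_at g x (0, 1) \<or> ker_at g x (1, 0)" shows False
proof -
  obtain U M where U: "open U" "x \<in> U" "moebius_on g U M" "odd_mat M" "mker M (1, 1)"
    using assms(1) unfolding ker_at_def by blast
  from assms(2) have "mker M (0, 1) \<or> mker M (1, 0)"
    using ker_at_unique[OF U(1-4)] by auto
  with U(4,5) show False by (cases M) auto
qed

text \<open>This makes the proportions of kernel lines over a Foelner set measurable functions of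
  the point.\<close>

lemma open_ker_at: "open {x. ker_at g x v}"
proof -
  have "{x. ker_at g x v} = \<Union>{U. open U \<and> (\<exists>M. moebius_on g U M \<and> odd_mat M \<and> mker M v)}"
    unfolding ker_at_def by blast
  also have "open \<dots>" by (rule open_Union) simp
  finally show ?thesis .
qed

section \<open>Piecewise fractional linear homeomorphisms with rational break points\<close>

definition piecewise_moebius :: "(real \<Rightarrow> real) \<Rightarrow> bool" where
  "piecewise_moebius g \<longleftrightarrow> (\<exists>B. finite B \<and> B \<subseteq> \<rat> \<and>
     (\<forall>u v. u < v \<longrightarrow> {u<..<v} \<inter> B = {} \<longrightarrow> (\<exists>M. moebius_on g {u<..<v} M)))"

text \<open>The inverse is carried along to make the notion symmetric. Preservation of the rationals
  keeps break points rational under composition; rational break points are what sufficiently small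
  Farey intervals avoid (\<open>cone_avoid\<close>).\<close>

definition pp_homeo :: "(real \<Rightarrow> real) \<Rightarrow> (real \<Rightarrow> real) \<Rightarrow> bool" where
  "pp_homeo g h \<longleftrightarrow> g \<circ> h = id \<and> h \<circ> g = id \<and> strict_mono g \<and> strict_mono h \<and>
     g ` \<rat> \<subseteq> \<rat> \<and> h ` \<rat> \<subseteq> \<rat> \<and> piecewise_moebius g \<and> piecewise_moebius h"

lemma pp_homeo_sym: "pp_homeo g h \<Longrightarrow> pp_homeo h g"
  by (auto simp: pp_homeo_def)

lemma piecewise_moebius_compose:
  assumes g: "piecewise_moebius g" and h: "pp_homeo h h'"
  shows "piecewise_moebius (g \<circ> h)"
proof -
  obtain B where B: "finite B" "B \<subseteq> \<rat>"
    "\<And>u v. u < v \<Longrightarrow> {u<..<v} \<inter> B = {} \<Longrightarrow> \<exists>M. moebius_on g {u<..<v} M"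
    using g by (auto simp: piecewise_moebius_def)
  obtain D where D: "finite D" "D \<subseteq> \<rat>"
    "\<And>u v. u < v \<Longrightarrow> {u<..<v} \<inter> D = {} \<Longrightarrow> \<exists>M. moebius_on h {u<..<v} M"
    using h by (auto simp: piecewise_moebius_def pp_homeo_def)
  have mono: "strict_mono h" and inv: "h' \<circ> h = id" and rat: "h' ` \<rat> \<subseteq> \<rat>"
    using h by (auto simp: pp_homeo_def)
  have "\<exists>M. moebius_on (g \<circ> h) {u<..<v} M"
    if uv: "u < v" "{u<..<v} \<inter> (D \<union> h' ` B) = {}" for u v
  proof -
    obtain H where H: "moebius_on h {u<..<v} H" using D(3) uv by blast
    have sub: "h ` {u<..<v} \<subseteq> {h u<..<h v}"
      using mono by (auto simp: strict_mono_def)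
    have "{h u<..<h v} \<inter> B = {}"
    proof (rule ccontr)
      assume "{h u<..<h v} \<inter> B \<noteq> {}"
      then obtain y where y: "h u < y" "y < h v" "y \<in> B" by auto
      have hh: "h (h' y) = y" using h by (auto simp: pp_homeo_def fun_eq_iff)
      then have "u < h' y" "h' y < v" using y mono by (metis strict_mono_less)+
      then show False using uv(2) y(3) by auto
    qed
    moreover have "h u < h v" using mono uv(1) by (simp add: strict_mono_def)
    ultimately obtain K where "moebius_on g {h u<..<h v} K" using B(3) by blast
    then show ?thesis using moebius_on_compose[OF H _ sub] by blast
  qed
  moreover have "finite (D \<union> h' ` B)" "D \<union> h' ` B \<subseteq> \<rat>" using B(1,2) D(1,2) rat by auto
  ultimately show ?thesis unfolding piecewise_moebius_def by blast
qed

lemma pp_homeo_compose: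
  assumes "pp_homeo g g'" "pp_homeo h h'"
  shows "pp_homeo (g \<circ> h) (h' \<circ> g')"
proof -
  have "piecewise_moebius (g \<circ> h)" "piecewise_moebius (h' \<circ> g')"
    using assms pp_homeo_sym piecewise_moebius_compose by (auto simp: pp_homeo_def)
  moreover have "g \<circ> h \<circ> (h' \<circ> g') = id" "h' \<circ> g' \<circ> (g \<circ> h) = id"
    using assms by (auto simp: pp_homeo_def fun_eq_iff)
  ultimately show ?thesis
    using assms by (auto simp: pp_homeo_def strict_mono_def image_subset_iff)
qed

lemma pp_homeoI:
  assumes "\<And>t. g (h t) = t" "\<And>t. h (g t) = t" "strict_mono g" "g ` \<rat> \<subseteq> \<rat>" "h ` \<rat> \<subseteq> \<rat>"
    "piecewise_moebius g" "piecewise_moebius h"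
  shows "pp_homeo g h"
proof -
  have "strict_mono h"
  proof (rule strict_monoI, rule ccontr)
    fix x y assume "x < y" "\<not> h x < h y"
    then have "g (h y) \<le> g (h x)"
      using assms(3) by (metis not_less strict_mono_less_eq)
    then show False using \<open>x < y\<close> assms(1) by simp
  qed
  then show ?thesis using assms unfolding pp_homeo_def by (auto simp: fun_eq_iff)
qed

section \<open>The generators as piecewise fractional linear homeomorphisms\<close>

definition inv_b :: "real \<Rightarrow> real" where
  "inv_b t = (if t \<le> 0 then t else if t \<le> 1 then t / (1 + t) else if t \<le> 2 then 1 / (3 - t) else t - 1)"

definition inv_c :: "real \<Rightarrow> real" where
  "inv_c t = (if 0 \<le> t \<and> t \<le> 1 then t / (2 - t) else t)"

lemma map_b_inv_b: "map_b (inv_b t) = t"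
proof -
  consider "t \<le> 0" | "0 < t" "t \<le> 1" | "1 < t" "t \<le> 2" | "2 < t" by linarith
  then show ?thesis
  proof cases
    case 2
    then have "0 < t / (1 + t)" "t / (1 + t) \<le> 1/2" "inv_b t = t / (1 + t)"
      by (auto simp: inv_b_def divide_simps)
    moreover have "t / (1 + t) / (1 - t / (1 + t)) = t"
      using 2 by (simp add: field_simps)
    ultimately show ?thesis by (simp add: map_b_def)
  next
    case 3
    then have "1/2 < 1 / (3 - t)" "1 / (3 - t) \<le> 1" "inv_b t = 1 / (3 - t)"
      by (auto simp: inv_b_def divide_simps)
    then show ?thesis using 3 by (simp add: map_b_def)
  qed (auto simp: map_b_def inv_b_def)
qed

lemma inv_b_map_b: "inv_b (map_b t) = t"
proof -
  consider "t \<le> 0" | "0 < t" "t \<le> 1/2" | "1/2 < t" "t \<le> 1" | "1 < t" by linarith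
  then show ?thesis
  proof cases
    case 2
    then have "0 < t / (1 - t)" "t / (1 - t) \<le> 1" "map_b t = t / (1 - t)"
      by (auto simp: map_b_def divide_simps)
    moreover have "t / (1 - t) / (1 + t / (1 - t)) = t"
      using 2 by (simp add: field_simps)
    ultimately show ?thesis by (simp add: inv_b_def)
  next
    case 3
    then have "1 < 3 - 1 / t" "3 - 1 / t \<le> 2" "map_b t = 3 - 1 / t"
      by (auto simp: map_b_def divide_simps)
    then show ?thesis using 3 by (simp add: inv_b_def)
  qed (auto simp: map_b_def inv_b_def)
qed

lemma map_c_inv_c: "map_c (inv_c t) = t"
proof (cases "0 \<le> t \<and> t \<le> 1")
  case True
  then have "0 \<le> t / (2 - t)" "t / (2 - t) \<le> 1" "inv_c t = t / (2 - t)"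
    by (auto simp: inv_c_def divide_simps)
  moreover have "2 * (t / (2 - t)) / (1 + t / (2 - t)) = t"
    using True by (simp add: field_simps)
  ultimately show ?thesis by (simp add: map_c_def)
qed (auto simp: map_c_def inv_c_def)

lemma inv_c_map_c: "inv_c (map_c t) = t"
proof (cases "0 \<le> t \<and> t \<le> 1")
  case True
  then have "0 \<le> 2 * t / (1 + t)" "2 * t / (1 + t) \<le> 1" "map_c t = 2 * t / (1 + t)"
    by (auto simp: map_c_def divide_simps)
  moreover have "2 * t / (1 + t) / (2 - 2 * t / (1 + t)) = t"
    using True by (simp add: field_simps)
  ultimately show ?thesis by (simp add: inv_c_def)
qed (auto simp: map_c_def inv_c_def)

lemma strict_mono_glue:
  fixes f :: "real \<Rightarrow> real"
  assumes "\<And>x y. x < y \<Longrightarrow> y \<le> p \<Longrightarrow> f x < f y" "\<And>x y. p \<le> x \<Longrightarrow> x < y \<Longrightarrow> f x < f y" "x < y"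
  shows "f x < f y"
proof -
  consider "y \<le> p" | "p \<le> x" | "x < p" "p < y" by linarith
  then show ?thesis
    by cases (use assms order_less_trans[of "f x" "f p" "f y"] in auto)
qed

lemma strict_mono_map_b: "strict_mono map_b"
proof -
  have 1: "map_b x < map_b y" if "x < y" "y \<le> 0" for x y using that by (simp add: map_b_def)
  have 2: "map_b x < map_b y" if "0 \<le> x" "x < y" "y \<le> 1/2" for x y
    using that frac_less[of x y "1 - y" "1 - x"] by (auto simp: map_b_def)
  have 3: "map_b x < map_b y" if "1/2 \<le> x" "x < y" "y \<le> 1" for x y
  proof -
    have "map_b z = 3 - 1 / z" if "1/2 \<le> z" "z \<le> 1" for z
    proof (cases "z = 1/2")
      case True show ?thesis unfolding True by (simp add: map_b_def)
    qed (use that in \<open>auto simp: map_b_def\<close>)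
    then have "map_b x = 3 - 1 / x" "map_b y = 3 - 1 / y" using that by auto
    moreover have "1 / y < 1 / x" using that by (simp add: frac_less2)
    ultimately show ?thesis by simp
  qed
  have 4: "map_b x < map_b y" if "1 \<le> x" "x < y" for x y
    using that by (auto simp: map_b_def)
  have "map_b x < map_b y" if "x < y" "y \<le> 1/2" for x y
  proof (cases "y \<le> 0 \<or> 0 \<le> x")
    case False
    then have "map_b x < map_b 0" "map_b 0 < map_b y" using 1 2 that by auto
    then show ?thesis by (rule order_less_trans)
  qed (use 1 2 that in auto)
  moreover have "map_b x < map_b y" if "1/2 \<le> x" "x < y" for x y
  proof (cases "y \<le> 1 \<or> 1 \<le> x")
    case False
    then have "map_b x < map_b 1" "map_b 1 < map_b y" using 3 4 that by auto
    then show ?thesis by (rule order_less_trans)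
  qed (use 3 4 that in auto)
  ultimately show ?thesis
    using strict_mono_glue[of "1/2" map_b] by (auto simp: strict_mono_def)
qed

lemma strict_mono_map_c: "strict_mono map_c"
proof -
  have 1: "map_c x < map_c y" if "x < y" "y \<le> 0" for x y using that by (auto simp: map_c_def)
  have 2: "map_c x < map_c y" if "0 \<le> x" "x < y" "y \<le> 1" for x y
    using that by (auto simp: map_c_def divide_simps algebra_simps)
  have 3: "map_c x < map_c y" if "1 \<le> x" "x < y" for x y
    using that by (auto simp: map_c_def)
  have "map_c x < map_c y" if "x < y" "y \<le> 1" for x y
  proof (cases "y \<le> 0 \<or> 0 \<le> x")
    case False
    then have "map_c x < map_c 0" "map_c 0 < map_c y" using 1 2 that by auto
    then show ?thesis by (rule order_less_trans)
  qed (use 1 2 that in auto)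
  with 3 show ?thesis
    using strict_mono_glue[of 1 map_c] by (auto simp: strict_mono_def)
qed

lemma disjoint_intervalD:
  fixes u v :: real
  assumes "{u<..<v} \<inter> B = {}" "p \<in> B" shows "p \<le> u \<or> v \<le> p"
  using assms by force

lemma piecewise_moebius_a: "piecewise_moebius map_a" "piecewise_moebius (\<lambda>t. t - 1)"
  unfolding piecewise_moebius_def
  by (rule exI[of _ "{}"], simp, intro allI impI exI[of _ "Mat 1 1 0 1"], simp add: map_a_def)
     (rule exI[of _ "{}"], simp, intro allI impI exI[of _ "Mat 1 (-1) 0 1"], simp)

lemma piecewise_moebius_b: "piecewise_moebius map_b"
  unfolding piecewise_moebius_def
proof (rule exI[of _ "{0, 1/2, 1}"], intro conjI allI impI)
  fix u v :: real assume uv: "u < v" "{u<..<v} \<inter> {0, 1/2, 1} = {}"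
  consider "v \<le> 0" | "0 \<le> u" "v \<le> 1/2" | "1/2 \<le> u" "v \<le> 1" | "1 \<le> u"
    using disjoint_intervalD[OF uv(2), of 0] disjoint_intervalD[OF uv(2), of "1/2"]
      disjoint_intervalD[OF uv(2), of 1] by force
  then show "\<exists>M. moebius_on map_b {u<..<v} M"
  proof cases
    case 1 then show ?thesis by (intro exI[of _ "Mat (1) (0) (0) (1)"]) (auto simp: map_b_def)
  next
    case 2 then show ?thesis by (intro exI[of _ "Mat (1) (0) (-1) (1)"]) (auto simp: map_b_def)
  next
    case 3 then show ?thesis by (intro exI[of _ "Mat (3) (-1) (1) (0)"]) (auto simp: map_b_def left_diff_distrib)
  next
    case 4 then show ?thesis by (intro exI[of _ "Mat (1) (1) (0) (1)"]) (auto simp: map_b_def)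
  qed
qed auto

lemma piecewise_moebius_inv_b: "piecewise_moebius inv_b"
  unfolding piecewise_moebius_def
proof (rule exI[of _ "{0, 1, 2}"], intro conjI allI impI)
  fix u v :: real assume uv: "u < v" "{u<..<v} \<inter> {0, 1, 2} = {}"
  consider "v \<le> 0" | "0 \<le> u" "v \<le> 1" | "1 \<le> u" "v \<le> 2" | "2 \<le> u"
    using disjoint_intervalD[OF uv(2), of 0] disjoint_intervalD[OF uv(2), of 1]
      disjoint_intervalD[OF uv(2), of 2] by force
  then show "\<exists>M. moebius_on inv_b {u<..<v} M"
  proof cases
    case 1 then show ?thesis by (intro exI[of _ "Mat (1) (0) (0) (1)"]) (auto simp: inv_b_def)
  next
    case 2 then show ?thesis by (intro exI[of _ "Mat (1) (0) (1) (1)"]) (auto simp: inv_b_def add.commute[of "1::real"])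
  next
    case 3 then show ?thesis by (intro exI[of _ "Mat (0) (1) (-1) (3)"]) (auto simp: inv_b_def)
  next
    case 4 then show ?thesis by (intro exI[of _ "Mat (1) (-1) (0) (1)"]) (auto simp: inv_b_def)
  qed
qed auto

lemma piecewise_moebius_c: "piecewise_moebius map_c" "piecewise_moebius inv_c"
proof -
  have D: "v \<le> 0 \<or> 0 \<le> u \<and> v \<le> 1 \<or> 1 \<le> u" if "{u<..<v} \<inter> {0, 1} = {}" "u < v" for u v :: real
    using disjoint_intervalD[OF that(1), of 0] disjoint_intervalD[OF that(1), of 1] that(2) by force
  have "\<exists>M. moebius_on map_c {u<..<v} M" if uv: "u < v" "{u<..<v} \<inter> {0, 1} = {}" for u v
  proof (cases "0 \<le> u \<and> v \<le> 1")
    case True then show ?thesis by (intro exI[of _ "Mat (2) (0) (1) (1)"]) (auto simp: map_c_def add.commute[of "1::real"])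
  next
    case False then show ?thesis using D[OF uv(2,1)]
      by (intro exI[of _ "Mat (1) (0) (0) (1)"]) (auto simp: map_c_def)
  qed
  then show "piecewise_moebius map_c"
    unfolding piecewise_moebius_def by (intro exI[of _ "{0, 1}"]) auto
  have "\<exists>M. moebius_on inv_c {u<..<v} M" if uv: "u < v" "{u<..<v} \<inter> {0, 1} = {}" for u v
  proof (cases "0 \<le> u \<and> v \<le> 1")
    case True then show ?thesis by (intro exI[of _ "Mat (1) (0) (-1) (2)"]) (auto simp: inv_c_def)
  next
    case False then show ?thesis using D[OF uv(2,1)]
      by (intro exI[of _ "Mat (1) (0) (0) (1)"]) (auto simp: inv_c_def)
  qed
  then show "piecewise_moebius inv_c"
    unfolding piecewise_moebius_def by (intro exI[of _ "{0, 1}"]) auto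
qed

lemma pp_homeo_a: "pp_homeo map_a (\<lambda>t. t - 1)"
  by (rule pp_homeoI)
     (auto simp: piecewise_moebius_a, auto simp: map_a_def strict_mono_def)

lemma pp_homeo_b: "pp_homeo map_b inv_b"
proof (rule pp_homeoI)
  show "map_b ` \<rat> \<subseteq> \<rat>" "inv_b ` \<rat> \<subseteq> \<rat>" by (auto simp: map_b_def inv_b_def)
qed (auto simp: map_b_inv_b inv_b_map_b strict_mono_map_b piecewise_moebius_b piecewise_moebius_inv_b)

lemma pp_homeo_c: "pp_homeo map_c inv_c"
proof (rule pp_homeoI)
  show "map_c ` \<rat> \<subseteq> \<rat>" "inv_c ` \<rat> \<subseteq> \<rat>" by (auto simp: map_c_def inv_c_def)
qed (auto simp: map_c_inv_c inv_c_map_c strict_mono_map_c piecewise_moebius_c)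

lemma inv_homeo_group:
  fixes f g :: "'a :: topological_space \<Rightarrow> 'a"
  assumes "f \<in> carrier homeo_group" "g \<circ> f = id"
  shows "inv\<^bsub>homeo_group\<^esub> f = g"
proof -
  interpret group "homeo_group :: ('a \<Rightarrow> 'a) monoid" by (rule group_homeo_group)
  obtain f' where f': "homeomorphism UNIV UNIV f f'" using assms(1) by (auto simp: homeo_group_def)
  then have "g = f'" using assms(2) by (auto simp: homeomorphism_def fun_eq_iff) (metis comp_eq_dest_lhs)
  moreover have "f' \<in> carrier homeo_group"
    using homeomorphism_symD[OF f'] by (auto simp: homeo_group_def)
  ultimately show ?thesis
    using assms by (intro inv_equality) (auto simp: homeo_group_def)
qed

lemma G0_pp_homeo:
  assumes "g \<in> carrier G0"
  shows "\<exists>h. pp_homeo g h"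
  using assms unfolding carrier_G0
proof (induction rule: generate.induct)
  case one
  have "pp_homeo id id"
    by (rule pp_homeoI) (auto simp: strict_mono_def piecewise_moebius_def intro!: exI[of _ "{}"] exI[of _ "Mat (1) (0) (0) (1)"])
  moreover have "\<one>\<^bsub>homeo_group\<^esub> = (id :: real \<Rightarrow> real)" by (simp add: homeo_group_def)
  ultimately show ?case by metis
next
  case (incl h) then show ?case using pp_homeo_a pp_homeo_b pp_homeo_c by auto
next
  case (inv h)
  then obtain k where k: "pp_homeo h k" using pp_homeo_a pp_homeo_b pp_homeo_c by auto
  have "h \<in> carrier homeo_group" using inv map_a_homeo map_b_homeo map_c_homeo by auto
  then have "inv\<^bsub>homeo_group\<^esub> h = k" using inv_homeo_group k by (auto simp: pp_homeo_def)
  then show ?case using pp_homeo_sym[OF k] by auto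
next
  case (eng h1 h2)
  moreover have "h1 \<otimes>\<^bsub>homeo_group\<^esub> h2 = h1 \<circ> h2" by (simp add: homeo_group_def)
  ultimately show ?case using pp_homeo_compose by metis
qed

lemma piecewise_moebius_odd_mat:
  assumes "piecewise_moebius g"
  shows "\<exists>B. finite B \<and> (\<forall>x. x \<notin> B \<longrightarrow> (\<exists>U M. open U \<and> x \<in> U \<and> moebius_on g U M \<and> odd_mat M))"
proof -
  obtain B where B: "finite B"
    "\<And>u v. u < v \<Longrightarrow> {u<..<v} \<inter> B = {} \<Longrightarrow> \<exists>M. moebius_on g {u<..<v} M"
    using assms by (auto simp: piecewise_moebius_def)
  have "\<exists>U M. open U \<and> x \<in> U \<and> moebius_on g U M \<and> odd_mat M" if x: "x \<notin> B" for x
  proof -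
    obtain e where e: "e > 0" "ball x e \<subseteq> - B"
      using finite_imp_closed[OF B(1)] x open_contains_ball[of "- B"]
      by (metis ComplI open_Compl)
    then have "{x - e<..<x + e} \<inter> B = {}" by (auto simp: ball_eq_greaterThanLessThan)
    then obtain M where "moebius_on g {x - e<..<x + e} M" using B(2) e(1) by fastforce
    then obtain M' where "moebius_on g {x - e<..<x + e} M'" "odd_mat M'" 
      using moebius_on_odd_mat by blast
    then show ?thesis using e(1) by (intro exI[of _ "{x - e<..<x + e}"]) auto
  qed
  then show ?thesis using B(1) by blast
qed

section \<open>Amenable groups have Foelner sets\<close>

text \<open>Rado's argument: a family minimal with respect to Hall's condition consists of singletons.\<close>

definition hall :: "'i set \<Rightarrow> ('i \<Rightarrow> 'a set) \<Rightarrow> bool" where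
  "hall I S \<longleftrightarrow> (\<forall>J. finite J \<longrightarrow> J \<subseteq> I \<longrightarrow> card J \<le> card (\<Union>i\<in>J. S i))"

lemma hallD: "hall I S \<Longrightarrow> finite J \<Longrightarrow> J \<subseteq> I \<Longrightarrow> card J \<le> card (\<Union>i\<in>J. S i)"
  by (simp add: hall_def)

text \<open>Submodularity of cardinality: if both removals violate the condition, the violating
  index sets \<open>J\<close> and \<open>K\<close> have neighbourhoods \<open>?P\<close> and
  \<open>?Q\<close> no larger than themselves. But \<open>?P \<union> ?Q\<close> has to serve
  \<open>J \<union> K\<close> and \<open>i\<close> in addition, and \<open>?P \<inter> ?Q\<close>
  has to serve \<open>J \<inter> K\<close>: one element is missing.\<close>

lemma hall_remove:
  fixes S :: "'i \<Rightarrow> 'a set"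
  assumes fin: "\<And>i. i \<in> I \<Longrightarrow> finite (S i)" and hall: "hall I S"
    and i: "i \<in> I" and x: "x \<in> S i" and y: "y \<in> S i" and xy: "x \<noteq> y"
  shows "hall I (S(i := S i - {x})) \<or> hall I (S(i := S i - {y}))"
proof (rule ccontr)
  assume neg: "\<not> ?thesis"
  have crit: "\<exists>J. finite J \<and> J \<subseteq> I \<and> i \<notin> J \<and> card ((S i - {z}) \<union> (\<Union>j\<in>J. S j)) \<le> card J"
    if z: "\<not> hall I (S(i := S i - {z}))" for z
  proof -
    from z obtain J where J: "finite J" "J \<subseteq> I" "card (\<Union>j\<in>J. (S(i := S i - {z})) j) < card J"
      unfolding hall_def not_all not_imp not_le by (elim exE conjE)
    have "i \<in> J"
    proof (rule ccontr)
      assume "i \<notin> J"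
      then have eq: "(\<Union>j\<in>J. (S(i := S i - {z})) j) = (\<Union>j\<in>J. S j)"
        by (intro SUP_cong) auto
      have "card J \<le> card (\<Union>j\<in>J. S j)" using J(1,2) hall by (intro hallD)
      then show False using J(3) unfolding eq by linarith
    qed
    then have U: "(\<Union>j\<in>J. F j) = F i \<union> (\<Union>j\<in>J - {i}. F j)" for F :: "'i \<Rightarrow> 'a set" by blast
    have "(\<Union>j\<in>J. (S(i := S i - {z})) j) = (S i - {z}) \<union> (\<Union>j\<in>J - {i}. (S(i := S i - {z})) j)"
      by (subst U) simp
    also have "(\<Union>j\<in>J - {i}. (S(i := S i - {z})) j) = (\<Union>j\<in>J - {i}. S j)"
      by (intro SUP_cong) auto
    finally have eq: "(\<Union>j\<in>J. (S(i := S i - {z})) j) = (S i - {z}) \<union> (\<Union>j\<in>J - {i}. S j)" .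
    have "card ((S i - {z}) \<union> (\<Union>j\<in>J - {i}. S j)) < card J" using J(3) unfolding eq .
    moreover have "card J = Suc (card (J - {i}))" using \<open>i \<in> J\<close> J(1) by (metis card_Suc_Diff1)
    ultimately have "card ((S i - {z}) \<union> (\<Union>j\<in>J - {i}. S j)) \<le> card (J - {i})" by linarith
    then show ?thesis using J(1,2) by blast
  qed
  obtain J where J: "finite J" "J \<subseteq> I" "i \<notin> J" "card ((S i - {x}) \<union> (\<Union>j\<in>J. S j)) \<le> card J"
    using crit[of x] neg unfolding de_Morgan_disj by blast
  obtain K where K: "finite K" "K \<subseteq> I" "i \<notin> K" "card ((S i - {y}) \<union> (\<Union>j\<in>K. S j)) \<le> card K"
    using crit[of y] neg unfolding de_Morgan_disj by blast
  let ?P = "(S i - {x}) \<union> (\<Union>j\<in>J. S j)" and ?Q = "(S i - {y}) \<union> (\<Union>j\<in>K. S j)"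
  have finP: "finite ?P" "finite ?Q" using fin i J K by auto
  have 1: "card (insert i (J \<union> K)) \<le> card (?P \<union> ?Q)"
  proof -
    have eq: "?P \<union> ?Q = (\<Union>j\<in>insert i (J \<union> K). S j)" using x y xy by auto
    have "card (insert i (J \<union> K)) \<le> card (\<Union>j\<in>insert i (J \<union> K). S j)"
      using J(1,2) K(1,2) i by (intro hallD[OF hall]) auto
    then show ?thesis unfolding eq .
  qed
  have 2: "card (J \<inter> K) \<le> card (?P \<inter> ?Q)"
  proof -
    have "card (J \<inter> K) \<le> card (\<Union>j\<in>J \<inter> K. S j)" using J(1,2) by (intro hallD[OF hall]) auto
    also have "\<dots> \<le> card (?P \<inter> ?Q)" using finP by (intro card_mono) auto
    finally show ?thesis .
  qed
  have "card J + card K = card (J \<union> K) + card (J \<inter> K)" by (rule card_Un_Int[OF J(1) K(1)])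
  moreover have "card ?P + card ?Q = card (?P \<union> ?Q) + card (?P \<inter> ?Q)" by (rule card_Un_Int[OF finP])
  moreover have "card (insert i (J \<union> K)) = Suc (card (J \<union> K))" using J(1,3) K(1,3) by simp
  ultimately show False using 1 2 J(4) K(4) by linarith
qed

text \<open>A member of the chain with the least total size on \<open>J\<close> is contained in
  every other member there.\<close>

lemma finite_inter_chain:
  assumes "finite J" "finite (S0 :: 'a set)" "\<C> \<noteq> {}"
    "\<And>S T. S \<in> \<C> \<Longrightarrow> T \<in> \<C> \<Longrightarrow> (\<forall>i. S i \<subseteq> T i) \<or> (\<forall>i. T i \<subseteq> S i)"
    "\<And>S i. S \<in> \<C> \<Longrightarrow> i \<in> J \<Longrightarrow> S i \<subseteq> S0"
  shows "\<exists>S\<in>\<C>. \<forall>i\<in>J. S i = (\<Inter>T\<in>\<C>. T i)"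
proof -
  define m where "m S = (\<Sum>i\<in>J. card (S i))" for S :: "'b \<Rightarrow> 'a set"
  obtain S1 where "S1 \<in> \<C>" using assms(3) by blast
  then obtain S where S: "S \<in> \<C>" "\<And>T. T \<in> \<C> \<Longrightarrow> m S \<le> m T"
    using ex_has_least_nat[of "\<lambda>S. S \<in> \<C>" S1 m] by blast
  have fin: "finite (T i)" if "T \<in> \<C>" "i \<in> J" for T i
    using finite_subset[OF assms(5)[OF that] assms(2)] .
  have le: "S i \<subseteq> T i" if "T \<in> \<C>" "i \<in> J" for T i
  proof (rule ccontr)
    assume n: "\<not> S i \<subseteq> T i"
    then have le: "\<forall>j. T j \<subseteq> S j" using assms(4)[OF S(1) that(1)] by blast
    have "m T < m S" unfolding m_def
    proof (rule sum_strict_mono_ex1)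
      show "\<forall>j\<in>J. card (T j) \<le> card (S j)" using le fin[OF S(1)] by (auto intro: card_mono)
      show "\<exists>j\<in>J. card (T j) < card (S j)"
        using le n that(2) fin[OF S(1)] by (intro bexI[of _ i] psubset_card_mono) auto
    qed (rule assms(1))
    then show False using S(2)[OF that(1)] by simp
  qed
  have "S i = (\<Inter>T\<in>\<C>. T i)" if i: "i \<in> J" for i
  proof (rule equalityI)
    show "S i \<subseteq> (\<Inter>T\<in>\<C>. T i)" using le[OF _ i] by (rule INT_greatest)
    show "(\<Inter>T\<in>\<C>. T i) \<subseteq> S i" using S(1) by (rule INT_lower)
  qed
  then show ?thesis by (intro bexI[OF _ S(1)] ballI)
qed

text \<open>Each instance of the condition involves finitely many indices, and on these the
  intersection is attained by a member of the chain.\<close>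

lemma hall_chain:
  assumes fin: "\<And>i. i \<in> I \<Longrightarrow> finite (S0 i)" and ne: "\<C> \<noteq> {}"
    and chain: "\<And>S T. S \<in> \<C> \<Longrightarrow> T \<in> \<C> \<Longrightarrow> (\<forall>i. S i \<subseteq> T i) \<or> (\<forall>i. T i \<subseteq> S i)"
    and sub: "\<And>S i. S \<in> \<C> \<Longrightarrow> S i \<subseteq> S0 i" and hall: "\<And>S. S \<in> \<C> \<Longrightarrow> hall I S"
  shows "hall I (\<lambda>i. \<Inter>T\<in>\<C>. T i)"
  unfolding hall_def
proof (intro allI impI)
  fix J assume J: "finite J" "J \<subseteq> I"
  have "\<exists>S\<in>\<C>. \<forall>i\<in>J. S i = (\<Inter>T\<in>\<C>. T i)"
  proof (rule finite_inter_chain[OF J(1) _ ne chain])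
    show "finite (\<Union>i\<in>J. S0 i)" using J fin by auto
    show "S i \<subseteq> (\<Union>i\<in>J. S0 i)" if "S \<in> \<C>" "i \<in> J" for S i
      using UN_upper[of i J S0] sub[OF that(1), of i] that(2) by (meson order_trans)
  qed
  then obtain S where S: "S \<in> \<C>" "\<forall>i\<in>J. S i = (\<Inter>T\<in>\<C>. T i)"
    by (rule bexE)
  have eq: "(\<Union>i\<in>J. S i) = (\<Union>i\<in>J. \<Inter>T\<in>\<C>. T i)"
    by (rule SUP_cong[OF HOL.refl bspec[OF S(2)]])
  have "card J \<le> card (\<Union>i\<in>J. S i)" by (rule hallD[OF hall[OF S(1)] J])
  then show "card J \<le> card (\<Union>i\<in>J. \<Inter>T\<in>\<C>. T i)" unfolding eq .
qed

lemma hall_marriage: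
  fixes S0 :: "'i \<Rightarrow> 'a set"
  assumes fin: "\<And>i. i \<in> I \<Longrightarrow> finite (S0 i)" and hall: "hall I S0"
  shows "\<exists>f. inj_on f I \<and> (\<forall>i\<in>I. f i \<in> S0 i)"
proof -
  \<comment> \<open>Subfamilies are described by what has been removed, so that a minimal family
    becomes a maximal element of the pointwise order, as Zorn's lemma provides.\<close>
  define A where "A = {R. hall I (\<lambda>i. S0 i - R i)}"
  have "\<exists>M\<in>A. \<forall>X\<in>A. M \<le> X \<longrightarrow> X = M"
  proof (rule predicate_Zorn[of A "(\<le>)"])
    show "partial_order_on A (relation_of (\<le>) A)"
      by (auto simp: relation_of_def partial_order_on_def preorder_on_def refl_on_def trans_def antisym_def)
    fix C assume C: "C \<in> Chains (relation_of (\<le>) A)"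
    show "\<exists>u\<in>A. \<forall>R\<in>C. R \<le> u"
    proof (cases "C = {}")
      case True
      have "(\<lambda>i. {}) \<in> A" using hall by (simp add: A_def)
      then show ?thesis using True by blast
    next
      case False
      let ?\<C> = "(\<lambda>R i. S0 i - R i) ` C"
      have CA: "C \<subseteq> A" using C by (auto simp: Chains_def relation_of_def)
      have ch: "(\<forall>i. S i \<subseteq> T i) \<or> (\<forall>i. T i \<subseteq> S i)" if ST: "S \<in> ?\<C>" "T \<in> ?\<C>" for S T
      proof -
        obtain P where P: "S = (\<lambda>i. S0 i - P i)" "P \<in> C" using ST(1) by (rule imageE)
        obtain Q where Q: "T = (\<lambda>i. S0 i - Q i)" "Q \<in> C" using ST(2) by (rule imageE)
        have "P \<le> Q \<or> Q \<le> P" using C P(2) Q(2) unfolding Chains_def relation_of_def by blast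
        then show ?thesis unfolding P(1) Q(1) le_fun_def by blast
      qed
      have "hall I (\<lambda>i. \<Inter>T\<in>?\<C>. T i)"
        by (rule hall_chain[OF fin _ ch]) (use False CA in \<open>auto simp: A_def\<close>)
      moreover have "(\<lambda>i. \<Inter>T\<in>?\<C>. T i) = (\<lambda>i. S0 i - (\<Union>R\<in>C. R i))"
        using False by auto
      ultimately have "(\<lambda>i. \<Union>R\<in>C. R i) \<in> A" by (simp add: A_def)
      then show ?thesis by (rule bexI[rotated]) (auto simp: le_fun_def)
    qed
  qed
  then obtain R where R: "hall I (\<lambda>i. S0 i - R i)" "\<And>X. X \<in> A \<Longrightarrow> R \<le> X \<Longrightarrow> X = R"
    by (auto simp: A_def)
  let ?S = "\<lambda>i. S0 i - R i"
  have single: "x = y" if "i \<in> I" "x \<in> ?S i" "y \<in> ?S i" for i x y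
  proof (rule ccontr)
    assume "x \<noteq> y"
    then have "hall I (?S(i := ?S i - {x})) \<or> hall I (?S(i := ?S i - {y}))"
      using hall_remove[of I ?S i x y] fin R(1) that by auto
    moreover have "?S(i := ?S i - {z}) = (\<lambda>j. S0 j - (R(i := insert z (R i))) j)" for z
      by (rule ext) auto
    ultimately have "hall I (\<lambda>j. S0 j - (R(i := insert x (R i))) j) \<or> hall I (\<lambda>j. S0 j - (R(i := insert y (R i))) j)"
      by metis
    then have "R(i := insert x (R i)) \<in> A \<or> R(i := insert y (R i)) \<in> A" unfolding A_def mem_Collect_eq .
    moreover have "R \<le> R(i := insert z (R i))" for z by (auto simp: le_fun_def)
    ultimately have "R(i := insert x (R i)) = R \<or> R(i := insert y (R i)) = R" using R(2) by blast
    then show False using that by (metis Diff_iff insertI1 fun_upd_same)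
  qed
  have ne: "?S i \<noteq> {}" if "i \<in> I" for i
  proof
    assume "?S i = {}"
    then have "card (\<Union>j\<in>{i}. ?S j) = 0" by (simp only: UN_simps UN_insert UN_empty) simp
    moreover have "card {i} \<le> card (\<Union>j\<in>{i}. ?S j)"
      using that by (intro hallD[OF R(1)]) auto
    ultimately show False by simp
  qed
  define f where "f i = (SOME x. x \<in> ?S i)" for i
  have f: "f i \<in> ?S i" if "i \<in> I" for i unfolding f_def using ne[OF that] some_in_eq by blast
  have "inj_on f I"
  proof (rule inj_onI, rule ccontr)
    fix i j assume ij: "i \<in> I" "j \<in> I" "f i = f j" "i \<noteq> j"
    have S: "?S k = {f k}" if k: "k \<in> I" for k
    proof (intro equalityI subsetI)
      show "x \<in> {f k}" if "x \<in> ?S k" for x using single[OF k that f[OF k]] by simp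
    qed (use f[OF k] in simp)
    have "(\<Union>k\<in>{i,j}. ?S k) = ?S i \<union> ?S j" by simp
    also have "\<dots> = {f i}" unfolding S[OF ij(1)] S[OF ij(2)] ij(3) by simp
    finally have "(\<Union>k\<in>{i,j}. ?S k) = {f i}" .
    moreover have "card {i,j} \<le> card (\<Union>k\<in>{i,j}. ?S k)"
      using ij by (intro hallD[OF R(1)]) auto
    ultimately show False using ij(4) by simp
  qed
  then show ?thesis using f by blast
qed

text \<open>Hall's condition holds for two copies of the group, so there are two injections with
  disjoint images that move each element by left multiplication with some \<open>k \<in> K\<close>.
  Cutting the group according to \<open>k\<close> shows that each image has measure 1, and the two
  images together would have measure 2.\<close>

lemma not_amenable_if_doubling:
  assumes "group G" "finite K" "K \<subseteq> carrier G"
    and dbl: "\<And>F. finite F \<Longrightarrow> F \<subseteq> carrier G \<Longrightarrow> 2 * card F \<le> card (\<Union>k\<in>K. (\<lambda>f. k \<otimes>\<^bsub>G\<^esub> f) ` F)"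
  shows "\<not> amenable G"
proof
  assume "amenable G"
  then obtain \<mu> :: "'a set \<Rightarrow> real" where \<mu>: "\<forall>A. A \<subseteq> carrier G \<longrightarrow> 0 \<le> \<mu> A" "\<mu> (carrier G) = 1"
    "\<forall>A B. A \<subseteq> carrier G \<longrightarrow> B \<subseteq> carrier G \<longrightarrow> A \<inter> B = {} \<longrightarrow> \<mu> (A \<union> B) = \<mu> A + \<mu> B"
    "\<forall>g \<in> carrier G. \<forall>A. A \<subseteq> carrier G \<longrightarrow> \<mu> (g <#\<^bsub>G\<^esub> A) = \<mu> A"
    unfolding amenable_def by (elim exE conjE)
  have pos: "0 \<le> \<mu> A" if "A \<subseteq> carrier G" for A using \<mu>(1) that by simp
  have add: "\<mu> (A \<union> B) = \<mu> A + \<mu> B"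
    if "A \<subseteq> carrier G" "B \<subseteq> carrier G" "A \<inter> B = {}" for A B using \<mu>(3) that by simp
  have inv: "\<mu> (g <#\<^bsub>G\<^esub> A) = \<mu> A" if "g \<in> carrier G" "A \<subseteq> carrier G" for g A
    using \<mu>(4) that by simp
  note one = \<mu>(2)
  interpret group G by fact
  let ?I = "carrier G \<times> (UNIV :: bool set)"
  let ?S = "\<lambda>i :: 'a \<times> bool. (\<lambda>k. k \<otimes>\<^bsub>G\<^esub> fst i) ` K"
  have "hall ?I ?S"
    unfolding hall_def
  proof (intro allI impI)
    fix J assume J: "finite J" "J \<subseteq> ?I"
    have "J \<subseteq> fst ` J \<times> UNIV" by force
    then have "card J \<le> card (fst ` J \<times> (UNIV :: bool set))" using J(1) by (intro card_mono) auto
    also have "\<dots> = 2 * card (fst ` J)" by (simp add: card_cartesian_product)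
    also have "\<dots> \<le> card (\<Union>k\<in>K. (\<lambda>f. k \<otimes>\<^bsub>G\<^esub> f) ` (fst ` J))" using J by (intro dbl) auto
    also have "(\<Union>k\<in>K. (\<lambda>f. k \<otimes>\<^bsub>G\<^esub> f) ` (fst ` J)) = (\<Union>i\<in>J. ?S i)" by auto
    finally show "card J \<le> card (\<Union>i\<in>J. ?S i)" .
  qed
  moreover have "finite (?S i)" for i using assms(2) by simp
  ultimately have "\<exists>f. inj_on f ?I \<and> (\<forall>i\<in>?I. f i \<in> ?S i)" by (rule hall_marriage[rotated])
  then obtain f where f: "inj_on f ?I" "\<forall>i\<in>?I. f i \<in> ?S i" by (elim exE conjE)
  have fK: "\<exists>k\<in>K. f (g, e) = k \<otimes>\<^bsub>G\<^esub> g" if "g \<in> carrier G" for g e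
    using bspec[OF f(2), of "(g, e)"] that by auto
  have empty: "\<mu> {} = 0" using add[of "{}" "{}"] by simp
  have sum: "\<mu> (\<Union>k\<in>L. A k) = (\<Sum>k\<in>L. \<mu> (A k))"
    if "finite L" "\<And>k. k \<in> L \<Longrightarrow> A k \<subseteq> carrier G"
      "\<And>k l. k \<in> L \<Longrightarrow> l \<in> L \<Longrightarrow> k \<noteq> l \<Longrightarrow> A k \<inter> A l = {}" for L and A :: "'a \<Rightarrow> 'a set"
    using that
  proof (induction L rule: finite_induct)
    case (insert k L)
    have "A k \<inter> (\<Union>l\<in>L. A l) = {}" using insert.prems(2)[of k] insert.hyps(2) by fastforce
    then have "\<mu> (A k \<union> (\<Union>l\<in>L. A l)) = \<mu> (A k) + \<mu> (\<Union>l\<in>L. A l)"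
      using insert.prems(1) by (intro add) auto
    then show ?case using insert by simp
  qed (simp add: empty)
  have full: "\<mu> ((\<lambda>g. f (g, e)) ` carrier G) = 1" for e
  proof -
    let ?A = "\<lambda>k. {g \<in> carrier G. f (g, e) = k \<otimes>\<^bsub>G\<^esub> g}"
    have D: "?A k \<inter> ?A l = {}" if "k \<in> K" "l \<in> K" "k \<noteq> l" for k l
    proof -
      have "k \<in> carrier G" "l \<in> carrier G" using that assms(3) by auto
      then show ?thesis using that(3) right_cancel[of _ k l] by auto
    qed
    have kA: "k <#\<^bsub>G\<^esub> ?A k = (\<lambda>g. f (g, e)) ` ?A k" for k by (auto simp: l_coset_def)
    have U: "carrier G = (\<Union>k\<in>K. ?A k)" using fK by auto
    have fin: "(\<lambda>g. f (g, e)) ` carrier G = (\<Union>k\<in>K. k <#\<^bsub>G\<^esub> ?A k)"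
    proof -
      have "(\<lambda>g. f (g, e)) ` carrier G = (\<lambda>g. f (g, e)) ` (\<Union>k\<in>K. ?A k)" using U by presburger
      then show ?thesis unfolding kA image_UN .
    qed
    have "\<mu> ((\<lambda>g. f (g, e)) ` carrier G) = (\<Sum>k\<in>K. \<mu> (k <#\<^bsub>G\<^esub> ?A k))"
      unfolding fin
    proof (rule sum[OF assms(2)])
      show "k <#\<^bsub>G\<^esub> ?A k \<subseteq> carrier G" if "k \<in> K" for k
        using that assms(3) by (auto simp: l_coset_def)
      fix k l assume kl: "k \<in> K" "l \<in> K" "k \<noteq> l"
      have "inj_on (\<lambda>g. f (g, e)) (carrier G)" using f(1) by (auto simp: inj_on_def)
      then have "(\<lambda>g. f (g, e)) ` ?A k \<inter> (\<lambda>g. f (g, e)) ` ?A l = (\<lambda>g. f (g, e)) ` (?A k \<inter> ?A l)"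
        by (intro inj_on_image_Int[symmetric]) auto
      then show "(k <#\<^bsub>G\<^esub> ?A k) \<inter> (l <#\<^bsub>G\<^esub> ?A l) = {}"
        unfolding kA D[OF kl] by simp
    qed
    also have "\<dots> = (\<Sum>k\<in>K. \<mu> (?A k))"
      using assms(3) by (intro sum.cong[OF HOL.refl] inv) auto
    also have "\<dots> = \<mu> (\<Union>k\<in>K. ?A k)"
      by (rule sum[symmetric, OF assms(2)]) (use D in auto)
    finally show ?thesis using U one by simp
  qed
  let ?R = "\<lambda>e. (\<lambda>g. f (g, e)) ` carrier G"
  have sub: "?R e \<subseteq> carrier G" for e 
  proof
    fix x assume "x \<in> ?R e"
    then obtain g where "g \<in> carrier G" "x = f (g, e)" by auto
    then show "x \<in> carrier G" using fK[of g e] assms(3) by auto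
  qed
  have disj: "?R True \<inter> ?R False = {}" using f(1) by (auto simp: inj_on_def)
  have "\<mu> (carrier G) = \<mu> (?R True \<union> ?R False) + \<mu> (carrier G - (?R True \<union> ?R False))"
    using sub by (subst add[symmetric]) (auto intro!: arg_cong[of _ _ \<mu>])
  moreover have "\<mu> (?R True \<union> ?R False) = 2" using add[OF sub sub disj] full by simp
  ultimately show False using one pos[of "carrier G - (?R True \<union> ?R False)"] by simp
qed

text \<open>Without such a set every finite \<open>F\<close> grows by the factor
  \<open>1 + \<epsilon>\<close> under translation by \<open>K\<close> and the unit; iterating until
  the factor exceeds 2 gives the hypothesis of \<open>not_amenable_if_doubling\<close>.\<close>

lemma amenable_foelner:
  fixes \<epsilon> :: real
  assumes "group G" "amenable G" "finite K" "K \<subseteq> carrier G" "\<epsilon> > 0"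
  shows "\<exists>F. finite F \<and> F \<noteq> {} \<and> F \<subseteq> carrier G \<and>
    (\<forall>k\<in>K. real (card ((\<lambda>f. k \<otimes>\<^bsub>G\<^esub> f) ` F - F)) \<le> \<epsilon> * card F)"
proof (rule ccontr)
  assume neg: "\<not> ?thesis"
  interpret group G by fact
  let ?T = "\<lambda>L F. \<Union>k\<in>L. (\<lambda>f. k \<otimes>\<^bsub>G\<^esub> f) ` F"
  \<comment> \<open>With the unit included the union of translates contains \<open>F\<close> itself,
    so the elements of a translate outside \<open>F\<close> count as growth.\<close>
  let ?K = "insert \<one>\<^bsub>G\<^esub> K"
  have K: "finite ?K" "?K \<subseteq> carrier G" using assms by auto
  have step: "(1 + \<epsilon>) * card F \<le> card (?T ?K F)" if F: "finite F" "F \<subseteq> carrier G" for F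
  proof (cases "F = {}")
    case False
    have "\<not> (\<forall>k\<in>K. real (card ((\<lambda>f. k \<otimes>\<^bsub>G\<^esub> f) ` F - F)) \<le> \<epsilon> * card F)"
      using neg F False by blast
    then obtain k where k: "k \<in> K" "real (card ((\<lambda>f. k \<otimes>\<^bsub>G\<^esub> f) ` F - F)) > \<epsilon> * card F"
      by (auto simp: not_le)
    have "F \<union> ((\<lambda>f. k \<otimes>\<^bsub>G\<^esub> f) ` F - F) \<subseteq> ?T ?K F" using F(2) k(1) by force
    then have "card (F \<union> ((\<lambda>f. k \<otimes>\<^bsub>G\<^esub> f) ` F - F)) \<le> card (?T ?K F)"
      using F(1) K(1) by (intro card_mono) auto
    moreover have "card (F \<union> ((\<lambda>f. k \<otimes>\<^bsub>G\<^esub> f) ` F - F)) = card F + card ((\<lambda>f. k \<otimes>\<^bsub>G\<^esub> f) ` F - F)"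
      using F(1) by (intro card_Un_disjoint) auto
    ultimately have "real (card F) + card ((\<lambda>f. k \<otimes>\<^bsub>G\<^esub> f) ` F - F) \<le> card (?T ?K F)" by linarith
    then show ?thesis using k(2) by (simp add: algebra_simps)
  qed simp
  have "\<exists>L. finite L \<and> L \<subseteq> carrier G \<and>
      (\<forall>F. finite F \<longrightarrow> F \<subseteq> carrier G \<longrightarrow> (1 + \<epsilon>) ^ n * card F \<le> card (?T L F))" for n
  proof (induction n)
    case 0
    have "(\<lambda>f. \<one>\<^bsub>G\<^esub> \<otimes>\<^bsub>G\<^esub> f) ` F = F" if "F \<subseteq> carrier G" for F
      using that by force
    then show ?case by (intro exI[of _ "{\<one>\<^bsub>G\<^esub>}"]) auto
  next
    case (Suc n)
    then obtain L where L: "finite L" "L \<subseteq> carrier G"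
      "\<forall>F. finite F \<longrightarrow> F \<subseteq> carrier G \<longrightarrow> (1 + \<epsilon>) ^ n * card F \<le> card (?T L F)" by (elim exE conjE)
    let ?L = "?T ?K L"
    have "(1 + \<epsilon>) ^ Suc n * card F \<le> card (?T ?L F)" if F: "finite F" "F \<subseteq> carrier G" for F
    proof -
      have "(1 + \<epsilon>) ^ Suc n * card F \<le> (1 + \<epsilon>) * card (?T L F)"
        using L(3)[rule_format, OF F] assms(5) by (simp add: mult.assoc)
      also have "\<dots> \<le> card (?T ?K (?T L F))"
        using L(1,2) F by (intro step) auto
      also have "?T ?K (?T L F) = ?T ?L F"
      proof -
        have A: "?T Q (?T L F) = (\<Union>k\<in>Q. \<Union>l\<in>L. (\<lambda>f. k \<otimes>\<^bsub>G\<^esub> (l \<otimes>\<^bsub>G\<^esub> f)) ` F)" for Q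
          by (simp add: image_UN image_image)
        have B: "?T (?T Q L) F = (\<Union>k\<in>Q. \<Union>l\<in>L. (\<lambda>f. k \<otimes>\<^bsub>G\<^esub> l \<otimes>\<^bsub>G\<^esub> f) ` F)" for Q
          by simp
        have "k \<otimes>\<^bsub>G\<^esub> (l \<otimes>\<^bsub>G\<^esub> f) = k \<otimes>\<^bsub>G\<^esub> l \<otimes>\<^bsub>G\<^esub> f" if "k \<in> ?K" "l \<in> L" "f \<in> F" for k l f
        proof -
          have "k \<in> carrier G" "l \<in> carrier G" "f \<in> carrier G" using that K(2) L(2) F(2) by auto
          then show ?thesis by (simp add: m_assoc)
        qed
        then show ?thesis unfolding A B by (intro SUP_cong image_cong HOL.refl)
      qed
      finally show ?thesis .
    qed
    moreover have "finite ?L" "?L \<subseteq> carrier G" using L K by auto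
    ultimately show ?case by blast
  qed note pow = this
  obtain n where n: "(1 + \<epsilon>) ^ n \<ge> 2"
    using real_arch_pow[of "1 + \<epsilon>" 2] assms(5) by (auto intro: less_imp_le)
  obtain L where L: "finite L" "L \<subseteq> carrier G"
    "\<forall>F. finite F \<longrightarrow> F \<subseteq> carrier G \<longrightarrow> (1 + \<epsilon>) ^ n * card F \<le> card (?T L F)"
    using pow[of n] by (elim exE conjE)
  have "2 * card F \<le> card (?T L F)" if "finite F" "F \<subseteq> carrier G" for F
  proof -
    have "2 * real (card F) \<le> (1 + \<epsilon>) ^ n * card F" using n by (intro mult_right_mono) auto
    also have "\<dots> \<le> card (?T L F)" using L(3)[rule_format, OF that] .
    finally show ?thesis by linarith
  qed
  then show False using not_amenable_if_doubling[OF assms(1) L(1,2)] assms(2) by blast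
qed

section \<open>Nonamenability\<close>

lemma integrable_indicator_Icc: "integrable lborel (indicat_real {a..b::real})"
proof (rule integrable_real_indicator)
  show "emeasure lborel {a..b} < \<infinity>" by (rule emeasure_bounded_finite) simp
qed simp

lemma integrable_bounded_Icc:
  fixes f :: "real \<Rightarrow> real"
  assumes [measurable]: "f \<in> borel_measurable borel" and "\<And>x. \<bar>f x\<bar> \<le> C"
  shows "integrable lborel (\<lambda>x. f x * indicator {a..b} x)"
proof (rule Bochner_Integration.integrable_bound[where f = "\<lambda>x. C * indicator {a..b} x"])
  show "integrable lborel (\<lambda>x. C * indicator {a..b} x :: real)"
    by (intro integrable_mult_right integrable_indicator_Icc)
  have "\<bar>f x * indicator {a..b} x\<bar> \<le> \<bar>C * indicator {a..b} x\<bar>" for x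
    using assms(2)[of x] by (auto simp: indicator_def)
  then show "AE x in lborel. norm (f x * indicator {a..b} x) \<le> norm (C * indicator {a..b} x)"
    by simp
qed measurable

text \<open>Both branches of the inverse of doubling have derivative \<open>1/2\<close>, so
  integrating the first inequality over \<open>[0, 1]\<close> gives twice the integral of
  \<open>u\<close> on the left, hence an integral of at least \<open>1 - 2 * \<epsilon>\<close>. The
  map \<open>y / (1 + y)\<close> carries \<open>[0, 1]\<close> onto \<open>[0, 1/2]\<close> with
  derivative at most 1, so the second inequality bounds the integral over the left half by
  \<open>1 + \<epsilon>\<close> minus the whole integral.\<close>

lemma doubling_inequality_contradiction:
  fixes u :: "real \<Rightarrow> real"
  assumes [measurable]: "u \<in> borel_measurable borel"
    and u: "\<And>x. 0 \<le> u x" "\<And>x. u x \<le> 1" and D: "finite D"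
    and ineq: "\<And>x. 0 < x \<Longrightarrow> x < 1 \<Longrightarrow> x \<notin> D \<Longrightarrow> u (x / 2) + u ((x + 1) / 2) \<ge> 1 + u x - 2 * \<epsilon>"
    and ineq': "\<And>y. 0 < y \<Longrightarrow> y < 1 \<Longrightarrow> u (y / (1 + y)) \<le> 1 - u y + \<epsilon>"
  shows "\<epsilon> > 1 / 20"
proof -
  let ?I = "\<lambda>a b f. LBINT x. f x * indicator {a..b::real} x :: real"
  have int: "integrable lborel (\<lambda>x. f x * indicator {a..b} x)"
    if "f \<in> borel_measurable borel" "\<And>x. \<bar>f x\<bar> \<le> C" for f :: "real \<Rightarrow> real" and a b C
    using that by (rule integrable_bounded_Icc)
  have absu: "\<bar>u x\<bar> \<le> 1" for x using u[of x] by simp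
  have setint: "set_integrable lborel {a..b} u" for a b
    using int[of u 1 a b] absu by (simp add: set_integrable_def mult.commute)
  have ae: "AE x in lborel. x \<notin> D \<union> {0, 1/2, 1}"
    using D by (intro AE_not_in countable_imp_null_set_lborel countable_finite) auto
  have ucomp: "(\<lambda>x. u (g x)) \<in> borel_measurable borel" if "g \<in> borel_measurable borel" for g
    using that by measurable
  have left: "?I 0 (1/2) u = ?I 0 1 (\<lambda>x. u (x / 2) / 2)"
  proof -
    have "((\<lambda>x. x / 2) has_real_derivative 1 / 2) (at x)" for x :: real
      by (auto intro!: derivative_eq_intros)
    then show ?thesis using integral_substitution(2)[of "\<lambda>x. x / 2" 0 1 u "\<lambda>x. 1/2"] setint by simp
  qed
  have right: "?I (1/2) 1 u = ?I 0 1 (\<lambda>x. u ((x + 1) / 2) / 2)"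
  proof -
    have "((\<lambda>x. (x + 1) / 2) has_real_derivative 1 / 2) (at x)" for x :: real
      by (auto intro!: derivative_eq_intros)
    then show ?thesis
      using integral_substitution(2)[of "\<lambda>x. (x + 1) / 2" 0 1 u "\<lambda>x. 1/2"] setint by simp
  qed
  have deriv: "((\<lambda>x. x / (1 + x)) has_real_derivative 1 / (1 + x)\<^sup>2) (at x)" if "0 \<le> x" for x :: real
    using that by (auto intro!: derivative_eq_intros simp: power2_eq_square)
  have cont: "continuous_on {0..1} (\<lambda>x::real. 1 / (1 + x)\<^sup>2)"
    by (intro continuous_intros) auto
  note subst = integral_substitution[of "\<lambda>x. x / (1 + x)" 0 1 u "\<lambda>x. 1 / (1 + x)\<^sup>2",
      OF _ deriv cont, simplified, OF setint]
  have int_l: "integrable lborel (\<lambda>x. u (x / 2) * indicator {0..1} x)"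
    and int_r: "integrable lborel (\<lambda>x. u ((x + 1) / 2) * indicator {0..1} x)"
    by (rule int[where C = 1], use absu in \<open>auto intro!: ucomp\<close>)+
  have int_u: "integrable lborel (\<lambda>x. u x * indicator {a..b} x)" for a b
    by (rule int[where C = 1]) (use absu in auto)
  have split: "?I 0 1 u = ?I 0 (1/2) u + ?I (1/2) 1 u"
  proof -
    have "?I 0 1 u = (LBINT x. u x * indicator {0..1/2} x + u x * indicator {1/2..1} x)"
      by (rule integral_cong_AE) (use ae in \<open>auto simp: indicator_def\<close>)
    then show ?thesis using int_u by simp
  qed
  have "(LBINT x. (1 - 2 * \<epsilon>) * indicator {0..1::real} x + u x * indicator {0..1} x)
      \<le> (LBINT x. u (x / 2) * indicator {0..1} x + u ((x + 1) / 2) * indicator {0..1} x)"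
  proof (rule integral_mono_AE)
    show "AE x in lborel. (1 - 2 * \<epsilon>) * indicator {0..1::real} x + u x * indicator {0..1} x
      \<le> u (x / 2) * indicator {0..1} x + u ((x + 1) / 2) * indicator {0..1} x"
      using ae
    proof eventually_elim
      case (elim x)
      then show ?case using ineq[of x] by (auto simp: indicator_def)
    qed
  qed (use int_u int_l int_r in auto)
  moreover have "(LBINT x. u (x / 2) * indicator {0..1} x + u ((x + 1) / 2) * indicator {0..1} x)
      = 2 * ?I 0 1 u"
    unfolding split left right using int_l int_r by simp
  moreover have "(LBINT x. (1 - 2 * \<epsilon>) * indicator {0..1::real} x + u x * indicator {0..1} x)
      = 1 - 2 * \<epsilon> + ?I 0 1 u"
    using int_u by simp
  ultimately have big: "?I 0 1 u \<ge> 1 - 2 * \<epsilon>" by simp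
  have "?I (1/2) 1 u \<le> (LBINT x. indicator {1/2..1::real} x)"
  proof (rule integral_mono)
    show "integrable lborel (indicat_real {1/2..1::real})" by (rule integrable_indicator_Icc)
    show "u x * indicator {1/2..1} x \<le> indicat_real {1/2..1::real} x" for x
      using u(2)[of x] by (simp add: indicator_def)
  qed (rule int_u)
  then have half: "?I (1/2) 1 u \<le> 1/2" by simp
  have "?I 0 (1/2) u = ?I 0 1 (\<lambda>x. u (x / (1 + x)) * (1 / (1 + x)\<^sup>2))"
    using subst(2) by simp
  also have "\<dots> \<le> (LBINT x. (1 + \<epsilon>) * indicator {0..1::real} x - u x * indicator {0..1} x)"
  proof (rule integral_mono_AE)
    show "integrable lborel (\<lambda>x. u (x / (1 + x)) * (1 / (1 + x)\<^sup>2) * indicator {0..1} x)"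
      using subst(1) by (simp add: set_integrable_def mult.commute)
    show "AE x in lborel. u (x / (1 + x)) * (1 / (1 + x)\<^sup>2) * indicator {0..1} x
      \<le> (1 + \<epsilon>) * indicator {0..1::real} x - u x * indicator {0..1} x"
      using ae
    proof eventually_elim
      case (elim x)
      show ?case
      proof (cases "0 < x \<and> x < 1")
        case True
        have "u (x / (1 + x)) * (1 / (1 + x)\<^sup>2) \<le> u (x / (1 + x)) * 1"
          using True u(1) by (intro mult_left_mono) auto
        also have "\<dots> \<le> 1 - u x + \<epsilon>" using ineq' True by simp
        finally show ?thesis using True by simp
      next
        case False
        then have "x \<notin> {0..1}" using elim by auto
        then show ?thesis by simp
      qed
    qed
  qed (use int_u in auto)
  also have "\<dots> = 1 + \<epsilon> - ?I 0 1 u" using int_u by simp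
  \<comment> \<open>Twice the integral lies between \<open>2 - 4 * \<epsilon>\<close> and
    \<open>3/2 + \<epsilon>\<close>, hence \<open>\<epsilon> \<ge> 1/10\<close>; the bound
    \<open>1/20\<close> leaves a margin.\<close>
  finally show ?thesis using big half split by linarith
qed

section \<open>Counting kernel lines over a Foelner set\<close>

lemma G0_mult: "g \<otimes>\<^bsub>G0\<^esub> h = g \<circ> h"
  by (simp add: G0_def homeo_group_def)

lemma G0_gens: "map_a \<in> carrier G0" "map_b \<in> carrier G0" "map_c \<in> carrier G0"
  "inv_b \<in> carrier G0" "inv_c \<in> carrier G0"
proof -
  have "inv\<^bsub>homeo_group\<^esub> map_b = inv_b" "inv\<^bsub>homeo_group\<^esub> map_c = inv_c"
    using inv_homeo_group[OF map_b_homeo, of inv_b] inv_homeo_group[OF map_c_homeo, of inv_c]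
    by (simp_all add: fun_eq_iff inv_b_map_b inv_c_map_c)
  then show "map_a \<in> carrier G0" "map_b \<in> carrier G0" "map_c \<in> carrier G0"
    "inv_b \<in> carrier G0" "inv_c \<in> carrier G0"
    unfolding carrier_G0
    by (metis generate.incl insertI1 insertI2, metis generate.incl insertI1 insertI2,
        metis generate.incl insertI1 insertI2, metis generate.inv insertI1 insertI2,
        metis generate.inv insertI1 insertI2)
qed

definition finv :: "(real \<Rightarrow> real) \<Rightarrow> real \<Rightarrow> real" where
  "finv g = inv_into UNIV g"

lemma finv_eq: "pp_homeo g h \<Longrightarrow> finv g = h"
  unfolding finv_def pp_homeo_def by (intro inv_unique_comp) auto

lemma finv_compose:
  assumes "g \<in> carrier G0" "pp_homeo k k'"
  shows "finv (k \<circ> g) = finv g \<circ> k'"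
proof -
  obtain h where "pp_homeo g h" using G0_pp_homeo[OF assms(1)] ..
  then show ?thesis using finv_eq pp_homeo_compose[OF assms(2)] by metis
qed

lemma ker_at_compose:
  assumes U: "open U" "h y \<in> U" "moebius_on g U M" and V: "open V" "y \<in> V" "moebius_on h V H"
    and h: "continuous_on V h" and M: "odd_mat (mmul M H)" "mker (mmul M H) v"
  shows "ker_at (g \<circ> h) y v"
  unfolding ker_at_def
proof (intro exI conjI)
  show "open (V \<inter> h -` U)" using continuous_open_preimage[OF h V(1) U(1)] .
  show "y \<in> V \<inter> h -` U" using U(2) V(2) by simp
  show "moebius_on (g \<circ> h) (V \<inter> h -` U) (mmul M H)"
    by (rule moebius_on_compose[OF moebius_on_subset[OF V(3)] U(3)]) auto
qed (use M in auto)

text \<open>Translation by \<open>k\<close> is injective, and the translates that leave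
  \<open>F\<close> are few by the Foelner property.\<close>

lemma card_shift_le:
  fixes \<epsilon> :: real
  assumes "finite F" "\<And>g. g \<in> F \<Longrightarrow> P g \<Longrightarrow> Q (k \<circ> g)" "inj k"
    and "real (card ((\<lambda>f. k \<circ> f) ` F - F)) \<le> \<epsilon> * card F"
  shows "real (card {g \<in> F. P g}) \<le> card {g \<in> F. Q g} + \<epsilon> * card F"
proof -
  have "card {g \<in> F. P g} = card ((\<lambda>f. k \<circ> f) ` {g \<in> F. P g})"
    using assms(3) by (intro card_image[symmetric] inj_onI) (auto simp: fun_eq_iff inj_def)
  also have "\<dots> \<le> card ({g \<in> F. Q g} \<union> ((\<lambda>f. k \<circ> f) ` F - F))"
    using assms(1,2) by (intro card_mono) auto
  also have "\<dots> \<le> card {g \<in> F. Q g} + card ((\<lambda>f. k \<circ> f) ` F - F)" by (rule card_Un_le)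
  finally show ?thesis using assms(4) by linarith
qed

theorem G0_not_amenable: "\<not> amenable G0"
proof
  assume "amenable G0"
  let ?\<epsilon> = "1 / 20 :: real"
  \<comment> \<open>Chosen through their inverses, which are \<open>2 * y\<close> on
    \<open>(0, 1/2)\<close> for \<open>k1\<close> and \<open>2 * y - 1\<close> on
    \<open>(1/2, 1)\<close> for \<open>k2\<close>.\<close>
  define k1 where "k1 = inv_b \<circ> inv_c"
  define k2 where "k2 = inv_b \<circ> map_a \<circ> map_c"
  interpret group G0 by (rule group_G0)
  have "k1 \<in> carrier G0" "k2 \<in> carrier G0"
    using G0_gens m_closed unfolding G0_mult k1_def k2_def by auto
  then have K: "{k1, k2, map_b} \<subseteq> carrier G0" using G0_gens by simp
  have "\<exists>F. finite F \<and> F \<noteq> {} \<and> F \<subseteq> carrier G0 \<and>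
    (\<forall>k\<in>{k1, k2, map_b}. real (card ((\<lambda>f. k \<circ> f) ` F - F)) \<le> ?\<epsilon> * card F)"
    using amenable_foelner[OF group_G0 \<open>amenable G0\<close> _ K, of ?\<epsilon>] by (simp add: G0_mult)
  then obtain F where F: "finite F" "F \<noteq> {}" "F \<subseteq> carrier G0"
    and inv1: "real (card ((\<lambda>f. k1 \<circ> f) ` F - F)) \<le> ?\<epsilon> * card F"
    and inv2: "real (card ((\<lambda>f. k2 \<circ> f) ` F - F)) \<le> ?\<epsilon> * card F"
    and inv3: "real (card ((\<lambda>f. map_b \<circ> f) ` F - F)) \<le> ?\<epsilon> * card F" by auto
  \<comment> \<open>Inverses are used because \<open>finv (k \<circ> g)\<close> is
    \<open>finv g\<close> precomposed with a fixed map, so left translation by \<open>k\<close>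
    changes the matrix only by a known right factor.\<close>
  define N where "N v x = card {g \<in> F. ker_at (finv g) x v}" for v x
  have k1: "pp_homeo k1 (map_c \<circ> map_b)"
    unfolding k1_def by (intro pp_homeo_compose pp_homeo_sym[OF pp_homeo_b] pp_homeo_sym[OF pp_homeo_c])
  have k2: "pp_homeo k2 (inv_c \<circ> ((\<lambda>t. t - 1) \<circ> map_b))"
    unfolding k2_def by (intro pp_homeo_compose pp_homeo_sym[OF pp_homeo_b] pp_homeo_a pp_homeo_c)
  have inj: "inj k1" "inj k2" "inj map_b"
    using k1 k2 pp_homeo_b by (auto simp: pp_homeo_def strict_mono_imp_inj_on)
  have "\<exists>D. finite D \<and> (\<forall>g\<in>F. \<forall>x. x \<notin> D \<longrightarrow>
      (\<exists>U M. open U \<and> x \<in> U \<and> moebius_on (finv g) U M \<and> odd_mat M))"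
  proof -
    have "\<exists>B. finite B \<and> (\<forall>x. x \<notin> B \<longrightarrow>
      (\<exists>U M. open U \<and> x \<in> U \<and> moebius_on (finv g) U M \<and> odd_mat M))" if gF: "g \<in> F" for g
    proof -
      obtain h where h: "pp_homeo g h" using G0_pp_homeo[of g] F(3) gF by auto
      then show ?thesis using piecewise_moebius_odd_mat[of h] finv_eq[OF h] by (simp add: pp_homeo_def)
    qed
    then obtain B where "\<forall>g\<in>F. finite (B g) \<and> (\<forall>x. x \<notin> B g \<longrightarrow>
      (\<exists>U M. open U \<and> x \<in> U \<and> moebius_on (finv g) U M \<and> odd_mat M))" by metis
    then show ?thesis using F(1) by (intro exI[of _ "\<Union>g\<in>F. B g"]) simp
  qed
  then obtain D where D: "finite D" "\<And>g x. g \<in> F \<Longrightarrow> x \<notin> D \<Longrightarrow>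
      \<exists>U M. open U \<and> x \<in> U \<and> moebius_on (finv g) U M \<and> odd_mat M" by (elim exE conjE) simp
  have compl: "real (card F) - N v x = card {g \<in> F. \<not> ker_at (finv g) x v}" for v x
  proof -
    have "card F = card {g \<in> F. ker_at (finv g) x v} + card {g \<in> F. \<not> ker_at (finv g) x v}"
      using F(1) by (subst card_Un_disjoint[symmetric]) (auto intro!: arg_cong[of _ _ card])
    then show ?thesis by (simp add: N_def)
  qed
  \<comment> \<open>Mod 2 the matrix of \<open>2 * y\<close> has kernel \<open>(1, 0)\<close> and
    image \<open>(0, 1)\<close>, so the product stays odd if \<open>M\<close> does not kill
    \<open>(0, 1)\<close>.\<close>
  have A1: "real (card F) - N (0, 1) x \<le> N (1, 0) (x / 2) + ?\<epsilon> * card F"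
    if x: "0 < x" "x < 1" "x \<notin> D" for x
    unfolding compl unfolding N_def
  proof (rule card_shift_le[OF F(1) _ inj(1) inv1])
    fix g assume g: "g \<in> F" "\<not> ker_at (finv g) x (0, 1)"
    obtain U M where U: "open U" "x \<in> U" "moebius_on (finv g) U M" "odd_mat M"
      using D(2)[OF g(1) x(3)] by blast
    have M: "\<not> mker M (0, 1)" using g(2) U unfolding ker_at_def by blast
    have k: "(map_c \<circ> map_b) y = 2 * y" if "y \<in> {0<..<1/2}" for y
    proof -
      have "map_b y = y / (1 - y)" "0 \<le> y / (1 - y)" "y / (1 - y) \<le> 1" "1 + y / (1 - y) = 1 / (1 - y)"
        using that by (auto simp: map_b_def divide_simps)
      then show ?thesis using that by (simp add: map_c_def)
    qed
    have "ker_at (finv g \<circ> (map_c \<circ> map_b)) (x / 2) (1, 0)"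
    proof (rule ker_at_compose[OF U(1) _ U(3)])
      show "moebius_on (map_c \<circ> map_b) {0<..<1/2} (Mat 2 0 0 1)" using k by auto
      show "continuous_on {0<..<1/2} (map_c \<circ> map_b)"
        by (subst continuous_on_cong[OF HOL.refl k]) (auto intro!: continuous_intros)
      show "odd_mat (mmul M (Mat 2 0 0 1))" "mker (mmul M (Mat 2 0 0 1)) (1, 0)"
        using M by (cases M, auto)+
    qed (use x U(2) k in auto)
    then show "ker_at (finv (k1 \<circ> g)) (x / 2) (1, 0)"
      using finv_compose[OF _ k1] F(3) g(1) by auto
  qed
  \<comment> \<open>Here the kernel is again \<open>(1, 0)\<close>, while the image is the line of
    \<open>(1, 1)\<close>.\<close>
  have A2: "real (card F) - N (1, 1) x \<le> N (1, 0) ((x + 1) / 2) + ?\<epsilon> * card F"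
    if x: "0 < x" "x < 1" "x \<notin> D" for x
    unfolding compl unfolding N_def
  proof (rule card_shift_le[OF F(1) _ inj(2) inv2])
    fix g assume g: "g \<in> F" "\<not> ker_at (finv g) x (1, 1)"
    obtain U M where U: "open U" "x \<in> U" "moebius_on (finv g) U M" "odd_mat M"
      using D(2)[OF g(1) x(3)] by blast
    have M: "\<not> mker M (1, 1)" using g(2) U unfolding ker_at_def by blast
    let ?k = "inv_c \<circ> ((\<lambda>t. t - 1) \<circ> map_b)"
    have k: "?k y = 2 * y - 1" if "y \<in> {1/2<..<1}" for y
    proof -
      have "map_b y = 3 - 1 / y" "0 \<le> 2 - 1 / y" "2 - 1 / y \<le> 1"
        using that by (auto simp: map_b_def divide_simps)
      moreover have "(2 - 1 / y) / (1 / y) = 2 * y - 1" using that by (simp add: field_simps)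
      ultimately show ?thesis by (simp add: inv_c_def)
    qed
    have "ker_at (finv g \<circ> ?k) ((x + 1) / 2) (1, 0)"
    proof (rule ker_at_compose[OF U(1) _ U(3)])
      show "moebius_on ?k {1/2<..<1} (Mat 2 (-1) 0 1)" using k by auto
      show "continuous_on {1/2<..<1} ?k"
        by (subst continuous_on_cong[OF HOL.refl k]) (auto intro!: continuous_intros)
      show "odd_mat (mmul M (Mat 2 (-1) 0 1))" "mker (mmul M (Mat 2 (-1) 0 1)) (1, 0)"
        using M by (cases M, auto)+
      show "?k ((x + 1) / 2) \<in> U"
      proof (subst k)
        have "2 * ((x + 1) / 2) - 1 = x" by (simp add: add_divide_distrib)
        then show "2 * ((x + 1) / 2) - 1 \<in> U" using U(2) by simp
      qed (use x in auto)
    qed (use x in auto)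
    then show "ker_at (finv (k2 \<circ> g)) ((x + 1) / 2) (1, 0)"
      using finv_compose[OF _ k2] F(3) g(1) by auto
  qed
  \<comment> \<open>The matrix of \<open>inv_b\<close> on \<open>(0, 1)\<close> maps
    \<open>(1, 1)\<close> to \<open>(1, 2)\<close>, which is \<open>(1, 0)\<close> mod 2.\<close>
  have A3: "N (1, 0) (y / (1 + y)) \<le> N (1, 1) y + ?\<epsilon> * card F" if y: "0 < y" "y < 1" for y
    unfolding N_def
  proof (rule card_shift_le[OF F(1) _ inj(3) inv3])
    fix g assume g: "g \<in> F" "ker_at (finv g) (y / (1 + y)) (1, 0)"
    obtain U M where U: "open U" "y / (1 + y) \<in> U" "moebius_on (finv g) U M" "odd_mat M" "mker M (1, 0)"
      using g(2) unfolding ker_at_def by blast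
    have k: "inv_b z = z / (1 + z)" if "z \<in> {0<..<1}" for z using that by (simp add: inv_b_def)
    have "ker_at (finv g \<circ> inv_b) y (1, 1)"
    proof (rule ker_at_compose[OF U(1) _ U(3)])
      show "moebius_on inv_b {0<..<1} (Mat 1 0 1 1)" using k by (auto simp: add.commute)
      show "continuous_on {0<..<1} inv_b"
        by (subst continuous_on_cong[OF HOL.refl k]) (auto intro!: continuous_intros)
      show "odd_mat (mmul M (Mat 1 0 1 1))" "mker (mmul M (Mat 1 0 1 1)) (1, 1)"
        using U(4,5) by (cases M, auto)+
      show "inv_b y \<in> U" using U(2) k y by simp
    qed (use y in auto)
    then show "ker_at (finv (map_b \<circ> g)) y (1, 1)"
      using finv_compose[OF _ pp_homeo_b] F(3) g(1) by auto
  qed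
  have A4: "N (1, 0) x + N (0, 1) x + N (1, 1) x \<le> card F" for x
  proof -
    let ?A = "\<lambda>v. {g \<in> F. ker_at (finv g) x v}"
    have 1: "?A (1, 0) \<inter> ?A (0, 1) = {}" using ker_at_not_both by blast
    have 2: "(?A (1, 0) \<union> ?A (0, 1)) \<inter> ?A (1, 1) = {}" using ker_at_not_both' by blast
    have fin: "finite (?A v)" for v using F(1) by simp
    have "card (?A (1, 0) \<union> ?A (0, 1) \<union> ?A (1, 1)) = card (?A (1, 0)) + card (?A (0, 1)) + card (?A (1, 1))"
      using card_Un_disjoint[OF _ fin 2] card_Un_disjoint[OF fin fin 1] fin by simp
    then have "N (1, 0) x + N (0, 1) x + N (1, 1) x = card (?A (1, 0) \<union> ?A (0, 1) \<union> ?A (1, 1))"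
      unfolding N_def by simp
    also have "\<dots> \<le> card F" using F(1) by (intro card_mono) auto
    finally show ?thesis .
  qed
  have pos: "0 < real (card F)" using F(1,2) by (simp add: card_gt_0_iff)
  define u where "u x = N (1, 0) x / card F" for x
  have "?\<epsilon> > 1 / 20"
  proof (rule doubling_inequality_contradiction[of u D])
    have N: "real (N (1, 0) x) = (\<Sum>g\<in>F. indicator {x. ker_at (finv g) x (1, 0)} x)" for x
      using F(1) by (simp add: N_def indicator_def sum.If_cases Int_def)
    have "{x. ker_at (finv g) x (1, 0)} \<in> sets borel" for g
      using open_ker_at by (rule borel_open)
    then show "u \<in> borel_measurable borel"
      unfolding u_def[abs_def] N by measurable
    show "0 \<le> u x" for x by (simp add: u_def)
    show "u x \<le> 1" for x using A4[of x] pos by (simp add: u_def divide_simps)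
    show "finite D" by fact
    show "u (x / 2) + u ((x + 1) / 2) \<ge> 1 + u x - 2 * ?\<epsilon>" if "0 < x" "x < 1" "x \<notin> D" for x
    proof -
      \<comment> \<open>In the sum of \<open>A1\<close> and \<open>A2\<close> the counts of the
        other two lines are subtracted; together they are at most \<open>card F - N (1, 0) x\<close>
        by \<open>A4\<close>.\<close>
      have "real (card F) + N (1, 0) x - 2 * ?\<epsilon> * card F \<le> N (1, 0) (x / 2) + N (1, 0) ((x + 1) / 2)"
        using A1[OF that] A2[OF that] A4[of x] by linarith
      then have "(real (card F) + N (1, 0) x - 2 * ?\<epsilon> * card F) / card F
          \<le> (N (1, 0) (x / 2) + N (1, 0) ((x + 1) / 2)) / card F"
        using pos by (intro divide_right_mono) auto
      then show ?thesis using pos by (simp add: u_def add_divide_distrib diff_divide_distrib)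
    qed
    show "u (y / (1 + y)) \<le> 1 - u y + ?\<epsilon>" if "0 < y" "y < 1" for y
    proof -
      have "real (N (1, 0) (y / (1 + y))) \<le> real (card F) - real (N (1, 0) y) + ?\<epsilon> * card F"
        using A3[OF that] A4[of y] by linarith
      then have "N (1, 0) (y / (1 + y)) / card F \<le> (real (card F) - real (N (1, 0) y) + ?\<epsilon> * card F) / card F"
        using pos by (intro divide_right_mono) auto
      then show ?thesis using pos by (simp add: u_def add_divide_distrib diff_divide_distrib)
    qed
  qed
  then show False by simp
qed

section \<open>The presented group\<close>

text \<open>Integer powers in additive notation. The class \<open>group_add\<close> is not
  commutative: here \<open>+\<close> is the product of the presented group.\<close>

definition zp :: "'g :: group_add \<Rightarrow> int \<Rightarrow> 'g" where
  "zp x n = (if n \<ge> 0 then ((+) x ^^ nat n) 0 else ((+) (- x) ^^ nat (- n)) 0)"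

lemma zp_0 [simp]: "zp x 0 = 0"
  by (simp add: zp_def)

lemma zp_1 [simp]: "zp x 1 = x"
  by (simp add: zp_def)

lemma zp_Suc: "zp x (n + 1) = x + zp x n"
proof (cases "n \<ge> 0")
  case True
  then have "nat (n + 1) = Suc (nat n)" by simp
  then show ?thesis using True by (simp add: zp_def)
next
  case False
  then have "nat (- n) = Suc (nat (- (n + 1)))" by simp
  moreover have "nat (- (n + 1)) = 0" if "n = -1" using that by simp
  ultimately show ?thesis using False by (auto simp: zp_def add.assoc[symmetric])
qed

lemma zp_add: "zp x (m + n) = zp x m + zp x n"
proof (induction m rule: int_induct[where k = 0])
  case (step1 m)
  have "zp x (m + 1 + n) = x + zp x (m + n)"
    using zp_Suc[of x "m + n"] by (simp only: ac_simps)
  then show ?case using step1 by (simp only: zp_Suc add.assoc)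
next
  case (step2 m)
  have "zp x (m + n) = x + zp x (m - 1 + n)"
  proof -
    have "m - 1 + n + 1 = m + n" by simp
    then show ?thesis using zp_Suc[of x "m - 1 + n"] by metis
  qed
  moreover have "zp x m = x + zp x (m - 1)"
    using zp_Suc[of x "m - 1"] by (simp only: diff_add_cancel)
  ultimately have "x + zp x (m - 1 + n) = x + (zp x (m - 1) + zp x n)"
    using step2 by (simp only: add.assoc)
  then show ?case by (simp only: add_left_cancel)
qed simp

lemma zp_minus: "zp x (- n) = - zp x n"
  using zp_add[of x "- n" n] by (simp add: eq_neg_iff_add_eq_0)

definition com :: "'g :: group_add \<Rightarrow> 'g \<Rightarrow> bool" where
  "com x y \<longleftrightarrow> x + y = y + x"

lemma com_sym: "com x y \<Longrightarrow> com y x"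
  by (simp add: com_def)

lemma com_0 [simp]: "com x 0" "com 0 x"
  by (simp_all add: com_def)

lemma com_add: "com x y \<Longrightarrow> com x z \<Longrightarrow> com x (y + z)"
  unfolding com_def by (metis add.assoc)

lemma com_minus: "com x y \<Longrightarrow> com x (- y)"
  unfolding com_def by (metis add.assoc add.right_neutral add_minus_cancel minus_add_cancel right_minus)

lemma com_diff: "com x y \<Longrightarrow> com x z \<Longrightarrow> com x (y - z)"
  using com_add[of x y "- z"] com_minus[of x z] by (simp add: diff_conv_add_uminus del: add_uminus_conv_diff)

lemma conj_cancel [simp]: "g + a - g = g + b - g \<longleftrightarrow> a = (b :: 'g :: group_add)"
  by (metis add_left_imp_eq diff_add_cancel)

lemma com_conj: "com (g + x - g) (g + y - g) \<longleftrightarrow> com x y"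
proof -
  have "g + u - g + (g + v - g) = g + (u + v) - g" for u v
    by (simp add: diff_conv_add_uminus add.assoc del: add_uminus_conv_diff)
  then show ?thesis by (simp add: com_def)
qed

lemma com_conj': "com x (- g + y + g) \<longleftrightarrow> com (g + x - g) y"
proof -
  have "com (g + x - g) (g + (- g + y + g) - g) \<longleftrightarrow> com x (- g + y + g)" by (rule com_conj)
  then show ?thesis by (simp add: diff_conv_add_uminus add.assoc del: add_uminus_conv_diff)
qed

lemmas free_simps = diff_conv_add_uminus add.assoc minus_add minus_minus add_minus_cancel minus_add_cancel
  right_minus left_minus add_0_left add_0_right

lemma swap_minus:
  assumes "x + a = a + (y :: 'g :: group_add)"
  shows "y + - a = - a + x"
proof -
  have "- a + (x + a) + - a = - a + (a + y) + - a" by (simp only: assms)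
  then show ?thesis by (simp only: add.assoc minus_add_cancel right_minus add_0_right)
qed

type_synonym letter = "int \<times> bool list \<times> bool"

section \<open>Conjugates of the generators and the letters attached to Farey intervals\<close>

locale presented =
  fixes A B C :: "'g :: group_add"
begin

definition cj :: "int \<Rightarrow> 'g \<Rightarrow> 'g" where
  "cj n x = zp A n + x - zp A n"

definition Bn :: "int \<Rightarrow> 'g" where
  "Bn n = cj n B"

text \<open>In the realization this is \<open>b (t + k) - k - 1\<close>, the identity for
  \<open>t \<ge> 1 - k\<close>. For \<open>k \<ge> 1\<close> it thus acts only to the left of
  \<open>(0, 1)\<close>, as \<open>Bn k\<close> acts only to the right.\<close>

definition En :: "int \<Rightarrow> 'g" where
  "En k = - A + Bn (- k)"

text \<open>As a homeomorphism \<open>b\<close> carries \<open>[0, 1/2]\<close> onto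
  \<open>[0, 1]\<close> and \<open>[1/2, 1]\<close> onto \<open>[1, 2]\<close>; conjugating back by
  it, after a shift by \<open>a\<close> in the second case, transports a letter to the corresponding
  half of \<open>[0, 1]\<close>.\<close>

fun Y0 :: "bool list \<Rightarrow> 'g" where
  "Y0 [] = C"
| "Y0 (False # s) = - B + Y0 s + B"
| "Y0 (True # s) = - B + cj 1 (Y0 s) + B"

definition Y :: "int \<Rightarrow> bool list \<Rightarrow> 'g" where
  "Y k s = cj k (Y0 s)"

lemma cj_0 [simp]: "cj 0 x = x"
  by (simp add: cj_def)

lemma cj_cj: "cj m (cj n x) = cj (m + n) x"
  by (simp add: cj_def zp_add diff_conv_add_uminus add.assoc minus_add del: add_uminus_conv_diff)

lemma cj_add: "cj n (x + y) = cj n x + cj n y"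
  by (simp add: cj_def diff_conv_add_uminus add.assoc del: add_uminus_conv_diff)

lemma cj_minus: "cj n (- x) = - cj n x"
  by (simp add: cj_def diff_conv_add_uminus add.assoc minus_add del: add_uminus_conv_diff)

lemma cj_A [simp]: "cj n A = A"
proof -
  have "zp A n + zp A 1 = zp A 1 + zp A n" by (metis zp_add add.commute)
  then show ?thesis by (simp add: cj_def)
qed

lemma cj_1: "cj 1 x = A + x - A"
  by (simp add: cj_def)

lemma com_cj: "com (cj n x) (cj n y) \<longleftrightarrow> com x y"
  unfolding cj_def by (rule com_conj)

lemma com_cj': "com x (cj n y) \<longleftrightarrow> com (cj (- n) x) y"
  using com_cj[of n "cj (- n) x" y] by (simp add: cj_cj)

lemma cj_Bn: "cj m (Bn n) = Bn (m + n)"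
  by (simp add: Bn_def cj_cj)

lemma Bn_0 [simp]: "Bn 0 = B"
  by (simp add: Bn_def)

lemma cj_Y: "cj m (Y n s) = Y (m + n) s"
  by (simp add: Y_def cj_cj)

lemma Y_0: "Y 0 s = Y0 s"
  by (simp add: Y_def)

lemma add_A: "A + cj n x = cj (n + 1) x + A"
proof -
  have "A + cj n x - A = cj (n + 1) x" using cj_cj[of 1 n x] by (simp add: cj_1 add.commute)
  then show ?thesis by (metis diff_add_cancel)
qed

lemma Bn_A: "Bn n + A = A + Bn (n - 1)"
  using add_A[of "n - 1" B] by (simp add: Bn_def)

end

section \<open>Incomparable binary words\<close>

fun incomp :: "bool list \<Rightarrow> bool list \<Rightarrow> bool" where
  "incomp [] u = False"
| "incomp (a # s) [] = False"
| "incomp (a # s) (b # u) = (a \<noteq> b \<or> incomp s u)"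

lemma incomp_Nil [simp]: "incomp u [] = False"
  by (cases u) auto

lemma incomp_sym: "incomp s u = incomp u s"
  by (induction s u rule: incomp.induct) auto

lemma not_incomp: "\<not> incomp s u \<Longrightarrow> (\<exists>w. u = s @ w) \<or> (\<exists>w. s = u @ w)"
  by (induction s u rule: incomp.induct) auto

lemma incomp_append_same: "incomp (w @ s) (w @ u) = incomp s u"
  by (induction w) auto

text \<open>Stated on words so that commutation can be derived from the relations alone; by
  \<open>apart_iff\<close> it means that the Farey intervals are disjoint.\<close>

fun apart :: "letter \<Rightarrow> letter \<Rightarrow> bool" where
  "apart (k, s, e) (l, u, f) = (k \<noteq> l \<or> incomp s u)"

lemma apart_sym: "apart l m = apart m l"
  by (cases l, cases m) (auto simp: incomp_sym)

text \<open>Except for \<open>BBC\<close>, these are the instances 1 and 2 of infinite families.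
  Conjugation by \<open>Bn 1\<close> or \<open>En 1\<close> raises the index, so each family follows
  by induction.\<close>

locale relations = presented A B C for A B C :: "'g :: group_add" +
  assumes BB1: "B + Bn 1 = Bn 2 + B" and BB2: "B + Bn 2 = Bn 3 + B"
    and CB1: "com C (Bn 1)" and CB2: "com C (Bn 2)"
    and CE1: "com C (En 1)" and CE2: "com C (En 2)"
    and CC1: "com C (cj 1 C)" and CC2: "com C (cj 2 C)"
    and BBC: "Bn 1 + B + C = C - cj 1 C + cj 2 C + B + B"
begin

lemma BB_shift: "Bn k + Bn n = Bn (n + 1) + Bn k \<longleftrightarrow> Bn (k + m) + Bn (n + m) = Bn (n + m + 1) + Bn (k + m)"
proof -
  have "cj m (Bn k + Bn n) = cj m (Bn (n + 1) + Bn k) \<longleftrightarrow> Bn k + Bn n = Bn (n + 1) + Bn k"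
    unfolding cj_def by (rule conj_cancel)
  then show ?thesis by (simp add: cj_add cj_Bn ac_simps)
qed

text \<open>Evaluate \<open>B + Bn (m + 3) + Bn 1\<close> with the earlier instances and their
  conjugates by powers of \<open>A\<close>, then cancel \<open>Bn 1\<close> on the right.\<close>

lemma BB_aux: "B + Bn (int n + 1) = Bn (int n + 2) + B"
proof (induction n rule: less_induct)
  case (less n)
  consider "n = 0" | "n = 1" | m where "n = Suc (Suc m)"
    by (metis One_nat_def not0_implies_Suc)
  then show ?case
  proof cases
    case (3 m)
    have i1: "B + Bn (int m + 1) = Bn (int m + 2) + B" and i2: "B + Bn (int m + 2) = Bn (int m + 3) + B"
      using less.IH[of m] less.IH[of "Suc m"] 3 by (auto simp: algebra_simps)
    have j1: "Bn 1 + Bn (int m + 2) = Bn (int m + 3) + Bn 1"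
      using i1 BB_shift[of 0 "int m + 1" 1] by (simp add: algebra_simps)
    have j2: "Bn 2 + Bn (int m + 3) = Bn (int m + 4) + Bn 2"
      using i1 BB_shift[of 0 "int m + 1" 2] by (simp add: algebra_simps)
    have "B + Bn (int m + 3) + Bn 1 = B + (Bn 1 + Bn (int m + 2))" by (simp add: j1 add.assoc)
    also have "\<dots> = Bn 2 + (B + Bn (int m + 2))" using BB1 by (simp add: add.assoc[symmetric])
    also have "\<dots> = (Bn 2 + Bn (int m + 3)) + B" by (simp add: i2 add.assoc)
    also have "\<dots> = Bn (int m + 4) + (Bn 2 + B)" by (simp add: j2 add.assoc)
    also have "\<dots> = Bn (int m + 4) + B + Bn 1" by (simp add: BB1[symmetric] add.assoc)
    finally have "B + Bn (int m + 3) = Bn (int m + 4) + B" by (simp only: add_right_cancel)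
    then show ?thesis by (simp add: 3 algebra_simps)
  qed (use BB1 BB2 in simp_all)
qed

lemma BB: "k < n \<Longrightarrow> Bn k + Bn n = Bn (n + 1) + Bn k"
proof -
  assume "k < n"
  then obtain m where m: "n - k = int m + 1" using zero_less_imp_eq_int[of "n - k"]
    by (metis Suc_pred' add.commute diff_gt_0_iff_gt of_nat_Suc)
  then have "B + Bn (n - k) = Bn (n - k + 1) + B" using BB_aux[of m] by (simp add: add.assoc)
  then show ?thesis using BB_shift[of 0 "n - k" k] by (simp add: algebra_simps)
qed

lemma com_C_Bn: "j \<ge> 1 \<Longrightarrow> com C (Bn j)"
proof (induction j rule: int_ge_induct)
  case base then show ?case by (rule CB1)
next
  case (step j)
  show ?case
  proof (cases "j = 1")
    case True then show ?thesis using CB2 by simp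
  next
    case False
    then have "Bn (j + 1) = Bn 1 + Bn j - Bn 1" using BB[of 1 j] step.hyps by (simp add: eq_diff_eq)
    then show ?thesis using step.IH CB1 by (simp add: com_add com_diff)
  qed
qed

lemma com_C_En: "j \<ge> 1 \<Longrightarrow> com C (En j)"
proof (induction j rule: int_ge_induct)
  case base then show ?case by (rule CE1)
next
  case (step j)
  show ?case
  proof (cases "j = 1")
    case True then show ?thesis using CE2 by simp
  next
    case False
    have e: "Bn (- j) + Bn (- 1) = B + Bn (- j)"
      using BB[of "- j" "- 1"] False step.hyps by simp
    have sw: "Bn (n - 1) + - A = - A + Bn n" for n
      by (rule swap_minus[OF Bn_A])
    have "En 1 + En j = - A + ((Bn (0 - 1) + - A) + Bn (- j))"
      by (simp only: En_def add.assoc diff_0)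
    also have "\<dots> = - A + (- A + (Bn (- j) + Bn (- 1)))" by (simp only: sw e Bn_0 add.assoc)
    also have "\<dots> = - A + ((Bn (- j - 1) + - A) + Bn (- 1))" by (simp only: sw add.assoc)
    also have "\<dots> = En (j + 1) + En 1"
      by (simp only: En_def add.assoc minus_add_distrib diff_conv_add_uminus)
    finally have "En 1 + En j = En (j + 1) + En 1" .
    then have "En (j + 1) = En 1 + En j - En 1" by (simp add: eq_diff_eq)
    then show ?thesis using step.IH CE1 by (simp add: com_add com_diff)
  qed
qed

lemma Bn_B: "j \<ge> 1 \<Longrightarrow> B + Bn j - B = Bn (j + 1)"
  using BB[of 0 j] by (simp add: diff_eq_eq)

lemma com_En_B: "j \<ge> 1 \<Longrightarrow> com (En j) B"
proof -
  assume "j \<ge> 1"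
  then have e: "Bn (- j) + B = Bn 1 + Bn (- j)" using BB[of "- j" 0] by simp
  have sw: "- A + Bn 1 = B + - A"
    using swap_minus[OF Bn_A[of 1]] by simp
  have "En j + B = - A + (Bn 1 + Bn (- j))" by (simp only: En_def add.assoc e)
  also have "\<dots> = (- A + Bn 1) + Bn (- j)" by (simp only: add.assoc)
  also have "\<dots> = B + En j" by (simp only: sw En_def add.assoc)
  finally show ?thesis by (simp add: com_def)
qed

lemma cj_En: "cj (- 1) (En j) = En (j + 1)"
  by (simp only: En_def cj_add cj_minus cj_A cj_Bn) (simp add: algebra_simps)

text \<open>These elements act outside \<open>(0, 1)\<close>. Conjugation by \<open>B\<close> sends
  \<open>Bn j\<close> to \<open>Bn (j + 1)\<close> and fixes \<open>En j\<close>; undoing the shift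
  of the \<open>True\<close> case lowers the first index and raises the second. So the induction has
  to run over all \<open>j \<ge> 1\<close>.\<close>

lemma com_Bn_En_Y0: "j \<ge> 1 \<Longrightarrow> com (Bn j) (Y0 s) \<and> com (En j) (Y0 s)"
proof (induction s arbitrary: j)
  case Nil
  then show ?case using com_C_Bn com_C_En com_sym by auto
next
  case (Cons b s)
  have e: "B + Bn j - B = Bn (j + 1)" "B + En j - B = En j"
    using Bn_B Cons.prems com_En_B[OF Cons.prems] by (auto simp: com_def diff_eq_eq)
  have "com (Bn (j + 1)) (Y0 s)" "com (En j) (Y0 s)" using Cons.IH Cons.prems by auto
  moreover have "com (Bn (j + 1)) (cj 1 (Y0 s))" "com (En j) (cj 1 (Y0 s))"
    using Cons.IH[of j] Cons.IH[of "j + 1"] Cons.prems by (simp_all add: com_cj' cj_Bn cj_En)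
  ultimately show ?case by (cases b) (simp_all add: com_conj' e)
qed

lemma B_Y_neg: "k < 0 \<Longrightarrow> com B (Y k s)"
  using com_Bn_En_Y0[of "- k" s] com_cj[of "- k" B "Y k s"]
  by (simp add: Y_def cj_cj Bn_def)

text \<open>To the right of 1 the maps \<open>a\<close> and \<open>b\<close> agree. Algebraically,
  \<open>- A + B\<close> is a conjugate of \<open>En k\<close> and so commutes with the letter, on
  which \<open>B\<close> therefore acts as \<open>A\<close> does.\<close>

lemma B_Y_pos: "k \<ge> 1 \<Longrightarrow> B + Y k s = Y (k + 1) s + B"
proof -
  assume k: "k \<ge> 1"
  have e: "cj k (En k) = - A + B" by (simp add: En_def cj_add cj_minus cj_Bn)
  have "com (- A + B) (Y k s)"
    unfolding Y_def e[symmetric] com_cj using com_Bn_En_Y0[OF k] by simp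
  then have e: "- A + (B + Y k s) = Y k s + (- A + B)" by (simp only: com_def add.assoc)
  have "B + Y k s = A + (- A + (B + Y k s))" by (simp only: free_simps)
  also have "\<dots> = A + (Y k s + (- A + B))" by (simp only: e)
  also have "\<dots> = (A + Y k s - A) + B" by (simp only: free_simps)
  also have "A + Y k s - A = Y (k + 1) s" using cj_Y[of 1 k s] by (simp add: cj_1 add.commute)
  finally show ?thesis .
qed

lemma B_Y_False: "B + Y 0 (False # s) = Y 0 s + B"
  by (simp add: Y_0 add.assoc[symmetric])

lemma B_Y_True: "B + Y 0 (True # s) = Y 1 s + B"
  by (simp add: Y_def add.assoc[symmetric])

lemma A_Y: "A + Y k s = Y (k + 1) s + A"
  by (simp add: Y_def add_A)

lemma com_C_cj_C: "k \<ge> 1 \<Longrightarrow> com C (cj k C)"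
proof (induction k rule: int_ge_induct)
  case base then show ?case by (rule CC1)
next
  case (step k)
  show ?case
  proof (cases "k = 1")
    case True then show ?thesis using CC2 by simp
  next
    case False
    then have "B + Y (k - 1) [] = Y k [] + B" using B_Y_pos[of "k - 1" "[]"] step.hyps by simp
    then have "cj 1 (B + Y (k - 1) []) = cj 1 (Y k [] + B)" by simp
    then have "Bn 1 + Y k [] = Y (k + 1) [] + Bn 1" by (simp add: cj_add cj_Y Bn_def add.commute)
    then have "cj (k + 1) C = Bn 1 + cj k C - Bn 1" by (simp add: Y_def eq_diff_eq)
    then show ?thesis using step.IH CB1 by (simp add: com_add com_diff)
  qed
qed

lemma com_C_Y: "k \<ge> 1 \<Longrightarrow> com C (Y k u)"
proof (induction u arbitrary: k)
  case Nil then show ?case using com_C_cj_C by (simp add: Y_def)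
next
  case (Cons b u)
  have Y: "Y k (b # u) = - Bn k + Y (if b then k + 1 else k) u + Bn k"
    by (cases b) (simp_all add: Y_def cj_add cj_minus cj_cj Bn_def)
  have "com C (Bn k)" by (rule com_C_Bn[OF Cons.prems])
  moreover have "com C (Y (if b then k + 1 else k) u)" using Cons by simp
  ultimately show ?case unfolding Y by (intro com_add com_minus)
qed

lemma com_Y0_Y: "k \<ge> 1 \<Longrightarrow> com (Y0 s) (Y k u)"
proof (induction s arbitrary: k)
  case Nil then show ?case using com_C_Y by simp
next
  case (Cons b s)
  have "Y0 (b # s) = - B + Y (if b then 1 else 0) s + B"
    by (cases b) (simp_all add: Y_def)
  moreover have "B + Y k u - B = Y (k + 1) u" using B_Y_pos[OF Cons.prems] by (simp add: diff_eq_eq)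
  moreover have "com (Y (if b then 1 else 0) s) (Y (k + 1) u)"
  proof (cases b)
    case True
    have "com (cj 1 (Y0 s)) (cj 1 (Y k u))" using Cons by (simp add: com_cj)
    then show ?thesis using True by (simp add: Y_def cj_cj add.commute)
  next
    case False
    then show ?thesis using Cons by (simp add: Y_0)
  qed
  ultimately show ?case by (metis com_conj' com_sym)
qed

lemma com_Y0_Y0: "incomp s u \<Longrightarrow> com (Y0 s) (Y0 u)"
proof (induction s u rule: incomp.induct)
  case (3 a s b u)
  have c: "com (- B + x + B) (- B + y + B) \<longleftrightarrow> com x y" for x y
    using com_conj[of "- B" x y] by simp
  show ?case
  proof (cases "a = b")
    case True
    then show ?thesis using 3 by (cases a) (simp_all add: c com_cj)
  next
    case False
    have "com (Y0 s) (cj 1 (Y0 u))" "com (Y0 u) (cj 1 (Y0 s))" using com_Y0_Y[of 1] by (simp_all add: Y_def)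
    then show ?thesis using False by (cases a) (simp_all add: c com_sym)
  qed
qed auto

definition Yl :: "letter \<Rightarrow> 'g" where
  "Yl l = (case l of (k, s, e) \<Rightarrow> if e then Y k s else - Y k s)"

lemma com_Yl:
  assumes "apart l m"
  shows "com (Yl l) (Yl m)"
proof -
  obtain k s e where l: "l = (k, s, e)" by (cases l)
  obtain j u f where m: "m = (j, u, f)" by (cases m)
  have lt: "com (Y k s) (Y j u)" if "k < j" for k j s u
    using com_Y0_Y[of "j - k" s u] that com_cj[of k "Y0 s" "Y (j - k) u"] by (simp add: cj_Y) (simp add: Y_def)
  have "com (Y k s) (Y j u)"
    using assms lt[of k j s u] lt[of j k u s] com_Y0_Y0[of s u] com_sym
    by (cases k j rule: linorder_cases) (auto simp: l m Y_def com_cj)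
  then show ?thesis unfolding l m Yl_def using com_minus com_sym
    by (simp split: prod.splits) blast
qed

definition prodY :: "letter list \<Rightarrow> 'g" where
  "prodY ls = sum_list (map Yl ls)"

lemma prodY_Nil [simp]: "prodY [] = 0"
  by (simp add: prodY_def)

lemma prodY_Cons [simp]: "prodY (l # ls) = Yl l + prodY ls"
  by (simp add: prodY_def)

lemma prodY_append: "prodY (ls @ ms) = prodY ls + prodY ms"
  by (simp add: prodY_def)

section \<open>The subgroup generated by the first two generators, and the subdivision of a
  letter\<close>

inductive_set Thompson :: "'g set" where
  Thompson_0: "0 \<in> Thompson"
| Thompson_step: "x \<in> Thompson \<Longrightarrow> y \<in> {A, - A, B, - B} \<Longrightarrow> x + y \<in> Thompson"

lemma Thompson_add: "y \<in> Thompson \<Longrightarrow> x \<in> Thompson \<Longrightarrow> x + y \<in> Thompson"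
  by (induction rule: Thompson.induct) (auto simp: add.assoc[symmetric] intro: Thompson_step)

lemma Thompson_gen: "A \<in> Thompson" "B \<in> Thompson" "- A \<in> Thompson" "- B \<in> Thompson"
  using Thompson_step[OF Thompson_0, of A] Thompson_step[OF Thompson_0, of B] Thompson_step[OF Thompson_0, of "- A"] Thompson_step[OF Thompson_0, of "- B"]
  by auto

lemma Thompson_minus: "x \<in> Thompson \<Longrightarrow> - x \<in> Thompson"
proof (induction rule: Thompson.induct)
  case (Thompson_step x y)
  then have "- y \<in> Thompson" "- x \<in> Thompson" using Thompson_gen by auto
  then show ?case unfolding minus_add by (intro Thompson_add)
qed (simp add: Thompson_0)

lemma Thompson_zp: "zp A n \<in> Thompson"
proof -
  have "((+) x ^^ n) 0 \<in> Thompson" if "x \<in> Thompson" for x n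
    using that by (induction n) (auto intro: Thompson_0 Thompson_add)
  then show ?thesis using Thompson_gen by (simp add: zp_def)
qed

text \<open>One conjugator serves all \<open>u\<close>, so a relation between letters below
  \<open>[0, 1]\<close> carries over to every interval.\<close>

lemma Y_conj: "\<exists>g\<in>Thompson. \<forall>u. Y k (s @ u) = g + Y0 u - g"
proof -
  have "\<exists>g\<in>Thompson. \<forall>u. Y0 (s @ u) = g + Y0 u - g"
  proof (induction s)
    case Nil show ?case by (rule bexI[of _ 0]) (auto intro: Thompson_0)
  next
    case (Cons b s)
    then obtain g where g: "g \<in> Thompson" "\<forall>u. Y0 (s @ u) = g + Y0 u - g" by blast
    let ?h = "- B + (if b then A + g else g)"
    have "Y0 ((b # s) @ u) = ?h + Y0 u - ?h" for u
      using g(2) by (cases b)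
        (simp_all add: cj_1 diff_conv_add_uminus minus_add add.assoc del: add_uminus_conv_diff)
    moreover have "?h \<in> Thompson" using g(1) Thompson_gen Thompson_add by simp
    ultimately show ?case by blast
  qed
  then obtain g where g: "g \<in> Thompson" "\<forall>u. Y0 (s @ u) = g + Y0 u - g" by blast
  have "Y k (s @ u) = (zp A k + g) + Y0 u - (zp A k + g)" for u
    using g(2) by (simp add: Y_def cj_def diff_conv_add_uminus minus_add add.assoc del: add_uminus_conv_diff)
  then show ?thesis using Thompson_add[OF g(1) Thompson_zp] by blast
qed

text \<open>In the realization this maps the intervals of the words 00, 01, 1 onto those of 0, 10,
  11 (with 0 for \<open>False\<close>) and fixes every point outside \<open>[0, 1]\<close>: the
  Thompson element that remains when \<open>c\<close> is subdivided.\<close>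

definition X0 :: 'g where
  "X0 = - B - Bn 1 + B + B"

lemma X0_Thompson: "X0 \<in> Thompson"
proof -
  have "Bn 1 \<in> Thompson" using Thompson_gen Thompson_add by (simp add: Bn_def cj_1 diff_conv_add_uminus del: add_uminus_conv_diff)
  then show ?thesis unfolding X0_def diff_conv_add_uminus by (intro Thompson_add Thompson_minus Thompson_gen)
qed

text \<open>The three letters are the conjugates by \<open>B + B\<close> of the factors
  \<open>C\<close>, \<open>cj 1 C\<close>, \<open>cj 2 C\<close> of \<open>BBC\<close>; for
  \<open>Y0 [True]\<close> this uses \<open>c2\<close>.\<close>

lemma expand_pos: "C = X0 + Y0 [False, False] - Y0 [False, True] + Y0 [True]"
proof -
  have c2: "- B + cj 2 C + B = cj 1 C"
  proof -
    have "- B + (B + cj 1 C) = - B + (cj 2 C + B)" using B_Y_pos[of 1 "[]"] by (simp add: Y_def)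
    then show ?thesis by (simp only: free_simps)
  qed
  have "X0 + Y0 [False, False] - Y0 [False, True] + Y0 [True]
      = - B - Bn 1 + (B + B) + (- B - B + C + B + B) + - (- B - B + cj 1 C + B + B) + (- B + (- B + cj 2 C + B) + B)"
    by (simp add: X0_def c2) (simp only: free_simps)
  also have "\<dots> = - B - Bn 1 + (C - cj 1 C + cj 2 C + B + B)"
    by (simp only: free_simps)
  also have "\<dots> = C" unfolding BBC[symmetric] by (simp only: free_simps)
  finally show ?thesis by simp
qed

text \<open>The same relation with the Thompson element on the right. As \<open>C\<close> commutes
  with \<open>Bn 1\<close>, the three letters are also conjugates of the factors of
  \<open>BBC\<close> by \<open>Bn 1 + B\<close>.\<close>

lemma expand_neg: "C = Y0 [False] - Y0 [True, False] + Y0 [True, True] + X0"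
proof -
  have c0: "- Bn 1 + C + Bn 1 = C"
    using com_C_Bn[of 1] by (simp add: com_def add.assoc)
  have y1: "Y0 [False] = - B + - Bn 1 + C + Bn 1 + B"
    unfolding Y0.simps by (subst c0[symmetric]) (simp only: add.assoc)
  have y2: "Y0 [True, False] = - B + - Bn 1 + cj 1 C + Bn 1 + B"
    by (simp only: Y0.simps cj_add cj_minus Bn_def add.assoc)
  have y3: "Y0 [True, True] = - B + - Bn 1 + cj 2 C + Bn 1 + B"
    by (simp only: Y0.simps cj_add cj_minus cj_cj Bn_def add.assoc) simp
  have "Y0 [False] - Y0 [True, False] + Y0 [True, True] + X0
      = - B + - Bn 1 + (C - cj 1 C + cj 2 C + B + B)"
    unfolding y1 y2 y3 X0_def
    by (simp only: free_simps)
  also have "\<dots> = C" unfolding BBC[symmetric] by (simp only: free_simps)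
  finally show ?thesis by simp
qed

end

section \<open>Farey intervals\<close>

text \<open>\<open>Mat p p' q q'\<close> with \<open>p q' - p' q = -1\<close> encodes the Farey interval with end points
  \<open>p / q < p' / q'\<close>; \<open>gen False\<close> and \<open>gen True\<close> pass to the two halves at the mediant.\<close>

definition gen :: "bool \<Rightarrow> mat" where
  "gen b = (if b then Mat 1 0 1 1 else Mat 1 1 0 1)"

fun Wm :: "bool list \<Rightarrow> mat" where
  "Wm [] = Mat 1 0 0 1"
| "Wm (b # s) = mmul (gen b) (Wm s)"

definition cone_mat :: "int \<Rightarrow> bool list \<Rightarrow> mat" where
  "cone_mat k s = mmul (Mat k (k + 1) 1 1) (Wm s)"

fun lp :: "mat \<Rightarrow> real" where
  "lp (Mat p p' q q') = of_int p / of_int q"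

fun rp :: "mat \<Rightarrow> real" where
  "rp (Mat p p' q q') = of_int p' / of_int q'"

fun farey :: "mat \<Rightarrow> bool" where
  "farey (Mat p p' q q') \<longleftrightarrow> q > 0 \<and> q' > 0 \<and> p * q' - p' * q = - 1"

fun den :: "mat \<Rightarrow> int" where
  "den (Mat p p' q q') = q + q'"

definition interval :: "mat \<Rightarrow> real set" where
  "interval M = {lp M<..<rp M}"

lemma mmul_assoc: "mmul (mmul L M) N = mmul L (mmul M N)"
  by (cases L, cases M, cases N) (simp add: algebra_simps)

lemma mmul_id [simp]: "mmul M (Mat 1 0 0 1) = M" "mmul (Mat 1 0 0 1) M = M"
  by (cases M, simp)+

lemma Wm_append: "Wm (s @ u) = mmul (Wm s) (Wm u)"
  by (induction s) (simp_all add: mmul_assoc)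

lemma cone_mat_append: "cone_mat k (s @ u) = mmul (cone_mat k s) (Wm u)"
  by (simp add: cone_mat_def Wm_append mmul_assoc)

lemma cone_mat_snoc: "cone_mat k (s @ [b]) = mmul (cone_mat k s) (gen b)"
  by (simp add: cone_mat_append)

lemma farey_less:
  assumes "farey M" shows "lp M < rp M"
proof -
  obtain p p' q q' where M: "M = Mat p p' q q'" by (cases M)
  have q: "0 < real_of_int q" "0 < real_of_int q'" and d: "p' * q = p * q' + 1" using assms by (auto simp: M)
  have "real_of_int p' * of_int q = of_int p * of_int q' + 1"
    using arg_cong[OF d, of real_of_int] by simp
  then show ?thesis using q by (simp add: M divide_simps mult.commute)
qed

lemma farey_gen:
  assumes "farey M"
  shows "farey (mmul M (gen b))" "lp M \<le> lp (mmul M (gen b))" "rp (mmul M (gen b)) \<le> rp M"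
    "den M + 1 \<le> den (mmul M (gen b))" "rp (mmul M (gen False)) = lp (mmul M (gen True))"
proof -
  obtain p p' q q' where M: "M = Mat p p' q q'" by (cases M)
  have q: "q > 0" "q' > 0" and d: "p' * q = p * q' + 1" using assms by (auto simp: M)
  show "farey (mmul M (gen b))" using q d by (simp add: M gen_def algebra_simps)
  show "den M + 1 \<le> den (mmul M (gen b))" using q by (simp add: M gen_def)
  show "rp (mmul M (gen False)) = lp (mmul M (gen True))" by (simp add: M gen_def)
  have q': "0 < real_of_int q" "0 < real_of_int q'" using q by auto
  have "real_of_int p' * of_int q = of_int p * of_int q' + 1"
    using arg_cong[OF d, of real_of_int] by simp
  then have e: "real_of_int p * of_int q' \<le> real_of_int p' * of_int q" by simp
  show "lp M \<le> lp (mmul M (gen b))" using q' e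
    by (simp add: M gen_def divide_simps add_pos_pos) (simp add: algebra_simps)
  show "rp (mmul M (gen b)) \<le> rp M" using q' e
    by (simp add: M gen_def divide_simps add_pos_pos) (simp add: algebra_simps)
qed

lemma farey_Wm:
  assumes "farey M"
  shows "farey (mmul M (Wm s)) \<and> lp M \<le> lp (mmul M (Wm s)) \<and> rp (mmul M (Wm s)) \<le> rp M \<and>
    den M + int (length s) \<le> den (mmul M (Wm s))"
  using assms
proof (induction s arbitrary: M)
  case (Cons b s)
  show ?case using Cons.IH[OF farey_gen(1)[OF Cons.prems, of b]] farey_gen(1-4)[OF Cons.prems, of b]
    by (simp add: mmul_assoc[symmetric])
qed simp

lemma farey_base: "farey (Mat k (k + 1) 1 1)"
  by simp

lemma farey_cone_mat: "farey (cone_mat k s)"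
  unfolding cone_mat_def using farey_Wm[OF farey_base] by blast

lemma interval_Wm: "farey M \<Longrightarrow> interval (mmul M (Wm s)) \<subseteq> interval M"
  using farey_Wm[of M s] by (auto simp: interval_def)

definition cone :: "int \<Rightarrow> bool list \<Rightarrow> real set" where
  "cone k s = interval (cone_mat k s)"

lemma open_cone: "open (cone k s)"
  by (simp add: cone_def interval_def)

lemma cone_nonempty: "cone k s \<noteq> {}"
  using farey_less[OF farey_cone_mat, of k s] by (simp add: cone_def interval_def)

lemma infinite_cone: "infinite (cone k s)"
proof
  assume "finite (cone k s)"
  then have "cone k s = {}" by (rule finite_imp_not_open[OF _ open_cone])
  then show False using cone_nonempty by simp
qed

lemma cone_append: "cone k (s @ u) \<subseteq> cone k s"
  unfolding cone_def cone_mat_append by (rule interval_Wm[OF farey_cone_mat])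

lemma cone_base: "cone k s \<subseteq> {of_int k<..<of_int k + 1}"
  using interval_Wm[OF farey_base, of k s] by (simp add: cone_def cone_mat_def interval_def)

lemma interval_disjoint: "farey M \<Longrightarrow> incomp s u \<Longrightarrow> interval (mmul M (Wm s)) \<inter> interval (mmul M (Wm u)) = {}"
proof (induction s u arbitrary: M rule: incomp.induct)
  case (3 a s b u)
  have f: "farey (mmul M (gen c))" for c using farey_gen(1)[OF 3(2)] .
  show ?case
  proof (cases "a = b")
    case True
    then show ?thesis using 3 f by (simp add: mmul_assoc[symmetric])
  next
    case False
    have "interval (mmul M (gen False)) \<inter> interval (mmul M (gen True)) = {}"
      using farey_gen(5)[OF 3(2)] by (auto simp: interval_def)
    then have disj: "interval (mmul M (gen a)) \<inter> interval (mmul M (gen b)) = {}"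
      using False by (cases a; cases b) (simp_all add: Int_commute)
    have sub: "interval (mmul M (Wm (c # v))) \<subseteq> interval (mmul M (gen c))" for c v
      using interval_Wm[OF f] by (simp add: mmul_assoc[symmetric])
    show ?thesis using Int_mono[OF sub[of a s] sub[of b u]] unfolding disj by (rule subset_empty[THEN iffD1])
  qed
qed auto

lemma cone_disjoint_iff: "cone k s \<inter> cone j u = {} \<longleftrightarrow> k \<noteq> j \<or> incomp s u"
proof
  show "cone k s \<inter> cone j u = {}" if "k \<noteq> j \<or> incomp s u"
  proof (cases "k = j")
    case True
    then show ?thesis using that interval_disjoint[OF farey_base] by (simp add: cone_def cone_mat_def)
  next
    case False
    have "{of_int k<..<of_int k + 1} \<inter> {of_int j<..<of_int j + 1 :: real} = {}"
    proof -
      have "k = j" if "t \<in> {of_int k<..<of_int k + 1}" "t \<in> {of_int j<..<of_int j + 1}" for t :: real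
      proof -
        have "real_of_int k < of_int (j + 1)" "real_of_int j < of_int (k + 1)" using that by auto
        then show ?thesis unfolding of_int_less_iff by simp
      qed
      then show ?thesis using False by blast
    qed
    then show ?thesis using cone_base by blast
  qed
  show "k \<noteq> j \<or> incomp s u" if "cone k s \<inter> cone j u = {}"
  proof (rule ccontr)
    assume "\<not> ?thesis"
    then have jk: "j = k" and "(\<exists>w. u = s @ w) \<or> (\<exists>w. s = u @ w)" using not_incomp by auto
    then consider w where "u = s @ w" | w where "s = u @ w" by blast
    then show False
    proof cases
      case 1
      then have "cone j u \<subseteq> cone k s" using cone_append jk by simp
      then show ?thesis using that cone_nonempty[of j u] by blast
    next
      case 2
      then have "cone k s \<subseteq> cone j u" using cone_append jk by simp
      then show ?thesis using that cone_nonempty[of k s] by blast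
    qed
  qed
qed

text \<open>A fraction \<open>a / d\<close> strictly between the Farey neighbours
  \<open>p / q\<close> and \<open>p' / q'\<close> is a combination of them with positive integer
  coefficients, so \<open>d \<ge> q + q'\<close>; and \<open>q + q'\<close> grows with the length of
  the word.\<close>

lemma cone_avoid:
  assumes "finite (F :: real set)" "F \<subseteq> \<rat>"
  shows "\<exists>n. \<forall>k s. n \<le> length s \<longrightarrow> cone k s \<inter> F = {}"
  using assms
proof (induction F rule: finite_induct)
  case (insert r F)
  then obtain n where n: "\<forall>k s. n \<le> length s \<longrightarrow> cone k s \<inter> F = {}" by auto
  obtain a d :: int where ad: "d > 0" "r = of_int a / of_int d"
    using insert.prems by (metis Rats_cases' insert_subset)
  have "r \<notin> cone k s" if "nat d \<le> length s" for k s
  proof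
    assume r: "r \<in> cone k s"
    obtain p p' q q' where M: "cone_mat k s = Mat p p' q q'" by (cases "cone_mat k s")
    have f: "q > 0" "q' > 0" "p' * q = p * q' + 1" using farey_cone_mat[of k s] by (auto simp: M)
    have "real_of_int p * of_int d < of_int a * of_int q" "real_of_int a * of_int q' < of_int p' * of_int d"
      using r f ad by (auto simp: cone_def interval_def M divide_simps mult.commute split: if_splits)
    then have "p * d < a * q" "a * q' < p' * d"
      by (metis of_int_less_iff of_int_mult)+
    then have i: "1 \<le> a * q - p * d" "1 \<le> p' * d - a * q'" by auto
    have "d = q * (p' * d - a * q') + q' * (a * q - p * d)"
    proof -
      have "q * (p' * d - a * q') + q' * (a * q - p * d) = (p' * q - p * q') * d" by algebra
      then show ?thesis using f(3) by simp
    qed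
    moreover have "q * 1 \<le> q * (p' * d - a * q')" "q' * 1 \<le> q' * (a * q - p * d)"
      using i f by (intro mult_left_mono; simp)+
    ultimately have "q + q' \<le> d" by linarith
    moreover have "2 + int (length s) \<le> q + q'"
      using farey_Wm[OF farey_base, of k s] M by (simp add: cone_mat_def)
    ultimately show False using that ad(1) by linarith
  qed
  then show ?case using n by (intro exI[of _ "max n (nat d)"]) auto
qed simp

text \<open>A letter \<open>(k, s, e)\<close> is anchored at one end point of its interval: at the right one if \<open>e\<close>
  holds, at the left one otherwise. Only the parities of the coordinates matter.\<close>

fun avec :: "letter \<Rightarrow> int \<times> int" where
  "avec (k, s, e) = (case cone_mat k s of Mat p p' q q' \<Rightarrow> if e then (p', q') else (p, q))"

definition par :: "int \<times> int \<Rightarrow> bool \<times> bool" where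
  "par v = (odd (fst v), odd (snd v))"

definition acol :: "letter \<Rightarrow> bool \<times> bool" where
  "acol l = par (avec l)"

lemma mker_par: "par v = par w \<Longrightarrow> mker M v = mker M w"
  by (cases M; cases v; cases w) (auto simp: par_def)

lemma mker_unique_par:
  assumes "odd_mat M" "mker M v" "mker M w" "par v \<noteq> (False, False)" "par w \<noteq> (False, False)"
  shows "par v = par w"
  using assms by (cases M; cases v; cases w) (auto simp: par_def)

lemma acol_nonzero: "acol l \<noteq> (False, False)"
proof -
  obtain k s e where l: "l = (k, s, e)" by (cases l)
  obtain p p' q q' where M: "cone_mat k s = Mat p p' q q'" by (cases "cone_mat k s")
  have "p' * q - p * q' = 1" using farey_cone_mat[of k s] by (simp add: M)
  then have "odd (p' * q - p * q')" by simp
  then show ?thesis by (auto simp: l acol_def par_def M)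
qed

lemma acol_neq: "acol (k, s, True) \<noteq> acol (k, s, False)"
proof -
  obtain p p' q q' where M: "cone_mat k s = Mat p p' q q'" by (cases "cone_mat k s")
  have "p' * q - p * q' = 1" using farey_cone_mat[of k s] by (simp add: M)
  then have "odd (p' * q - p * q')" by simp
  then show ?thesis by (auto simp: acol_def par_def M)
qed

section \<open>Parity classes of end points and the subdivision of letters\<close>

definition bxor :: "bool \<times> bool \<Rightarrow> bool \<times> bool \<Rightarrow> bool \<times> bool" where
  "bxor v w = (fst v \<noteq> fst w, snd v \<noteq> snd w)"

lemma bxor_cancel [simp]: "bxor v (bxor v w) = w" "bxor (bxor w v) v = w"
  by (auto simp: bxor_def prod_eq_iff)

lemma bxor_neq: "v \<noteq> (False, False) \<Longrightarrow> bxor v w \<noteq> w \<and> bxor w v \<noteq> w"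
  by (auto simp: bxor_def prod_eq_iff)

text \<open>The new end point is the mediant, whose coordinates are sums. So the two end points and
  the mediant represent the three points of the projective line over the field with two
  elements.\<close>

lemma acol_snoc:
  "acol (k, s @ [False], False) = acol (k, s, False)"
  "acol (k, s @ [False], True) = bxor (acol (k, s, False)) (acol (k, s, True))"
  "acol (k, s @ [True], False) = bxor (acol (k, s, False)) (acol (k, s, True))"
  "acol (k, s @ [True], True) = acol (k, s, True)"
  by (cases "cone_mat k s", auto simp: acol_def par_def cone_mat_snoc gen_def bxor_def)+

text \<open>The half that contains the anchor carries one piece, the other half two pieces that lie
  one level deeper, hence \<open>n - 1\<close>. For \<open>n = 0\<close> the truncated subtraction
  lets these two overshoot the depth by one.\<close>

function (sequential) expand :: "nat \<Rightarrow> letter \<Rightarrow> letter list" where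
  "expand 0 l = [l]"
| "expand (Suc n) (k, s, True) = expand (n - 1) (k, s @ [False, False], True) @
     expand (n - 1) (k, s @ [False, True], False) @ expand n (k, s @ [True], True)"
| "expand (Suc n) (k, s, False) = expand n (k, s @ [False], False) @
     expand (n - 1) (k, s @ [True, False], True) @ expand (n - 1) (k, s @ [True, True], False)"
  by pat_completeness auto
termination by (relation "Wellfounded.measure fst") auto

text \<open>The pieces depend only on depth and colour: an interval at depth \<open>n\<close> with
  an end point of the colour carries one piece anchored there; otherwise its mediant has the colour,
  and each of its halves carries a piece. This description makes subdivisions of different letters
  comparable.\<close>

definition lev :: "nat \<Rightarrow> letter \<Rightarrow> letter \<Rightarrow> bool" where
  "lev n l m \<longleftrightarrow> (case l of (k, s, e) \<Rightarrow> case m of (j, u, f) \<Rightarrow> j = k \<and> acol m = acol l \<and>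
     (\<exists>w. u = s @ w \<and> (length w = n \<or>
       length w = Suc n \<and> (\<forall>f'. acol (k, butlast u, f') \<noteq> acol l))))"

text \<open>Matches the depth count of \<open>lev\<close> with the three branches of
  \<open>expand\<close>; \<open>P\<close> stands for the condition that the parent interval has no
  end point of the colour. The last two hypotheses settle the overshoot at
  \<open>n = 0\<close>.\<close>

lemma append_levels:
  assumes "u \<noteq> s @ [c]" "\<And>b. u = s @ [c, b] \<Longrightarrow> P" "\<And>b d. u = s @ [c, b, d] \<Longrightarrow> \<not> P"
  shows "(\<exists>w. u = s @ w \<and> (length w = Suc n \<or> length w = Suc (Suc n) \<and> P)) \<longleftrightarrow>
    (\<exists>w. u = (s @ [c, False]) @ w \<and> (length w = n - 1 \<or> length w = Suc (n - 1) \<and> P)) \<or>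
    (\<exists>w. u = (s @ [c, True]) @ w \<and> (length w = n - 1 \<or> length w = Suc (n - 1) \<and> P)) \<or>
    (\<exists>w. u = (s @ [\<not> c]) @ w \<and> (length w = n \<or> length w = Suc n \<and> P))" (is "?L \<longleftrightarrow> ?R")
proof
  assume ?L
  then obtain w where w: "u = s @ w" "length w = Suc n \<or> length w = Suc (Suc n) \<and> P" by blast
  then obtain b w' where w': "w = b # w'" by (cases w) auto
  show ?R
  proof (cases "b = c")
    case True
    then obtain b' w'' where w'': "w' = b' # w''" using assms(1) w w' by (cases w') auto
    then show ?thesis using w w' True by (cases n; cases b') auto
  next
    case False
    then have "b = (\<not> c)" by auto
    then show ?thesis using w w' by auto
  qed
next
  have *: ?L if "u = (s @ [c, b]) @ w" "length w = n - 1 \<or> length w = Suc (n - 1) \<and> P" for b w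
  proof (cases n)
    case 0
    show ?thesis
    proof (cases w)
      case Nil
      then show ?thesis using that 0 assms(2) by (intro exI[of _ "[c, b]"]) auto
    next
      case (Cons d w')
      then have "u = s @ [c, b, d]" "P" using that 0 by auto
      then show ?thesis using assms(3) by blast
    qed
  next
    case (Suc n')
    then show ?thesis using that by (intro exI[of _ "c # b # w"]) auto
  qed
  assume ?R
  then consider b w where "u = (s @ [c, b]) @ w" "length w = n - 1 \<or> length w = Suc (n - 1) \<and> P"
    | w where "u = (s @ [\<not> c]) @ w" "length w = n \<or> length w = Suc n \<and> P" by blast
  then show ?L
  proof cases
    case 1 then show ?thesis by (rule *)
  next
    case (2 w) then show ?thesis by (intro exI[of _ "(\<not> c) # w"]) auto
  qed
qed

lemma set_expand: "set (expand n l) = {m. lev n l m}"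
proof (induction n l rule: expand.induct)
  case (1 l)
  obtain k s e where l: "l = (k, s, e)" by (cases l)
  have "lev 0 l m \<longleftrightarrow> m = l" for m
  proof -
    obtain j u f where m: "m = (j, u, f)" by (cases m)
    have "acol (k, s, f) = acol (k, s, e) \<longleftrightarrow> f = e" using acol_neq[of k s] by (cases f; cases e) auto
    moreover have "\<exists>f'. acol (k, s, f') = acol l" using l by auto
    ultimately show ?thesis
      by (auto simp: lev_def l m length_Suc_conv butlast_append)
  qed
  then show ?case by auto
next
  case (2 n k s)
  let ?l = "(k, s, True)"
  \<comment> \<open>The half away from the anchor has end points of the two other colours.\<close>
  have n1: "acol (k, s @ [False], f) \<noteq> acol ?l" for f
    using bxor_neq[OF acol_nonzero] acol_neq[of k s] by (cases f) (auto simp: acol_snoc)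
  have c: "acol (k, s @ [True], True) = acol ?l" "acol (k, s @ [False, False], True) = acol ?l"
    "acol (k, s @ [False, True], False) = acol ?l"
    using acol_snoc[of k "s @ [False]"] acol_snoc[of k s] by simp_all
  have c': "\<exists>f. acol (k, s @ [False, b], f) = acol ?l" for b
    using c(2,3) by (intro exI[of _ "\<not> b"]) (cases b; simp)
  have "lev (Suc n) ?l m \<longleftrightarrow> lev (n - 1) (k, s @ [False, False], True) m \<or>
      lev (n - 1) (k, s @ [False, True], False) m \<or> lev n (k, s @ [True], True) m" for m
  proof -
    obtain j u f where m: "m = (j, u, f)" by (cases m)
    let ?P = "\<forall>f'. acol (k, butlast u, f') \<noteq> acol ?l"
    show ?thesis
    proof (cases "j = k \<and> acol (k, u, f) = acol ?l")
      case True
      have "u \<noteq> s @ [False]" using True n1 by auto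
      moreover have "?P" if "u = s @ [False, b]" for b using that n1 by (simp add: butlast_append)
      moreover have "\<not> ?P" if "u = s @ [False, b, d]" for b d using that c'[of b] by (simp add: butlast_append)
      ultimately show ?thesis
        using append_levels[of u s False ?P n] True by (simp only: lev_def m c prod.case simp_thms)
    next
      case False
      then show ?thesis by (auto simp: lev_def m c)
    qed
  qed
  then show ?case using 2 by auto
next
  case (3 n k s)
  let ?l = "(k, s, False)"
  have n1: "acol (k, s @ [True], f) \<noteq> acol ?l" for f
    using bxor_neq[OF acol_nonzero] acol_neq[of k s] by (cases f) (auto simp: acol_snoc)
  have c: "acol (k, s @ [False], False) = acol ?l" "acol (k, s @ [True, False], True) = acol ?l"
    "acol (k, s @ [True, True], False) = acol ?l"
    using acol_snoc[of k "s @ [True]"] acol_snoc[of k s] by simp_all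
  have c': "\<exists>f. acol (k, s @ [True, b], f) = acol ?l" for b
    using c(2,3) by (intro exI[of _ "\<not> b"]) (cases b; simp)
  have "lev (Suc n) ?l m \<longleftrightarrow> lev n (k, s @ [False], False) m \<or>
      lev (n - 1) (k, s @ [True, False], True) m \<or> lev (n - 1) (k, s @ [True, True], False) m" for m
  proof -
    obtain j u f where m: "m = (j, u, f)" by (cases m)
    let ?P = "\<forall>f'. acol (k, butlast u, f') \<noteq> acol ?l"
    show ?thesis
    proof (cases "j = k \<and> acol (k, u, f) = acol ?l")
      case True
      have "u \<noteq> s @ [True]" using True n1 by auto
      moreover have "?P" if "u = s @ [True, b]" for b using that n1 by (simp add: butlast_append)
      moreover have "\<not> ?P" if "u = s @ [True, b, d]" for b d using that c'[of b] by (simp add: butlast_append)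
      ultimately show ?thesis
        using append_levels[of u s True ?P n] True by (simp only: lev_def m c prod.case simp_thms) blast
    next
      case False
      then show ?thesis by (auto simp: lev_def m c)
    qed
  qed
  then show ?case using 3 by auto
qed

section \<open>Matrices of the letters and their transport\<close>

fun mvec :: "mat \<Rightarrow> int \<times> int \<Rightarrow> int \<times> int" where
  "mvec (Mat a b c d) (u, v) = (a * u + b * v, c * u + d * v)"

fun madj :: "mat \<Rightarrow> mat" where
  "madj (Mat a b c d) = Mat d (- b) (- c) a"

text \<open>The matrix of the letter at the interval \<open>M\<close>: the conjugate of \<open>Mat 2 0 1 1\<close>, which is \<open>c\<close>,
  or of its adjugate, by the unimodular matrix carrying \<open>[0, 1]\<close> to that interval.\<close>

fun ymat :: "mat \<Rightarrow> bool \<Rightarrow> mat" where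
  "ymat (Mat p p' q q') True = Mat (1 + p' * q) (- p' * p) (q' * q) (1 - q' * p)"
| "ymat (Mat p p' q q') False = Mat (1 - p * q') (p * p') (- q * q') (1 + q * p')"

lemma ymat_conj:
  assumes "mdet N = 1"
  shows "mmul (madj N) (mmul (ymat (mmul N M) e) N) = ymat M e"
proof -
  obtain a b c d where N: "N = Mat a b c d" by (cases N)
  obtain p p' q q' where M: "M = Mat p p' q q'" by (cases M)
  have "a * d - b * c = 1" using assms by (simp add: N)
  then show ?thesis by (cases e) (simp add: N M, intro conjI; algebra)+
qed

lemma moebius_on_inverse:
  assumes "moebius_on g U N" "mdet N = 1" "\<And>x. x \<in> U \<Longrightarrow> h (g x) = x"
  shows "moebius_on h (g ` U) (madj N)"
proof -
  obtain a b c d where N: "N = Mat a b c d" by (cases N)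
  have det: "a * d - b * c = 1" using assms(2) by (simp add: N)
  then have det': "real_of_int a * of_int d - of_int b * of_int c = 1"
    using arg_cong[OF det, of real_of_int] by simp
  have "- of_int c * g x + of_int a \<noteq> 0 \<and> x * (- of_int c * g x + of_int a) = of_int d * g x - of_int b"
    if x: "x \<in> U" for x
  proof -
    have 1: "of_int c * x + of_int d \<noteq> 0" "g x * (of_int c * x + of_int d) = of_int a * x + of_int b"
      using assms(1) x by (auto simp: N)
    have 2: "(- of_int c * g x + of_int a) * (of_int c * x + of_int d) = 1"
      using 1(2) det' by algebra
    have 3: "(of_int d * g x - of_int b) * (of_int c * x + of_int d) = x"
      using 1(2) det' by algebra
    have "(x * (- of_int c * g x + of_int a)) * (of_int c * x + of_int d)
        = (of_int d * g x - of_int b) * (of_int c * x + of_int d)"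
      using 2 3 by (simp add: mult.assoc)
    then show ?thesis using 1(1) 2 by auto
  qed
  then show ?thesis using det assms(3) by (auto simp: N algebra_simps)
qed

lemma pp_homeo_image_interval:
  assumes "pp_homeo h h'" "h (lp M) = lp M'" "h (rp M) = rp M'"
  shows "h ` interval M = interval M'"
proof (intro equalityI subsetI)
  fix t assume t: "t \<in> interval M'"
  have hh: "h (h' t) = t" "\<And>s. h' (h s) = s" and m: "strict_mono h'"
    using assms(1) by (auto simp: pp_homeo_def fun_eq_iff)
  have "h' (h (lp M)) < h' t" "h' t < h' (h (rp M))"
    using t m unfolding assms(2,3) by (auto simp: interval_def strict_mono_def)
  then have "h' t \<in> interval M" by (simp add: hh interval_def)
  then show "t \<in> h ` interval M" using hh(1) by (metis imageI)
next
  fix t assume "t \<in> h ` interval M"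
  moreover have "strict_mono h" using assms(1) by (simp add: pp_homeo_def)
  ultimately show "t \<in> interval M'"
    unfolding interval_def assms(2,3)[symmetric] by (auto simp: strict_mono_less)
qed

lemma map_b_left: "0 \<le> x \<Longrightarrow> x \<le> 1/2 \<Longrightarrow> map_b x = x / (1 - x)"
  by (auto simp: map_b_def)

lemma map_b_right: "1/2 \<le> x \<Longrightarrow> x \<le> 1 \<Longrightarrow> map_b x = 3 - 1 / x"
proof (cases "x = 1/2")
  case True show ?thesis unfolding True by (simp add: map_b_def)
qed (auto simp: map_b_def)

lemma map_b_mono: "x < y \<Longrightarrow> map_b x < map_b y"
  using strict_mono_map_b by (simp add: strict_mono_def)

lemma map_b_gt: "t > 0 \<Longrightarrow> map_b t > t"
proof -
  assume t: "t > 0"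
  consider "t \<le> 1/2" | "1/2 < t" "t \<le> 1" | "1 < t" by linarith
  then show ?thesis
  proof cases
    case 1
    have "t * (1 - t) < t * 1" using t by (intro mult_strict_left_mono) auto
    then show ?thesis using t 1 by (simp add: map_b_left less_divide_eq)
  next
    case 2
    then show ?thesis
    proof -
      have "1 < map_b t" using map_b_mono[of "1/2" t] 2 by (simp add: map_b_right)
      then show ?thesis using 2 by simp
    qed
  qed (simp add: map_b_def)
qed

lemma map_b_ge: "map_b t \<ge> t"
  using map_b_gt[of t] by (cases "t > 0") (auto simp: map_b_def)

text \<open>The group acts on the line through \<open>\<pi>\<close>; the aim is that
  \<open>\<pi>\<close> has trivial kernel on all elements written in the generators.\<close>

locale realized = relations A B C for A B C :: "'g :: group_add" +
  fixes \<pi> :: "'g \<Rightarrow> real \<Rightarrow> real"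
  assumes hom: "\<pi> (x + y) = \<pi> x \<circ> \<pi> y"
    and \<pi>_A: "\<pi> A = map_a" and \<pi>_B: "\<pi> B = map_b" and \<pi>_C: "\<pi> C = map_c"
    and \<pi>_G0: "\<pi> x \<in> carrier G0"
begin

lemma \<pi>_0: "\<pi> 0 t = t"
proof -
  have "map_a (\<pi> 0 t) = map_a t" using hom[of A 0] by (simp add: \<pi>_A fun_eq_iff)
  then show ?thesis by (simp add: map_a_def)
qed

lemma hom': "\<pi> (x + y) t = \<pi> x (\<pi> y t)"
  by (simp add: hom)

lemma \<pi>_minus [simp]: "\<pi> x (\<pi> (- x) t) = t" "\<pi> (- x) (\<pi> x t) = t"
  by (simp_all add: hom'[symmetric] \<pi>_0)

lemma \<pi>_pp: "pp_homeo (\<pi> x) (\<pi> (- x))"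
proof -
  obtain h where h: "pp_homeo (\<pi> x) h" using G0_pp_homeo[OF \<pi>_G0] ..
  have "h t = \<pi> (- x) t" for t
  proof -
    have "h (\<pi> x (\<pi> (- x) t)) = \<pi> (- x) t" using h by (metis comp_apply id_apply pp_homeo_def)
    then show ?thesis by simp
  qed
  then show ?thesis using h by (metis ext)
qed

lemma \<pi>_zp: "\<pi> (zp A n) t = t + of_int n"
proof (induction n arbitrary: t rule: int_induct[where k = 0])
  case (step1 n)
  then show ?case by (simp only: zp_Suc hom') (simp add: \<pi>_A map_a_def)
next
  case (step2 n)
  have "\<pi> (zp A n) t = \<pi> A (\<pi> (zp A (n - 1)) t)"
    using zp_Suc[of A "n - 1"] by (simp add: hom'[symmetric])
  then show ?case using step2 by (simp add: \<pi>_A map_a_def)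
qed (simp add: \<pi>_0)

lemma \<pi>_cj: "\<pi> (cj n x) t = \<pi> x (t - of_int n) + of_int n"
  by (simp add: cj_def diff_conv_add_uminus hom' zp_minus[symmetric] \<pi>_zp del: add_uminus_conv_diff)

lemma \<pi>_Bn: "\<pi> (Bn n) t = map_b (t - of_int n) + of_int n"
  by (simp add: Bn_def \<pi>_cj \<pi>_B)

section \<open>Positive words and the faithfulness of Thompson's group\<close>

definition pw :: "int list \<Rightarrow> 'g" where
  "pw ns = sum_list (map Bn ns)"

lemma pw_simps [simp]: "pw [] = 0" "pw (n # ns) = Bn n + pw ns" "pw (ns @ ms) = pw ns + pw ms"
  by (simp_all add: pw_def)

lemma pw_ge: "\<pi> (pw ns) t \<ge> t"
proof (induction ns)
  case (Cons n ns)
  have "\<pi> (pw ns) t \<le> \<pi> (Bn n) (\<pi> (pw ns) t)" using map_b_ge[of "\<pi> (pw ns) t - of_int n"] by (simp add: \<pi>_Bn)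
  then show ?case using Cons by (simp add: hom')
qed (simp add: \<pi>_0)

lemma pw_id: "\<forall>n\<in>set ns. k \<le> n \<Longrightarrow> t \<le> of_int k \<Longrightarrow> \<pi> (pw ns) t = t"
  by (induction ns) (simp_all add: \<pi>_0 hom' \<pi>_Bn map_b_def)

lemma pw_gt: "t > of_int k \<Longrightarrow> \<pi> (pw (ns @ [k])) t > t"
proof -
  assume "t > of_int k"
  then have "t < \<pi> (Bn k) t" using map_b_gt[of "t - of_int k"] by (simp add: \<pi>_Bn)
  also have "\<dots> \<le> \<pi> (pw ns) (\<pi> (Bn k) t)" by (rule pw_ge)
  finally show ?thesis by (simp add: hom')
qed

text \<open>The last index \<open>k\<close> is the least one; the word fixes every point up to
  \<open>k\<close> and moves every point beyond it. So the map determines \<open>k\<close>, and the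
  last factor can be cancelled.\<close>

lemma pw_inj:
  "sorted_wrt (\<ge>) ps \<Longrightarrow> sorted_wrt (\<ge>) qs \<Longrightarrow> \<pi> (pw ps) = \<pi> (pw qs) \<Longrightarrow> ps = qs"
proof (induction ps arbitrary: qs rule: rev_induct)
  case Nil
  show ?case
  proof (cases qs rule: rev_cases)
    case (snoc qs' k)
    have "\<pi> (pw qs) (of_int k + 1) > of_int k + 1" unfolding snoc by (rule pw_gt) simp
    moreover have "\<pi> (pw qs) (of_int k + 1) = of_int k + 1"
      unfolding Nil(3)[symmetric] by (simp add: \<pi>_0)
    ultimately show ?thesis by simp
  qed simp
next
  case (snoc k ps)
  show ?case
  proof (cases qs rule: rev_cases)
    case Nil
    have "\<pi> (pw (ps @ [k])) (of_int k + 1) > of_int k + 1" by (rule pw_gt) simp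
    moreover have "\<pi> (pw (ps @ [k])) (of_int k + 1) = of_int k + 1"
      unfolding snoc.prems(3) by (simp add: \<pi>_0 Nil)
    ultimately show ?thesis by simp
  next
    case (snoc qs' j)
    note qs = snoc
    have less: False if "x < y" "sorted_wrt (\<ge>) (vs @ [y])" "\<pi> (pw (us @ [x])) = \<pi> (pw (vs @ [y]))" for x y us vs
    proof -
      have "\<pi> (pw (us @ [x])) (of_int y) > of_int y" by (rule pw_gt) (use that in simp)
      moreover have "\<pi> (pw (vs @ [y])) (of_int y) = of_int y"
        by (rule pw_id[where k = y]) (use that in \<open>auto simp: sorted_wrt_append\<close>)
      ultimately show ?thesis using that(3) by simp
    qed
    have "k = j"
      using less[of k j qs' ps] less[of j k ps qs'] snoc.prems qs by (cases k j rule: linorder_cases) auto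
    have "\<pi> (pw ps) t = \<pi> (pw qs') t" for t
    proof -
      have "\<pi> (pw (ps @ [k])) (\<pi> (- Bn k) t) = \<pi> (pw (qs' @ [k])) (\<pi> (- Bn k) t)"
        using snoc.prems(3) qs \<open>k = j\<close> by simp
      then show ?thesis by (simp add: hom')
    qed
    then have "ps = qs'" using snoc.IH[of qs'] snoc.prems qs by (auto simp: sorted_wrt_append)
    then show ?thesis using qs \<open>k = j\<close> by simp
  qed
qed

text \<open>Multiplication of a decreasing word by \<open>Bn k\<close> on the left: by
  \<open>BB\<close>, moving it to the right past a larger index raises that index by one.\<close>

fun ins :: "int \<Rightarrow> int list \<Rightarrow> int list" where
  "ins k [] = [k]"
| "ins k (n # ns) = (if k \<ge> n then k # n # ns else (n + 1) # ins k ns)"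

lemma set_ins: "x \<in> set (ins k ns) \<Longrightarrow> x = k \<or> x \<in> set ns \<or> x - 1 \<in> set ns"
  by (induction ns) (auto split: if_splits)

lemma sorted_ins: "sorted_wrt (\<ge>) ns \<Longrightarrow> sorted_wrt (\<ge>) (ins k ns)"
proof (induction ns)
  case (Cons n ns)
  have "x \<le> n + 1" if "x \<in> set (ins k ns)" "k < n" for x
    using set_ins[OF that(1)] Cons.prems that(2) by force
  then show ?case using Cons by auto
qed simp

lemma pw_ins: "pw (ins k ns) = Bn k + pw ns"
proof (induction ns)
  case (Cons n ns)
  then show ?case using BB[of k n] by (simp add: add.assoc[symmetric])
qed simp

lemma pw_sorted: "\<exists>ms. sorted_wrt (\<ge>) ms \<and> pw ms = pw ns"
proof (induction ns)
  case (Cons n ns)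
  then obtain ms where "sorted_wrt (\<ge>) ms" "pw ms = pw ns" by blast
  then show ?case using sorted_ins[of ms n] pw_ins[of n ms] by (intro exI[of _ "ins n ms"]) simp
qed (intro exI[of _ "[]"], simp)

lemma pw_cancel: "\<pi> (pw ps) = \<pi> (pw qs) \<Longrightarrow> pw ps = pw qs"
proof -
  assume e: "\<pi> (pw ps) = \<pi> (pw qs)"
  obtain ps' where ps: "sorted_wrt (\<ge>) ps'" "pw ps' = pw ps" using pw_sorted by blast
  obtain qs' where qs: "sorted_wrt (\<ge>) qs'" "pw qs' = pw qs" using pw_sorted by blast
  have "ps' = qs'" using pw_inj[OF ps(1) qs(1)] e ps(2) qs(2) by simp
  then show ?thesis using ps qs by simp
qed

lemma pw_A: "pw ns + A = A + pw (map (\<lambda>n. n - 1) ns)"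
proof (induction ns)
  case (Cons n ns)
  have "pw (n # ns) + A = Bn n + A + pw (map (\<lambda>n. n - 1) ns)" using Cons by (simp add: add.assoc)
  then show ?case by (simp add: Bn_A add.assoc)
qed simp

lemma pw_minus_A: "pw ns + - A = - A + pw (map (\<lambda>n. n + 1) ns)"
proof -
  have "pw (map (\<lambda>n. n + 1) ns) + A = A + pw ns" using pw_A[of "map (\<lambda>n. n + 1) ns"] by (simp add: o_def)
  then show ?thesis by (rule swap_minus)
qed

lemma Bn_minus_Bn: "k < n \<Longrightarrow> Bn n + - Bn k = - Bn k + Bn (n + 1)" "k < n \<Longrightarrow> Bn k + - Bn n = - Bn (n + 1) + Bn k"
proof -
  assume kn: "k < n"
  show "Bn n + - Bn k = - Bn k + Bn (n + 1)" by (rule swap_minus[OF BB[OF kn, symmetric]])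
  have "- Bn (n + 1) + (Bn k + Bn n) + - Bn n = - Bn (n + 1) + (Bn (n + 1) + Bn k) + - Bn n"
    by (simp only: BB[OF kn])
  then show "Bn k + - Bn n = - Bn (n + 1) + Bn k" by (simp only: free_simps)
qed

text \<open>An inverse factor moves to the left through a positive word until it cancels or comes
  out in front; \<open>BB\<close> changes indices on the way but never signs.\<close>

lemma pw_minus_Bn: "(\<exists>ps'. pw ps + - Bn k = pw ps') \<or> (\<exists>k' ps'. pw ps + - Bn k = - Bn k' + pw ps')"
proof (induction ps)
  case Nil
  have "pw [] + - Bn k = - Bn k + pw []" by simp
  then show ?case by blast
next
  case (Cons n ps)
  then consider ps' where "pw ps + - Bn k = pw ps'" | k' ps' where "pw ps + - Bn k = - Bn k' + pw ps'" by blast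
  then show ?case
  proof cases
    case (1 ps')
    then have "pw (n # ps) + - Bn k = pw (n # ps')" by (simp only: pw_simps add.assoc)
    then show ?thesis by blast
  next
    case (2 k' ps')
    then have e: "pw (n # ps) + - Bn k = (Bn n + - Bn k') + pw ps'" by (simp only: pw_simps add.assoc)
    consider "n = k'" | "k' < n" | "n < k'" by linarith
    then show ?thesis
    proof cases
      case 1
      then have "pw (n # ps) + - Bn k = pw ps'" using e by simp
      then show ?thesis by blast
    next
      case 2
      then have "pw (n # ps) + - Bn k = - Bn k' + pw ((n + 1) # ps')"
        using e by (simp only: Bn_minus_Bn(1) pw_simps add.assoc)
      then show ?thesis by blast
    next
      case 3
      then have "pw (n # ps) + - Bn k = - Bn (k' + 1) + pw (n # ps')"
        using e by (simp only: Bn_minus_Bn(2) pw_simps add.assoc)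
      then show ?thesis by blast
    qed
  qed
qed

lemma zp_minus_Bn: "zp A i + - Bn k = - Bn (k + i) + zp A i"
proof -
  have "zp A i + Bn k = Bn (k + i) + zp A i"
    using cj_Bn[of i k] by (simp add: cj_def diff_eq_eq add.commute)
  then have "- Bn (k + i) + (zp A i + Bn k) + - Bn k = - Bn (k + i) + (Bn (k + i) + zp A i) + - Bn k"
    by simp
  then show ?thesis by (simp only: free_simps)
qed

lemma Thompson_fraction:
  assumes "x \<in> Thompson"
  shows "\<exists>qs i ps. x = - pw qs + (zp A i + pw ps)"
  using assms
proof (induction rule: Thompson.induct)
  case Thompson_0
  show ?case by (rule exI[of _ "[]"], rule exI[of _ 0], rule exI[of _ "[]"]) simp
next
  case (Thompson_step x y)
  then obtain qs i ps where x: "x = - pw qs + (zp A i + pw ps)" by blast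
  have zA: "zp A i + A = zp A (i + 1)" "zp A i + - A = zp A (i - 1)"
    using zp_add[of A i 1] zp_add[of A i "- 1"] zp_minus[of A 1] by simp_all
  consider "y = A" | "y = - A" | "y = B" | "y = - B" using Thompson_step.hyps(2) by blast
  then show ?case
  proof cases
    case 1
    have "x + y = - pw qs + (zp A i + A + pw (map (\<lambda>n. n - 1) ps))"
      unfolding x 1 by (simp only: pw_A add.assoc)
    then show ?thesis unfolding zA by blast
  next
    case 2
    have "x + y = - pw qs + (zp A i + - A + pw (map (\<lambda>n. n + 1) ps))"
      unfolding x 2 by (simp only: pw_minus_A add.assoc)
    then show ?thesis unfolding zA by blast
  next
    case 3
    have "x + y = - pw qs + (zp A i + pw (ps @ [0]))" unfolding x 3 by (simp add: add.assoc)
    then show ?thesis by blast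
  next
    case 4
    from pw_minus_Bn[of ps 0] consider ps' where "pw ps + - Bn 0 = pw ps'"
      | k' ps' where "pw ps + - Bn 0 = - Bn k' + pw ps'" by blast
    then show ?thesis
    proof cases
      case (1 ps')
      then have "x + y = - pw qs + (zp A i + pw ps')" unfolding x 4 by (simp only: Bn_0 add.assoc)
      then show ?thesis by blast
    next
      case (2 k' ps')
      then have "x + y = - pw qs + ((zp A i + - Bn k') + pw ps')" unfolding x 4 by (simp only: Bn_0 add.assoc)
      also have "\<dots> = - pw ((k' + i) # qs) + (zp A i + pw ps')"
        by (simp only: zp_minus_Bn pw_simps minus_add add.assoc)
      finally show ?thesis by blast
    qed
  qed
qed

lemma Thompson_faithful:
  assumes "x \<in> Thompson" "\<And>t. \<pi> x t = t"
  shows "x = 0"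
proof -
  obtain qs i ps where x: "x = - pw qs + (zp A i + pw ps)" using Thompson_fraction[OF assms(1)] by blast
  have e: "\<pi> (pw ps) t + of_int i = \<pi> (pw qs) t" for t
  proof -
    have "\<pi> (pw qs) (\<pi> x t) = \<pi> (pw qs) t" using assms(2) by simp
    then show ?thesis by (simp add: x hom' \<pi>_zp)
  qed
  \<comment> \<open>Far to the left both positive words act as the identity, so comparing there
    forces the translation by \<open>i\<close> to be trivial.\<close>
  have "\<exists>k. \<forall>n\<in>set (ps @ qs). k \<le> n"
    by (intro exI[of _ "Min (insert 0 (set (ps @ qs)))"]) auto
  then obtain k where k: "\<forall>n\<in>set (ps @ qs). k \<le> n" ..
  have "\<pi> (pw ps) (of_int k) = of_int k" "\<pi> (pw qs) (of_int k) = of_int k"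
    using k by (auto intro: pw_id[where k = k])
  then have i: "i = 0" using e[of "of_int k"] by simp
  then have "\<pi> (pw ps) = \<pi> (pw qs)" using e by (simp add: fun_eq_iff)
  then show ?thesis using pw_cancel[of ps qs] by (simp add: x i)
qed

end

section \<open>How the Thompson generators carry Farey intervals\<close>

context realized
begin

text \<open>Compatibility on three levels: conjugation of letters in the abstract group, images of
  intervals on the line, and a unimodular matrix that carries the vectors of the end points and
  hence the anchors.\<close>

definition moves :: "'g \<Rightarrow> int \<Rightarrow> bool list \<Rightarrow> int \<Rightarrow> bool list \<Rightarrow> mat \<Rightarrow> bool" where
  "moves y k s j u N \<longleftrightarrow> y + Y k s = Y j u + y \<and> \<pi> y ` cone k s = cone j u \<and>
     moebius_on (\<pi> y) (cone k s) N \<and> mdet N = 1 \<and> cone_mat j u = mmul N (cone_mat k s)"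

lemma moves_inverse:
  assumes "moves y k s j u N"
  shows "moves (- y) j u k s (madj N)"
proof -
  have a: "y + Y k s = Y j u + y" "\<pi> y ` cone k s = cone j u"
     "moebius_on (\<pi> y) (cone k s) N" "mdet N = 1" "cone_mat j u = mmul N (cone_mat k s)"
    using assms by (auto simp: moves_def)
  have "- y + Y j u = Y k s + - y" using swap_minus[OF a(1)[symmetric]] by simp
  moreover have "\<pi> (- y) ` cone j u = cone k s" unfolding a(2)[symmetric] by (simp add: image_image)
  moreover have "moebius_on (\<pi> (- y)) (cone j u) (madj N)"
    unfolding a(2)[symmetric] by (rule moebius_on_inverse[OF a(3,4)]) simp
  moreover have "mdet (madj N) = 1" using a(4) by (cases N) (simp add: algebra_simps)
  moreover have "cone_mat k s = mmul (madj N) (cone_mat j u)"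
  proof -
    have "mmul (madj N) N = Mat 1 0 0 1" using a(4) by (cases N) (simp add: algebra_simps)
    then show ?thesis unfolding a(5) mmul_assoc[symmetric] by simp
  qed
  ultimately show ?thesis by (simp add: moves_def)
qed

lemma movesI:
  assumes "y + Y k s = Y j u + y" "\<And>t. t \<in> cone k s \<Longrightarrow> \<pi> y t = h t" "moebius_on h (cone k s) N"
    "mdet N = 1" "cone_mat j u = mmul N (cone_mat k s)" "\<pi> y (lp (cone_mat k s)) = lp (cone_mat j u)" "\<pi> y (rp (cone_mat k s)) = rp (cone_mat j u)"
  shows "moves y k s j u N"
proof -
  have "moebius_on (\<pi> y) (cone k s) N"
    using moebius_on_cong[of "cone k s" "\<pi> y" h N] assms(2,3) by blast
  then show ?thesis
    using assms pp_homeo_image_interval[OF \<pi>_pp assms(6,7)] by (simp add: moves_def cone_def)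
qed

lemma cone_mat_shift: "cone_mat (k + 1) s = mmul (Mat 1 1 0 1) (cone_mat k s)"
  by (simp add: cone_mat_def mmul_assoc[symmetric] add_ac)

lemma cone_mat_pos: "cone_mat k s = Mat p p' q q' \<Longrightarrow> q > 0 \<and> q' > 0"
  using farey_cone_mat[of k s] by simp

lemma moves_A: "moves A k s (k + 1) s (Mat 1 1 0 1)"
proof (rule movesI[where h = "\<lambda>t. t + 1"])
  obtain p p' q q' where M: "cone_mat k s = Mat p p' q q'" by (cases "cone_mat k s")
  then show "\<pi> A (lp (cone_mat k s)) = lp (cone_mat (k + 1) s)" "\<pi> A (rp (cone_mat k s)) = rp (cone_mat (k + 1) s)"
    using cone_mat_pos[OF M] by (auto simp: cone_mat_shift M \<pi>_A map_a_def add_divide_distrib)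
qed (auto simp: A_Y \<pi>_A map_a_def cone_mat_shift)

lemma farey_interval_bounds:
  assumes "farey M"
  shows "lp M \<le> lp (mmul M (Wm s))" "rp (mmul M (Wm s)) \<le> rp M" "lp (mmul M (Wm s)) < rp (mmul M (Wm s))"
  using farey_Wm[OF assms, of s] farey_less by auto

lemma moves_B_pos:
  assumes "k \<ge> 1"
  shows "moves B k s (k + 1) s (Mat 1 1 0 1)"
proof (rule movesI[where h = "\<lambda>t. t + 1"])
  obtain p p' q q' where M: "cone_mat k s = Mat p p' q q'" by (cases "cone_mat k s")
  have b: "1 \<le> lp (cone_mat k s)" "lp (cone_mat k s) < rp (cone_mat k s)"
    using farey_interval_bounds[OF farey_base, of k s] assms by (auto simp: cone_mat_def)
  have B: "\<pi> B t = t + 1" if "t \<ge> 1" for t using that by (auto simp: \<pi>_B map_b_def)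
  show "\<pi> B t = t + 1" if "t \<in> cone k s" for t using that b B by (auto simp: cone_def interval_def)
  have "\<pi> B (lp (cone_mat k s)) = lp (cone_mat k s) + 1" "\<pi> B (rp (cone_mat k s)) = rp (cone_mat k s) + 1" using B b by auto
  then show "\<pi> B (lp (cone_mat k s)) = lp (cone_mat (k + 1) s)" "\<pi> B (rp (cone_mat k s)) = rp (cone_mat (k + 1) s)"
    using cone_mat_pos[OF M] by (auto simp: cone_mat_shift M add_divide_distrib)
qed (auto simp: B_Y_pos[OF assms] cone_mat_shift)

lemma moves_B_neg:
  assumes "k < 0"
  shows "moves B k s k s (Mat 1 0 0 1)"
proof (rule movesI[where h = "\<lambda>t. t"])
  have b: "rp (cone_mat k s) \<le> 0" "lp (cone_mat k s) < rp (cone_mat k s)"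
    using farey_interval_bounds[OF farey_base, of k s] assms by (auto simp: cone_mat_def)
  have B: "\<pi> B t = t" if "t \<le> 0" for t using that by (auto simp: \<pi>_B map_b_def)
  show "\<pi> B t = t" if "t \<in> cone k s" for t using that b B by (auto simp: cone_def interval_def)
  show "\<pi> B (lp (cone_mat k s)) = lp (cone_mat k s)" "\<pi> B (rp (cone_mat k s)) = rp (cone_mat k s)" using B b by auto
qed (use B_Y_neg[OF assms] in \<open>auto simp: com_def\<close>)

lemma moves_B_False: "moves B 0 (False # s) 0 s (Mat 1 0 (-1) 1)"
proof (rule movesI[where h = "\<lambda>t. t / (1 - t)"])
  let ?M = "cone_mat 0 (False # s)"
  obtain p p' q q' where M: "?M = Mat p p' q q'" by (cases ?M)
  have "?M = mmul (Mat 0 1 1 2) (Wm s)" by (simp add: cone_mat_def gen_def mmul_assoc[symmetric])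
  then have b: "0 \<le> lp ?M" "rp ?M \<le> 1/2" "lp ?M < rp ?M"
    using farey_interval_bounds[of "Mat 0 1 1 2" s] by auto
  show cone_mat: "cone_mat 0 s = mmul (Mat 1 0 (-1) 1) ?M"
    by (simp add: cone_mat_def gen_def mmul_assoc[symmetric])
  show "\<pi> B t = t / (1 - t)" if "t \<in> cone 0 (False # s)" for t
    using that b by (auto simp: \<pi>_B map_b_left cone_def interval_def)
  show "moebius_on (\<lambda>t. t / (1 - t)) (cone 0 (False # s)) (Mat 1 0 (-1) 1)"
    using b by (auto simp: cone_def interval_def)
  have q: "real_of_int q > 0" "real_of_int q' > 0" using cone_mat_pos[OF M] by auto
  have *: "real_of_int x / of_int y / (1 - of_int x / of_int y) = of_int x / of_int (y - x)"
    if "real_of_int y > 0" for x y :: int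
  proof -
    have "1 - real_of_int x / of_int y = of_int (y - x) / of_int y"
      using that by (simp add: diff_divide_distrib)
    then show ?thesis using that by simp
  qed
  have cm': "cone_mat 0 s = Mat p p' (q - p) (q' - p')" unfolding cone_mat M by simp
  have "\<pi> B (lp ?M) = lp ?M / (1 - lp ?M)" "\<pi> B (rp ?M) = rp ?M / (1 - rp ?M)"
    using b by (auto simp: \<pi>_B map_b_left)
  then show "\<pi> B (lp ?M) = lp (cone_mat 0 s)" "\<pi> B (rp ?M) = rp (cone_mat 0 s)"
    unfolding cm' M lp.simps rp.simps using *[OF q(1), of p] *[OF q(2), of p'] by presburger+
qed (auto simp: B_Y_False)

lemma moves_B_True: "moves B 0 (True # s) 1 s (Mat 3 (-1) 1 0)"
proof (rule movesI[where h = "\<lambda>t. 3 - 1 / t"])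
  let ?M = "cone_mat 0 (True # s)"
  obtain p p' q q' where M: "?M = Mat p p' q q'" by (cases ?M)
  have "?M = mmul (Mat 1 1 2 1) (Wm s)" by (simp add: cone_mat_def gen_def mmul_assoc[symmetric])
  then have b: "1/2 \<le> lp ?M" "rp ?M \<le> 1" "lp ?M < rp ?M"
    using farey_interval_bounds[of "Mat 1 1 2 1" s] by auto
  show cone_mat: "cone_mat 1 s = mmul (Mat 3 (-1) 1 0) ?M"
    by (simp add: cone_mat_def gen_def mmul_assoc[symmetric])
  show "\<pi> B t = 3 - 1 / t" if "t \<in> cone 0 (True # s)" for t
    using that b by (auto simp: \<pi>_B map_b_right cone_def interval_def)
  show "moebius_on (\<lambda>t. 3 - 1 / t) (cone 0 (True # s)) (Mat 3 (-1) 1 0)"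
    using b by (auto simp: cone_def interval_def left_diff_distrib)
  have q: "real_of_int q > 0" "real_of_int q' > 0" using cone_mat_pos[OF M] by auto
  have "0 < lp ?M" "0 < rp ?M" using b by linarith+
  then have p: "real_of_int p > 0" "real_of_int p' > 0"
    using q by (simp_all add: M zero_less_divide_iff)
  have *: "3 - 1 / (real_of_int x / of_int y) = of_int (3 * x - y) / of_int x"
    if "real_of_int x > 0" for x y :: int
    using that by (simp add: diff_divide_distrib)
  have cm': "cone_mat 1 s = Mat (3 * p - q) (3 * p' - q') p p'" unfolding cone_mat M by simp
  have "\<pi> B (lp ?M) = 3 - 1 / lp ?M" "\<pi> B (rp ?M) = 3 - 1 / rp ?M"
    using b by (auto simp: \<pi>_B map_b_right)
  then show "\<pi> B (lp ?M) = lp (cone_mat 1 s)" "\<pi> B (rp ?M) = rp (cone_mat 1 s)"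
    unfolding cm' M lp.simps rp.simps using *[OF p(1), of q] *[OF p(2), of q'] by presburger+
qed (auto simp: B_Y_True)

section \<open>The action of the letters on the line\<close>

definition acts_on_cone :: "letter \<Rightarrow> bool" where
  "acts_on_cone l \<longleftrightarrow> (case l of (k, s, e) \<Rightarrow> (\<forall>t\<in>cone k s. \<pi> (Yl l) t \<in> cone k s) \<and>
     (\<forall>t. t \<notin> cone k s \<longrightarrow> \<pi> (Yl l) t = t) \<and> moebius_on (\<pi> (Yl l)) (cone k s) (ymat (cone_mat k s) e))"

lemma Yl_conj:
  assumes "y + Y k s = Y j u + y"
  shows "Yl (k, s, e) = - y + (Yl (j, u, e) + y)"
proof -
  have 1: "- y + (Y j u + y) = Y k s" using assms by (simp add: add.assoc[symmetric]) (metis minus_add_cancel add.assoc)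
  have "- y + (- Y j u + y) = - (- y + (Y j u + y))" by (simp only: free_simps)
  then show ?thesis using 1 by (simp add: Yl_def)
qed

lemma acts_on_cone_moves:
  assumes moves: "moves y k s j u N" and "acts_on_cone (j, u, e)"
  shows "acts_on_cone (k, s, e)"
proof -
  let ?z = "Yl (j, u, e)"
  have a: "y + Y k s = Y j u + y" "\<pi> y ` cone k s = cone j u"
     "moebius_on (\<pi> y) (cone k s) N" "mdet N = 1" "cone_mat j u = mmul N (cone_mat k s)"
    using moves by (auto simp: moves_def)
  have b: "\<And>t. t \<in> cone j u \<Longrightarrow> \<pi> ?z t \<in> cone j u" "\<And>t. t \<notin> cone j u \<Longrightarrow> \<pi> ?z t = t"
    "moebius_on (\<pi> ?z) (cone j u) (ymat (cone_mat j u) e)"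
    using assms(2) by (auto simp: acts_on_cone_def)
  have c: "\<pi> (Yl (k, s, e)) t = \<pi> (- y) (\<pi> ?z (\<pi> y t))" for t
    by (simp add: Yl_conj[OF a(1)] hom')
  have d: "t \<in> cone k s \<longleftrightarrow> \<pi> y t \<in> cone j u" for t
    unfolding a(2)[symmetric] by (metis \<pi>_minus(2) imageE imageI)
  have i: "moebius_on (\<pi> (- y)) (cone j u) (madj N)"
    using moves_inverse[OF moves] by (simp add: moves_def)
  have m: "moebius_on (\<pi> (- y) \<circ> (\<pi> ?z \<circ> \<pi> y)) (cone k s) (mmul (madj N) (mmul (ymat (cone_mat j u) e) N))"
  proof (rule moebius_on_compose[OF moebius_on_compose[OF a(3) b(3)] i])
    show "\<pi> y ` cone k s \<subseteq> cone j u" using a(2) by simp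
    show "(\<pi> ?z \<circ> \<pi> y) ` cone k s \<subseteq> cone j u" using b(1) d by auto
  qed
  have "moebius_on (\<pi> (Yl (k, s, e))) (cone k s) (ymat (cone_mat k s) e)"
  proof -
    have "\<pi> (Yl (k, s, e)) = \<pi> (- y) \<circ> (\<pi> ?z \<circ> \<pi> y)" by (rule ext) (simp add: c)
    then show ?thesis using m unfolding a(5) ymat_conj[OF a(4)] by simp
  qed
  moreover have "\<pi> (Yl (k, s, e)) t \<in> cone k s" if "t \<in> cone k s" for t
    using that b(1) unfolding d c by simp
  moreover have "\<pi> (Yl (k, s, e)) t = t" if "t \<notin> cone k s" for t
    using that b(2) unfolding d c by simp
  ultimately show ?thesis by (simp add: acts_on_cone_def)
qed

lemma \<pi>_minus_C: "\<pi> (- C) t = inv_c t"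
  using \<pi>_minus(1)[of C t] inv_c_map_c by (metis \<pi>_C)

lemma acts_on_cone_base: "acts_on_cone (0, [], e)"
proof -
  have cone: "cone 0 [] = {0<..<1}" by (simp add: cone_def interval_def cone_mat_def)
  have cone_mat: "cone_mat 0 [] = Mat 0 1 1 1" by (simp add: cone_mat_def)
  show ?thesis
  proof (cases e)
    case True
    have "\<pi> (Yl (0, [], True)) t = map_c t" for t by (simp add: Yl_def Y_0 \<pi>_C)
    then show ?thesis using True
      by (auto simp: acts_on_cone_def cone cone_mat map_c_def divide_simps add.commute)
  next
    case False
    have "\<pi> (Yl (0, [], False)) t = inv_c t" for t by (simp add: Yl_def Y_0 \<pi>_minus_C)
    then show ?thesis using False
      by (auto simp: acts_on_cone_def cone cone_mat inv_c_def divide_simps)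
  qed
qed

text \<open>Conjugation by \<open>B\<close> shortens the word of an interval in
  \<open>[0, 1]\<close>, and conjugation by \<open>A\<close> removes the integer shift, so every
  letter reduces to \<open>c\<close> or its inverse on \<open>[0, 1]\<close>.\<close>

lemma acts_on_cone: "acts_on_cone (k, s, e)"
proof -
  have shift: "acts_on_cone (k, s, e)" if "acts_on_cone (0, s, e)" for k s
  proof (induction k rule: int_induct[where k = 0])
    case base show ?case by (rule that)
  next
    case (step1 k) show ?case by (rule acts_on_cone_moves[OF moves_inverse[OF moves_A] step1(2)])
  next
    case (step2 k)
    have "moves A (k - 1) s k s (Mat 1 1 0 1)" using moves_A[of "k - 1" s] by simp
    then show ?case using acts_on_cone_moves step2(2) by blast
  qed
  have "acts_on_cone (0, s, e)"
  proof (induction s)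
    case Nil show ?case by (rule acts_on_cone_base)
  next
    case (Cons b s)
    show ?case
    proof (cases b)
      case True then show ?thesis using acts_on_cone_moves[OF moves_B_True shift[OF Cons]] by simp
    next
      case False then show ?thesis using acts_on_cone_moves[OF moves_B_False Cons] by simp
    qed
  qed
  then show ?thesis by (rule shift)
qed

lemma Yl_in: "t \<in> cone k s \<Longrightarrow> \<pi> (Yl (k, s, e)) t \<in> cone k s"
  and Yl_out: "t \<notin> cone k s \<Longrightarrow> \<pi> (Yl (k, s, e)) t = t"
  and Yl_moebius: "moebius_on (\<pi> (Yl (k, s, e))) (cone k s) (ymat (cone_mat k s) e)"
  using acts_on_cone[of k s e] by (auto simp: acts_on_cone_def)

end

section \<open>Kernels mod 2 and the end points of Farey intervals\<close>

lemma mker_iff_mvec: "mker M v \<longleftrightarrow> even (fst (mvec M v)) \<and> even (snd (mvec M v))"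
  by (cases M; cases v) simp

lemma vec_mmul: "mvec (mmul M N) v = mvec M (mvec N v)"
  by (cases M; cases N; cases v) (simp add: algebra_simps)

lemma mker_mmul: "mker (mmul M N) v = mker M (mvec N v)"
  by (simp add: mker_iff_mvec vec_mmul)

lemma vec_madj: "mdet N = 1 \<Longrightarrow> mvec (madj N) (mvec N v) = v"
proof -
  assume "mdet N = 1"
  then have "mmul (madj N) N = Mat 1 0 0 1" by (cases N) (simp add: algebra_simps)
  then have "mvec (madj N) (mvec N v) = mvec (Mat 1 0 0 1) v" by (simp add: vec_mmul[symmetric])
  then show ?thesis by (cases v) simp
qed

lemma mker_not_odd: "\<not> odd_mat M \<Longrightarrow> mker M v"
  by (cases M; cases v) simp

lemma mker_double: "mker M (2 * u, 2 * v)"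
  by (cases M) simp

lemma odd_mat_madj:
  assumes "odd_mat M" "mdet N = 1"
  shows "odd_mat (mmul M (madj N))"
proof (rule ccontr)
  assume "\<not> ?thesis"
  then have "mker (mmul M (madj N)) (mvec N v)" for v by (rule mker_not_odd)
  then have "mker M v" for v by (simp add: mker_mmul vec_madj[OF assms(2)])
  from this[of "(1, 0)"] this[of "(0, 1)"] show False using assms(1) by (cases M) simp
qed

fun lneg :: "letter \<Rightarrow> letter" where
  "lneg (k, s, e) = (k, s, \<not> e)"

fun lcone :: "letter \<Rightarrow> real set" where
  "lcone (k, s, e) = cone k s"

fun lmat :: "letter \<Rightarrow> mat" where
  "lmat (k, s, e) = ymat (cone_mat k s) e"

fun len :: "letter \<Rightarrow> nat" where
  "len (k, s, e) = length s"

lemma lneg_lneg [simp]: "lneg (lneg l) = l"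
  by (cases l) simp

lemma lcone_lneg [simp]: "lcone (lneg l) = lcone l"
  by (cases l) simp

lemma apart_iff: "apart l m \<longleftrightarrow> lcone l \<inter> lcone m = {}"
  by (cases l; cases m) (simp add: cone_disjoint_iff)

text \<open>The end points are eigenvectors with eigenvalues 2 and 1, so mod 2 the kernel of
  \<open>lmat l\<close> is the anchor and its image is the other end point.\<close>

lemma vec_lmat: "mvec (lmat l) (avec l) = (2 * fst (avec l), 2 * snd (avec l))"
  "mvec (lmat l) (avec (lneg l)) = avec (lneg l)"
proof -
  obtain k s e where l: "l = (k, s, e)" by (cases l)
  obtain p p' q q' where M: "cone_mat k s = Mat p p' q q'" by (cases "cone_mat k s")
  have d: "p * q' - p' * q = - 1" using farey_cone_mat[of k s] by (simp add: M)
  show "mvec (lmat l) (avec l) = (2 * fst (avec l), 2 * snd (avec l))"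
    by (cases e) (simp add: l M, intro conjI; use d in algebra)+
  show "mvec (lmat l) (avec (lneg l)) = avec (lneg l)"
    by (cases e) (simp_all add: l M algebra_simps)
qed

text \<open>The end points of a Farey interval form a basis of the integer lattice.\<close>

lemma mker_both:
  assumes "mker M (avec l)" "mker M (avec (lneg l))"
  shows "\<not> odd_mat M"
proof -
  obtain k s e where l: "l = (k, s, e)" by (cases l)
  obtain p p' q q' where M: "cone_mat k s = Mat p p' q q'" by (cases "cone_mat k s")
  obtain a b c d where N: "M = Mat a b c d" by (cases M)
  have det: "p * q' - p' * q = - 1" using farey_cone_mat[of k s] by (simp add: M)
  have "even (a * p + b * q)" "even (c * p + d * q)" "even (a * p' + b * q')" "even (c * p' + d * q')"
    using assms by (cases e; simp add: l M N)+
  then have "even ((a * p' + b * q') * q - (a * p + b * q) * q')" "even ((a * p + b * q) * p' - (a * p' + b * q') * p)"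
    "even ((c * p' + d * q') * q - (c * p + d * q) * q')" "even ((c * p + d * q) * p' - (c * p' + d * q') * p)"
    by simp_all
  moreover have "(a * p' + b * q') * q - (a * p + b * q) * q' = a" "(a * p + b * q) * p' - (a * p' + b * q') * p = b"
    "(c * p' + d * q') * q - (c * p + d * q) * q' = c" "(c * p + d * q) * p' - (c * p' + d * q') * p = d"
    using det by algebra+
  ultimately show ?thesis by (simp add: N)
qed

text \<open>On the interval of \<open>l\<close>, precomposing \<open>g\<close> with \<open>l\<close> (\<open>up\<close>) moves away from the base vertex of the
  tree, precomposing with the inverse of \<open>l\<close> (\<open>down\<close>) moves towards it.\<close>

definition down :: "(real \<Rightarrow> real) \<Rightarrow> letter \<Rightarrow> bool" where
  "down g l \<longleftrightarrow> (\<exists>M. moebius_on g (lcone l) M \<and> odd_mat M \<and> mker M (avec l))"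

definition up :: "(real \<Rightarrow> real) \<Rightarrow> letter \<Rightarrow> bool" where
  "up g l \<longleftrightarrow> (\<exists>M. moebius_on g (lcone l) M \<and> odd_mat M \<and> \<not> mker M (avec (lneg l)))"

lemma down_cong: "(\<And>t. t \<in> lcone l \<Longrightarrow> g t = h t) \<Longrightarrow> down g l \<Longrightarrow> down h l"
  unfolding down_def using moebius_on_cong[of "lcone l" g h] by blast

lemma up_cong: "(\<And>t. t \<in> lcone l \<Longrightarrow> g t = h t) \<Longrightarrow> up g l \<Longrightarrow> up h l"
  unfolding up_def using moebius_on_cong[of "lcone l" g h] by blast

lemma moebius_on_halve:
  assumes "moebius_on g U M" "\<not> odd_mat M"
  shows "\<exists>N. moebius_on g U N \<and> (\<forall>v. mvec M v = (2 * fst (mvec N v), 2 * snd (mvec N v)))"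
proof -
  obtain a b c d where M: "M = Mat (2 * a) (2 * b) (2 * c) (2 * d)"
    using assms(2) by (cases M) (auto elim!: evenE)
  have "moebius_on g U (Mat a b c d)" using assms(1) by (auto simp: M algebra_simps)
  then show ?thesis by (intro exI[of _ "Mat a b c d"]) (auto simp: M)
qed

definition below :: "letter \<Rightarrow> letter \<Rightarrow> bool" where
  "below l m \<longleftrightarrow> (\<exists>k s e w f. l = (k, s, e) \<and> m = (k, s @ w, f))"

lemma below_lio: "below l m \<Longrightarrow> lcone m \<subseteq> lcone l"
  unfolding below_def by (auto dest: subsetD[OF cone_append])

lemma below_apart: "below l m \<Longrightarrow> apart l j \<Longrightarrow> apart m j"
  using below_lio[of l m] unfolding apart_iff by blast

lemma expand_lev: "m \<in> set (expand n l) \<Longrightarrow> lev n l m"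
  using set_expand by blast

lemma expand_below: "m \<in> set (expand n l) \<Longrightarrow> below l m \<and> acol m = acol l \<and> len l + n \<le> len m \<and> len m \<le> len l + Suc n"
  using expand_lev[of m n l] by (cases l; cases m) (auto simp: lev_def below_def)

lemma expand_1_nonempty: "expand 1 l \<noteq> []"
proof -
  obtain k s e where "l = (k, s, e)" by (cases l)
  then show ?thesis by (cases e) simp_all
qed

lemma apart_lists:
  assumes "apart l1 l2" "\<And>m. m \<in> set xs \<Longrightarrow> below l1 m" "\<And>m. m \<in> set ys \<Longrightarrow> below l2 m"
  shows "\<forall>x\<in>set xs. \<forall>y\<in>set ys. apart x y"
  using assms below_apart apart_sym by blast

lemma apart_expand: "apart l m \<Longrightarrow> \<forall>x\<in>set (expand a l). \<forall>y\<in>set (expand b m). apart x y"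
  by (rule apart_lists) (use expand_below in blast)+

lemma sorted_apart_mem:
  "sorted_wrt apart xs \<Longrightarrow> x \<in> set xs \<Longrightarrow> y \<in> set xs \<Longrightarrow> x \<noteq> y \<Longrightarrow> apart x y"
proof (induction xs)
  case (Cons z zs)
  then consider "x = z" "y \<in> set zs" | "y = z" "x \<in> set zs" | "x \<in> set zs" "y \<in> set zs" by auto
  then show ?case using Cons apart_sym[of x y] by cases auto
qed simp

lemma sorted_expand: "sorted_wrt apart (expand n l)"
proof (induction n l rule: expand.induct)
  case (2 n k s)
  have i: "apart (k, s @ [False, False], True) (k, s @ [False, True], False)"
    "apart (k, s @ [False, False], True) (k, s @ [True], True)"
    "apart (k, s @ [False, True], False) (k, s @ [True], True)" by (simp_all add: incomp_append_same)
  show ?case using 2 apart_expand[OF i(1)] apart_expand[OF i(2)] apart_expand[OF i(3)]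
    by (simp add: sorted_wrt_append ball_Un)
next
  case (3 n k s)
  have i: "apart (k, s @ [False], False) (k, s @ [True, False], True)"
    "apart (k, s @ [False], False) (k, s @ [True, True], False)"
    "apart (k, s @ [True, False], True) (k, s @ [True, True], False)" by (simp_all add: incomp_append_same)
  show ?case using 3 apart_expand[OF i(1)] apart_expand[OF i(2)] apart_expand[OF i(3)]
    by (simp add: sorted_wrt_append ball_Un)
qed simp

lemma down_expand:
  assumes "down g l" "m \<in> set (expand n l)"
  shows "down g m"
proof -
  obtain M where M: "moebius_on g (lcone l) M" "odd_mat M" "mker M (avec l)"
    using assms(1) unfolding down_def by blast
  have e: "below l m" "acol m = acol l" using expand_below[OF assms(2)] by auto
  have "moebius_on g (lcone m) M" by (rule moebius_on_subset[OF M(1) below_lio[OF e(1)]])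
  moreover have "mker M (avec m)" using mker_par[of "avec m" "avec l" M] e(2) M(3) by (simp add: acol_def)
  ultimately show ?thesis unfolding down_def using M(2) by blast
qed

text \<open>On the smaller interval there is only one kernel line, and both anchors lie on
  it.\<close>

lemma down_same_color:
  assumes "down g l" "down g m" "lcone m \<subseteq> lcone l"
  shows "acol m = acol l"
proof -
  obtain M where M: "moebius_on g (lcone l) M" "odd_mat M" "mker M (avec l)"
    using assms(1) unfolding down_def by blast
  obtain N where N: "moebius_on g (lcone m) N" "odd_mat N" "mker N (avec m)"
    using assms(2) unfolding down_def by blast
  have "infinite (lcone m)" using infinite_cone by (cases m) simp
  then have "mker N (avec l)"
    using mker_unique[OF moebius_on_subset[OF M(1) assms(3)] N(1) M(2) N(2)] M(3) by simp
  then show ?thesis unfolding acol_def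
    using mker_unique_par[OF N(2,3)] acol_nonzero[of l] acol_nonzero[of m] by (simp add: acol_def)
qed

context realized
begin

lemma Yl_lneg: "Yl (lneg l) = - Yl l"
  by (cases l) (simp add: Yl_def)

lemma Yl_lcone: "t \<in> lcone l \<Longrightarrow> \<pi> (Yl l) t \<in> lcone l" "t \<notin> lcone l \<Longrightarrow> \<pi> (Yl l) t = t"
  "moebius_on (\<pi> (Yl l)) (lcone l) (lmat l)"
  using Yl_in Yl_out Yl_moebius by (cases l; simp)+

text \<open>The other end point spans the image of \<open>lmat l\<close> mod 2; as it is not killed
  by \<open>M\<close>, the product stays odd, and its kernel is the anchor.\<close>

lemma up_down:
  assumes "up g l" shows "down (g \<circ> \<pi> (Yl l)) l"
proof -
  obtain M where M: "moebius_on g (lcone l) M" "odd_mat M" "\<not> mker M (avec (lneg l))"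
    using assms unfolding up_def by blast
  have "moebius_on (g \<circ> \<pi> (Yl l)) (lcone l) (mmul M (lmat l))"
    by (rule moebius_on_compose[OF Yl_lcone(3) M(1)]) (auto simp: Yl_lcone(1))
  moreover have "mker (mmul M (lmat l)) (avec l)" by (simp add: mker_mmul vec_lmat mker_double)
  moreover have "odd_mat (mmul M (lmat l))"
    using mker_not_odd[of "mmul M (lmat l)" "avec (lneg l)"] M(3) by (auto simp: mker_mmul vec_lmat)
  ultimately show ?thesis unfolding down_def by blast
qed

text \<open>A backtracking step in the tree: the product kills both end points, so it is even, and
  half of it agrees with \<open>M\<close> on the other end point, which \<open>M\<close> does not
  kill.\<close>

lemma down_up:
  assumes "down g l" shows "up (g \<circ> \<pi> (Yl (lneg l))) l"
proof -
  obtain M where M: "moebius_on g (lcone l) M" "odd_mat M" "mker M (avec l)"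
    using assms unfolding down_def by blast
  let ?Z = "lmat (lneg l)"
  have v: "mvec ?Z (avec l) = avec l" using vec_lmat(2)[of "lneg l"] by simp
  have "moebius_on (\<pi> (Yl (lneg l))) (lcone l) ?Z" using Yl_lcone(3)[of "lneg l"] by simp
  then have m: "moebius_on (g \<circ> \<pi> (Yl (lneg l))) (lcone l) (mmul M ?Z)"
    by (rule moebius_on_compose[OF _ M(1)]) (use Yl_lcone(1)[of _ "lneg l"] in auto)
  have "mker (mmul M ?Z) (avec l)" using M(3) by (simp add: mker_mmul v)
  moreover have "mker (mmul M ?Z) (avec (lneg l))" by (simp add: mker_mmul vec_lmat mker_double)
  ultimately have "\<not> odd_mat (mmul M ?Z)" by (rule mker_both)
  from moebius_on_halve[OF m this] obtain N where N: "moebius_on (g \<circ> \<pi> (Yl (lneg l))) (lcone l) N"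
    "\<forall>v. mvec (mmul M ?Z) v = (2 * fst (mvec N v), 2 * snd (mvec N v))" by blast
  have "\<not> mker N (avec (lneg l))"
  proof
    assume n: "mker N (avec (lneg l))"
    have lin: "mvec M (2 * fst w, 2 * snd w) = (2 * fst (mvec M w), 2 * snd (mvec M w))" for w
      by (cases M; cases w) (simp add: algebra_simps)
    have "mvec (mmul M ?Z) (avec (lneg l)) = (2 * fst (mvec M (avec (lneg l))), 2 * snd (mvec M (avec (lneg l))))"
      unfolding vec_mmul vec_lmat(1) by (rule lin)
    then have "mvec N (avec (lneg l)) = mvec M (avec (lneg l))" using N(2) by (simp add: prod_eq_iff)
    then have "mker M (avec (lneg l))" using n by (simp add: mker_iff_mvec)
    then show False using mker_both[OF M(3)] M(2) by simp
  qed
  then show ?thesis unfolding up_def using N(1) mker_not_odd by blast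
qed

lemma prodY_in:
  "sorted_wrt apart ls \<Longrightarrow> m \<in> set ls \<Longrightarrow> t \<in> lcone m \<Longrightarrow> \<pi> (prodY ls) t = \<pi> (Yl m) t"
  and prodY_out: "(\<And>l. l \<in> set ls \<Longrightarrow> t \<notin> lcone l) \<Longrightarrow> \<pi> (prodY ls) t = t"
proof -
  have out: "(\<forall>l\<in>set ls. t \<notin> lcone l) \<Longrightarrow> \<pi> (prodY ls) t = t" for ls
    by (induction ls) (auto simp: \<pi>_0 hom' Yl_lcone)
  then show "(\<And>l. l \<in> set ls \<Longrightarrow> t \<notin> lcone l) \<Longrightarrow> \<pi> (prodY ls) t = t" by blast
  show "sorted_wrt apart ls \<Longrightarrow> m \<in> set ls \<Longrightarrow> t \<in> lcone m \<Longrightarrow> \<pi> (prodY ls) t = \<pi> (Yl m) t"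
  proof (induction ls)
    case (Cons l ls)
    show ?case
    proof (cases "m = l")
      case True
      have "\<pi> (prodY ls) t = t"
        by (rule out) (use Cons.prems True in \<open>auto simp: apart_iff\<close>)
      then show ?thesis using True by (simp add: hom')
    next
      case False
      then have m: "m \<in> set ls" using Cons.prems by simp
      then have "\<pi> (prodY ls) t = \<pi> (Yl m) t" using Cons by simp
      moreover have "\<pi> (Yl m) t \<notin> lcone l"
        using Yl_lcone(1)[OF Cons.prems(3)] Cons.prems(1) m by (auto simp: apart_iff)
      ultimately show ?thesis by (simp add: hom' Yl_lcone)
    qed
  qed simp
qed

lemma com_prodY: "(\<And>l. l \<in> set ls \<Longrightarrow> com x (Yl l)) \<Longrightarrow> com x (prodY ls)"
  by (induction ls) (simp_all add: com_add)

lemma com_prodY2: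
  "(\<And>l m. l \<in> set ls \<Longrightarrow> m \<in> set ms \<Longrightarrow> apart l m) \<Longrightarrow> com (prodY ls) (prodY ms)"
  by (meson com_Yl com_prodY com_sym)

lemma minus_prodY: "- prodY ls = prodY (rev (map lneg ls))"
  by (induction ls) (simp_all add: prodY_append minus_add Yl_lneg del: minus_add_distrib)

lemma sorted_rev_lneg: "sorted_wrt apart ls \<Longrightarrow> sorted_wrt apart (rev (map lneg ls))"
  by (simp add: sorted_wrt_rev sorted_wrt_map) (erule sorted_wrt_mono_rel[rotated], auto simp: apart_iff)

lemma prodY_partition:
  "sorted_wrt apart ls \<Longrightarrow> prodY ls = prodY (filter P ls) + prodY (filter (\<lambda>l. \<not> P l) ls)"
proof (induction ls)
  case (Cons l ls)
  have IH: "prodY ls = prodY (filter P ls) + prodY (filter (\<lambda>l. \<not> P l) ls)" using Cons by simp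
  show ?case
  proof (cases "P l")
    case True then show ?thesis using IH by (simp add: add.assoc)
  next
    case False
    have "com (Yl l) (prodY (filter P ls))"
      by (rule com_prodY, rule com_Yl) (use Cons.prems in auto)
    then have "Yl l + (prodY (filter P ls) + prodY (filter (\<lambda>l. \<not> P l) ls))
        = prodY (filter P ls) + (Yl l + prodY (filter (\<lambda>l. \<not> P l) ls))"
      by (simp add: com_def add.assoc[symmetric])
    then show ?thesis using False IH by simp
  qed
qed simp

lemma prodY_set_eq:
  "sorted_wrt apart xs \<Longrightarrow> sorted_wrt apart ys \<Longrightarrow> set xs = set ys \<Longrightarrow> prodY xs = prodY ys"
proof (induction xs arbitrary: ys)
  case (Cons x xs)
  have irrefl: "\<not> apart x x" for x
    by (cases x) (simp add: apart_iff cone_nonempty)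
  have dist: "distinct zs" if "sorted_wrt apart zs" for zs
    using that by (induction zs) (use irrefl in auto)
  obtain us vs where ys: "ys = us @ x # vs" using Cons.prems(3) by (metis list.set_intros(1) split_list)
  have "com (prodY us) (Yl x)"
    by (rule com_sym, rule com_prodY, rule com_Yl, subst apart_sym)
       (use Cons.prems(2) ys in \<open>auto simp: sorted_wrt_append\<close>)
  then have "prodY ys = Yl x + prodY (us @ vs)" by (simp add: ys prodY_append com_def add.assoc[symmetric])
  moreover have "prodY xs = prodY (us @ vs)"
  proof (rule Cons.IH)
    show "sorted_wrt apart (us @ vs)" using Cons.prems(2) ys by (auto simp: sorted_wrt_append)
    show "set xs = set (us @ vs)"
      using Cons.prems(3) dist[OF Cons.prems(1)] dist[OF Cons.prems(2)] ys by auto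
  qed (use Cons.prems(1) in simp)
  ultimately show ?case by simp
qed simp

text \<open>Replacing \<open>l\<close> by \<open>rs\<close> leaves a Thompson factor on its left.
  The pieces \<open>rs\<close> commute with all later letters and their pieces, so these factors can
  be collected in front.\<close>

lemma refine_pairs:
  assumes "sorted_wrt apart (map fst ps)"
    "\<And>l rs. (l, rs) \<in> set ps \<Longrightarrow> (\<forall>m\<in>set rs. below l m) \<and> Yl l - prodY rs \<in> Thompson"
  shows "prodY (map fst ps) - prodY (concat (map snd ps)) \<in> Thompson"
  using assms
proof (induction ps)
  case Nil then show ?case by (simp add: Thompson_0)
next
  case (Cons a ps)
  obtain l rs where a: "a = (l, rs)" by (cases a)
  let ?L = "prodY (map fst ps)" and ?R = "prodY (concat (map snd ps))"
  have IH: "?L - ?R \<in> Thompson" 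
  proof (rule Cons.IH)
    show "(\<forall>m\<in>set rs. below l m) \<and> Yl l - prodY rs \<in> Thompson" if "(l, rs) \<in> set ps" for l rs
      using Cons.prems(2)[of l rs] that by simp
  qed (use Cons.prems(1) in simp)
  have l: "\<forall>m\<in>set rs. below l m" "Yl l - prodY rs \<in> Thompson" using Cons.prems(2)[of l rs] a by auto
  have i: "apart m j" if "m \<in> set rs" "j \<in> set (map fst ps)" for m j
    using Cons.prems(1) a that below_apart[of l m j] l(1) by auto
  have i': "apart m j" if m: "m \<in> set rs" and j: "j \<in> set (concat (map snd ps))" for m j
  proof -
    obtain j' js where j': "(j', js) \<in> set ps" "j \<in> set js" using j by auto
    then have "below j' j" using Cons.prems(2)[of j' js] by auto
    moreover have "apart m j'" by (rule i[OF m]) (use j'(1) in force)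
    ultimately show ?thesis using below_apart apart_sym by blast
  qed
  have "com (prodY rs) (?L - ?R)" by (intro com_diff com_prodY2) (use i i' in auto)
  then have e: "prodY rs + (?L - ?R) = (?L - ?R) + prodY rs" by (simp add: com_def)
  have "prodY (map fst (a # ps)) - prodY (concat (map snd (a # ps)))
      = (Yl l - prodY rs) + (prodY rs + (?L - ?R)) - prodY rs"
    by (simp add: a prodY_append) (simp only: free_simps)
  also have "\<dots> = (Yl l - prodY rs) + (?L - ?R)" unfolding e by (simp only: free_simps)
  finally show ?case using Thompson_add[OF IH l(2)] by simp
qed

lemma Thompson_conj: "g \<in> Thompson \<Longrightarrow> x \<in> Thompson \<Longrightarrow> g + x - g \<in> Thompson"
  unfolding diff_conv_add_uminus by (intro Thompson_add Thompson_minus)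

lemma expand1:
  "\<exists>x\<in>Thompson. Yl (k, s, True) = x + prodY [(k, s @ [False, False], True), (k, s @ [False, True], False), (k, s @ [True], True)]"
  "\<exists>x\<in>Thompson. Yl (k, s, False) = x + prodY [(k, s @ [False], False), (k, s @ [True, False], True), (k, s @ [True, True], False)]"
proof -
  obtain g where g: "g \<in> Thompson" "\<forall>u. Y k (s @ u) = g + Y0 u - g" using Y_conj by blast
  have Yks: "Y k s = g + C - g" using g(2)[rule_format, of "[]"] by simp
  have "Y k s = (g + X0 - g) + (Y k (s @ [False, False]) + (- Y k (s @ [False, True]) + Y k (s @ [True])))"
    unfolding Yks g(2)[rule_format] by (subst expand_pos) (simp only: free_simps)
  then show "\<exists>x\<in>Thompson. Yl (k, s, True) = x + prodY [(k, s @ [False, False], True), (k, s @ [False, True], False), (k, s @ [True], True)]"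
    using Thompson_conj[OF g(1) X0_Thompson] by (intro bexI[of _ "g + X0 - g"]) (simp_all add: Yl_def)
  let ?p = "Y0 [False]" and ?q = "Y0 [True, False]" and ?r = "Y0 [True, True]"
  \<comment> \<open>Inverting \<open>expand_neg\<close> reverses the three letters; as their
    intervals are disjoint, the order used by \<open>expand\<close> can be restored.\<close>
  have c: "com (- ?r) (?q - ?p)" "com ?q (- ?p)"
    using com_Y0_Y0[of "[True, True]" "[True, False]"] com_Y0_Y0[of "[True, True]" "[False]"]
      com_Y0_Y0[of "[True, False]" "[False]"] by (auto intro: com_diff com_minus com_sym)
  have "- C = - (?p - ?q + ?r + X0)" using expand_neg by simp
  also have "\<dots> = - X0 + (- ?r + (?q - ?p))" by (simp only: free_simps)
  also have "\<dots> = - X0 + ((?q + - ?p) + - ?r)" using c(1) by (simp add: com_def)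
  also have "\<dots> = - X0 + (- ?p + ?q + - ?r)" using c(2) by (simp only: com_def)
  finally have nC: "- C = - X0 + (- ?p + ?q + - ?r)" .
  have "- Y k s = g + - C - g" unfolding Yks by (simp only: free_simps)
  also have "\<dots> = (g + - X0 - g) + (- Y k (s @ [False]) + (Y k (s @ [True, False]) + - Y k (s @ [True, True])))"
    unfolding nC g(2)[rule_format] by (simp only: free_simps)
  finally show "\<exists>x\<in>Thompson. Yl (k, s, False) = x + prodY [(k, s @ [False], False), (k, s @ [True, False], True), (k, s @ [True, True], False)]"
    using Thompson_conj[OF g(1) Thompson_minus[OF X0_Thompson]] by (intro bexI[of _ "g + - X0 - g"]) (simp_all add: Yl_def)
qed

lemma Yl_expand: "Yl l - prodY (expand n l) \<in> Thompson"
proof (induction n l rule: expand.induct)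
  case (1 l) then show ?case by (simp add: Thompson_0)
next
  case (2 n k s)
  obtain x where x: "x \<in> Thompson" "Yl (k, s, True) = x + prodY [(k, s @ [False, False], True), (k, s @ [False, True], False), (k, s @ [True], True)]"
    using expand1(1) by blast
  let ?ps = "[((k, s @ [False, False], True), expand (n - 1) (k, s @ [False, False], True)),
    ((k, s @ [False, True], False), expand (n - 1) (k, s @ [False, True], False)),
    ((k, s @ [True], True), expand n (k, s @ [True], True))]"
  have "prodY (map fst ?ps) - prodY (concat (map snd ?ps)) \<in> Thompson"
    by (rule refine_pairs) (use 2 expand_below in \<open>auto simp: incomp_append_same\<close>)
  then have "x + (prodY (map fst ?ps) - prodY (concat (map snd ?ps))) \<in> Thompson" using Thompson_add x(1) by blast
  then show ?case using x(2) by (simp add: add_diff_eq)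
next
  case (3 n k s)
  obtain x where x: "x \<in> Thompson" "Yl (k, s, False) = x + prodY [(k, s @ [False], False), (k, s @ [True, False], True), (k, s @ [True, True], False)]"
    using expand1(2) by blast
  let ?ps = "[((k, s @ [False], False), expand n (k, s @ [False], False)),
    ((k, s @ [True, False], True), expand (n - 1) (k, s @ [True, False], True)),
    ((k, s @ [True, True], False), expand (n - 1) (k, s @ [True, True], False))]"
  have "prodY (map fst ?ps) - prodY (concat (map snd ?ps)) \<in> Thompson"
    by (rule refine_pairs) (use 3 expand_below in \<open>auto simp: incomp_append_same\<close>)
  then have "x + (prodY (map fst ?ps) - prodY (concat (map snd ?ps))) \<in> Thompson" using Thompson_add x(1) by blast
  then show ?case using x(2) by (simp add: add_diff_eq)
qed

section \<open>Products in which every letter moves away from the base vertex\<close>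

inductive ascending :: "'g \<Rightarrow> bool" where
  ascending_0: "ascending 0"
| ascending_gen: "ascending q \<Longrightarrow> y \<in> {A, - A, B, - B} \<Longrightarrow> ascending (q + y)"
| ascending_up: "ascending q \<Longrightarrow> up (\<pi> q) l \<Longrightarrow> ascending (q + Yl l)"

lemma ascending_add_Thompson: "x \<in> Thompson \<Longrightarrow> ascending q \<Longrightarrow> ascending (q + x)"
proof (induction rule: Thompson.induct)
  case (Thompson_step x y)
  have "ascending (q + x + y)" by (rule ascending_gen[OF Thompson_step.IH[OF Thompson_step.prems] Thompson_step.hyps(2)])
  then show ?case by (simp add: add.assoc)
qed simp

lemma ascending_prodY:
  "ascending r \<Longrightarrow> sorted_wrt apart ms \<Longrightarrow> \<forall>m\<in>set ms. up (\<pi> r) m \<Longrightarrow> ascending (r + prodY ms)"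
proof (induction ms arbitrary: r)
  case (Cons m ms)
  have "ascending (r + Yl m)" using Cons.prems by (intro ascending_up) auto
  moreover have "up (\<pi> (r + Yl m)) l" if l: "l \<in> set ms" for l
  proof (rule up_cong)
    show "up (\<pi> r) l" using Cons.prems(3) l by simp
    have "apart m l" using Cons.prems(2) l by simp
    then have "t \<notin> lcone m" if "t \<in> lcone l" for t using that by (auto simp: apart_iff)
    then show "\<pi> r t = \<pi> (r + Yl m) t" if "t \<in> lcone l" for t
      using that by (simp add: hom' Yl_lcone(2))
  qed
  ultimately have "ascending (r + Yl m + prodY ms)" using Cons.prems(2) by (intro Cons.IH) auto
  then show ?case by (simp add: add.assoc)
qed simp

lemma refine_list:
  assumes "sorted_wrt apart ls"
  shows "prodY ls - prodY (concat (map (\<lambda>l. expand (n l) l) ls)) \<in> Thompson"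
proof -
  let ?ps = "map (\<lambda>l. (l, expand (n l) l)) ls"
  have "prodY (map fst ?ps) - prodY (concat (map snd ?ps)) \<in> Thompson"
    by (rule refine_pairs) (use assms expand_below Yl_expand in \<open>auto simp: o_def\<close>)
  then show ?thesis by (simp add: o_def)
qed

lemma sorted_refine:
  assumes "sorted_wrt apart ls"
  shows "sorted_wrt apart (concat (map (\<lambda>l. expand (n l) l) ls))"
  using assms
proof (induction ls)
  case (Cons l ls)
  have "apart x y" if x: "x \<in> set (expand (n l) l)" and m: "m \<in> set ls" and y: "y \<in> set (expand (n m) m)" for x m y
  proof -
    have "apart l m" using Cons.prems m by simp
    then show ?thesis using apart_expand x y by blast
  qed
  then show ?case using Cons by (auto simp: sorted_wrt_append sorted_expand)
qed simp

lemma minus_refine: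
  assumes "prodY ls - prodY R \<in> Thompson" "ascending (p - prodY R)"
  shows "ascending (p - prodY ls)"
proof -
  have "ascending (p - prodY R + - (prodY ls - prodY R))" by (rule ascending_add_Thompson[OF Thompson_minus[OF assms(1)] assms(2)])
  also have "p - prodY R + - (prodY ls - prodY R) = p - prodY ls" by (simp only: free_simps)
  finally show ?thesis .
qed

text \<open>The empty word is excluded because \<open>b\<close> breaks at \<open>1/2\<close>, inside
  \<open>(0, 1)\<close>; on every proper Farey subinterval it is given by one matrix.\<close>

lemma moves_total:
  assumes "y \<in> {A, - A, B, - B}" "s \<noteq> []"
  shows "\<exists>j u N. moves y k s j u N"
proof -
  consider "y = A" | "y = - A" | "y = B" | "y = - B" using assms(1) by blast
  then show ?thesis
  proof cases
    case 1 then show ?thesis using moves_A by blast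
  next
    case 2 then show ?thesis using moves_inverse[OF moves_A[of "k - 1" s]] by simp blast
  next
    case 3
    note y = 3
    obtain b s' where s: "s = b # s'" using assms(2) by (cases s) auto
    consider "k < 0" | "k \<ge> 1" | "k = 0" "b" | "k = 0" "\<not> b" by linarith
    then show ?thesis
    proof cases
      case 1 then show ?thesis using y moves_B_neg[of k s] by blast
    next
      case 2 then show ?thesis using y moves_B_pos[of k s] by blast
    next
      case 3
      note k = 3
      have "moves y k s 1 s' (Mat 3 (-1) 1 0)" using y k s moves_B_True[of s'] by simp
      then show ?thesis by blast
    next
      case 4
      note k = 4
      have "moves y k s 0 s' (Mat 1 0 (-1) 1)" using y k s moves_B_False[of s'] by simp
      then show ?thesis by blast
    qed
  next
    case 4
    note y = 4
    consider "k < 0" | "k = 0" | "k = 1" | "k \<ge> 2" by linarith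
    then show ?thesis
    proof cases
      case 1 then show ?thesis using y moves_inverse[OF moves_B_neg[of k s]] by blast
    next
      case 2 then show ?thesis using y moves_inverse[OF moves_B_False[of s]] by blast
    next
      case 3 then show ?thesis using y moves_inverse[OF moves_B_True[of s]] by blast
    next
      case 4
      then have "moves (- B) (k - 1 + 1) s (k - 1) s (madj (Mat 1 1 0 1))" by (intro moves_inverse moves_B_pos) simp
      then have "moves y k s (k - 1) s (madj (Mat 1 1 0 1))" using y by simp
      then show ?thesis by blast
    qed
  qed
qed

definition lmoves :: "'g \<Rightarrow> letter \<Rightarrow> letter \<Rightarrow> mat \<Rightarrow> bool" where
  "lmoves y l m N \<longleftrightarrow> (case l of (k, s, e) \<Rightarrow> case m of (j, u, f) \<Rightarrow> f = e \<and> moves y k s j u N)"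

lemma lmoves_total:
  assumes "y \<in> {A, - A, B, - B}" "len l \<noteq> 0"
  shows "\<exists>m N. lmoves y l m N"
proof -
  obtain k s e where l: "l = (k, s, e)" by (cases l)
  obtain j u N where "moves y k s j u N" using moves_total[of y s k] assms l by auto
  then have "lmoves y l (j, u, e) N" by (simp add: lmoves_def l)
  then show ?thesis by blast
qed

lemma lmovesD:
  assumes "lmoves y l m N"
  shows "y + Yl l = Yl m + y" "\<pi> y ` lcone l = lcone m" "moebius_on (\<pi> (- y)) (lcone m) (madj N)" "mdet N = 1"
    "avec m = mvec N (avec l)"
proof -
  obtain k s e where l: "l = (k, s, e)" by (cases l)
  obtain j u f where m: "m = (j, u, f)" by (cases m)
  have moves: "moves y k s j u N" and f: "f = e" using assms by (auto simp: lmoves_def l m)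
  have a: "y + Y k s = Y j u + y" "\<pi> y ` cone k s = cone j u" "mdet N = 1" "cone_mat j u = mmul N (cone_mat k s)"
    using moves by (auto simp: moves_def)
  show "\<pi> y ` lcone l = lcone m" "mdet N = 1" using a by (auto simp: l m)
  show "moebius_on (\<pi> (- y)) (lcone m) (madj N)" using moves_inverse[OF moves] by (simp add: moves_def m)
  have "Yl l = - y + (Yl m + y)" unfolding l m f by (rule Yl_conj[OF a(1)])
  then show "y + Yl l = Yl m + y" by simp
  show "avec m = mvec N (avec l)" by (cases N; cases "cone_mat k s") (auto simp: l m f a(4))
qed

lemma down_lmoves:
  assumes moves: "lmoves y l m N" and d: "down (g \<circ> \<pi> y) l"
  shows "down g m"
proof -
  note a = lmovesD[OF moves]
  obtain M where M: "moebius_on (g \<circ> \<pi> y) (lcone l) M" "odd_mat M" "mker M (avec l)"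
    using d unfolding down_def by blast
  have "moebius_on (g \<circ> \<pi> y \<circ> \<pi> (- y)) (lcone m) (mmul M (madj N))"
    by (rule moebius_on_compose[OF a(3) M(1)]) (simp add: a(2)[symmetric] image_image)
  moreover have "g \<circ> \<pi> y \<circ> \<pi> (- y) = g" by (rule ext) simp
  moreover have "mker (mmul M (madj N)) (avec m)" using M(3) by (simp add: mker_mmul a(5) vec_madj[OF a(4)])
  ultimately show ?thesis unfolding down_def using odd_mat_madj[OF M(2) a(4)] by metis
qed

text \<open>The generators carry letters to letters, so \<open>ls\<close> can be moved past
  \<open>y\<close>. Subdividing once beforehand makes all words nonempty, as
  \<open>lmoves_total\<close> demands.\<close>

lemma peel_step:
  assumes IH: "\<And>ls. sorted_wrt apart ls \<Longrightarrow> \<forall>l\<in>set ls. down (\<pi> q) l \<Longrightarrow> ascending (q - prodY ls)"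
    and y: "y \<in> {A, - A, B, - B}" and ls: "sorted_wrt apart ls" "\<forall>l\<in>set ls. down (\<pi> (q + y)) l"
  shows "ascending (q + y - prodY ls)"
proof (rule minus_refine[OF refine_list[OF ls(1), of "\<lambda>_. 1"]])
  let ?R = "concat (map (expand 1) ls)"
  have R: "down (\<pi> q \<circ> \<pi> y) m" "len m \<noteq> 0" if mR: "m \<in> set ?R" for m
  proof -
    obtain l where l: "l \<in> set ls" "m \<in> set (expand 1 l)" using mR by auto
    have "down (\<pi> (q + y)) l" using ls(2) l(1) by blast
    then show "down (\<pi> q \<circ> \<pi> y) m" using down_expand[OF _ l(2)] by (simp add: hom)
    show "len m \<noteq> 0" using expand_below[OF l(2)] by simp
  qed
  define f where "f m = (SOME m'. \<exists>N. lmoves y m m' N)" for m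
  have f: "\<exists>N. lmoves y m (f m) N" if "m \<in> set ?R" for m
    unfolding f_def by (rule someI_ex) (use lmoves_total[OF y R(2)[OF that]] in blast)
  have sub: "sorted_wrt apart (map f ms) \<and> y + prodY ms = prodY (map f ms) + y"
    if "sorted_wrt apart ms" "set ms \<subseteq> set ?R" for ms
    using that
  proof (induction ms)
    case (Cons m ms)
    have mR: "m' \<in> set ?R" if "m' \<in> set (m # ms)" for m' using Cons.prems(2) that by (rule subsetD)
    obtain N where N: "lmoves y m (f m) N" using f[OF mR[of m]] by auto
    have "apart (f m) (f m')" if m': "m' \<in> set ms" for m'
    proof -
      obtain N' where N': "lmoves y m' (f m') N'" using f[OF mR[of m']] m' by auto
      have "lcone m \<inter> lcone m' = {}" using Cons.prems(1) m' by (simp add: apart_iff)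
      moreover have "inj (\<pi> y)" by (metis \<pi>_minus(2) injI)
      ultimately have "\<pi> y ` lcone m \<inter> \<pi> y ` lcone m' = {}" by (simp add: image_Int[symmetric])
      then show ?thesis using lmovesD(2)[OF N] lmovesD(2)[OF N'] by (simp add: apart_iff)
    qed
    moreover have "y + (Yl m + prodY ms) = Yl (f m) + (y + prodY ms)"
      using lmovesD(1)[OF N] by (simp add: add.assoc[symmetric])
    ultimately show ?case using Cons by (simp add: add.assoc)
  qed simp
  have "sorted_wrt apart ?R" using sorted_refine[OF ls(1), of "\<lambda>_. 1"] by simp
  then have s: "sorted_wrt apart (map f ?R)" "y + prodY ?R = prodY (map f ?R) + y" using sub[of ?R] by auto
  have "ascending (q - prodY (map f ?R))"
  proof (rule IH[OF s(1)], rule ballI)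
    fix l assume "l \<in> set (map f ?R)"
    then obtain m where m: "m \<in> set ?R" "l = f m" by auto
    then show "down (\<pi> q) l" using f[OF m(1)] down_lmoves R(1)[OF m(1)] by blast
  qed
  then have "ascending (q - prodY (map f ?R) + y)" by (intro ascending_gen y)
  also have "q - prodY (map f ?R) + y = q + (- prodY (map f ?R) + y)" by (simp only: free_simps)
  also have "- prodY (map f ?R) + y = y + - prodY ?R" 
  proof -
    have "- prodY (map f ?R) + (y + prodY ?R) + - prodY ?R = - prodY (map f ?R) + (prodY (map f ?R) + y) + - prodY ?R"
      unfolding s(2) ..
    then show ?thesis by (simp only: free_simps)
  qed
  finally show "ascending (q + y - prodY (concat (map (\<lambda>l. expand 1 l) ls)))" by (simp add: add_diff_eq)
qed

lemma peel_up:
  assumes IH: "\<And>ls. sorted_wrt apart ls \<Longrightarrow> \<forall>l\<in>set ls. down (\<pi> q) l \<Longrightarrow> ascending (q - prodY ls)"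
    and J: "up (\<pi> q) J" and ls: "sorted_wrt apart ls" "\<forall>l\<in>set ls. down (\<pi> (q + Yl J)) l"
  shows "ascending (q + Yl J - prodY ls)"
proof -
  \<comment> \<open>With the largest length as common depth, no piece of \<open>ls\<close> has a
    word shorter than that of \<open>J\<close>, so a piece that meets the interval of
    \<open>J\<close> lies inside it.\<close>
  define n where "n = Max (set (map len (J # ls)))"
  have n: "len l \<le> n" if "l \<in> set (J # ls)" for l
    unfolding n_def by (rule Max_ge) (use that in auto)
  define R where "R = concat (map (\<lambda>l. expand (n - len l) l) ls)"
  define js where "js = expand (n - len J) J"
  let ?p = "q + Yl J"
  have pJ: "down (\<pi> ?p) J" using up_down[OF J] by (simp add: hom)
  have Rd: "down (\<pi> ?p) m" if mR: "m \<in> set R" for m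
  proof -
    obtain l where l: "l \<in> set ls" "m \<in> set (expand (n - len l) l)" using mR by (auto simp: R_def)
    have "down (\<pi> ?p) l" using ls(2) l(1) by blast
    then show ?thesis using down_expand[OF _ l(2)] by blast
  qed
  have jd: "down (\<pi> ?p) m" if "m \<in> set js" for m using down_expand[OF pJ] that by (simp add: js_def)
  have sR: "sorted_wrt apart R" unfolding R_def by (rule sorted_refine[OF ls(1)])
  have sj: "sorted_wrt apart js" unfolding js_def by (rule sorted_expand)
  \<comment> \<open>Such a piece has the right depth by construction and the colour of
    \<open>J\<close> by \<open>down_same_color\<close>, and \<open>set_expand\<close> asks for
    nothing else.\<close>
  have key: "m \<in> set js" if mR: "m \<in> set R" and ni: "\<not> apart m J" for m
  proof -
    obtain l where l: "l \<in> set ls" "m \<in> set (expand (n - len l) l)" using mR by (auto simp: R_def)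
    obtain k s e where l': "l = (k, s, e)" by (cases l)
    obtain k1 u f where m': "m = (k1, u, f)" by (cases m)
    obtain k2 v e2 where J': "J = (k2, v, e2)" by (cases J)
    have lev: "lev (n - len l) l m" using set_expand l(2) by blast
    then obtain w where w: "u = s @ w" "k1 = k" "acol m = acol l"
      "length w = n - length s \<or> length w = Suc (n - length s) \<and> (\<forall>f'. acol (k, butlast u, f') \<noteq> acol l)"
      by (auto simp: lev_def l' m')
    have ln: "length s \<le> n" "length v \<le> n" using n[of l] n[of J] l(1) by (auto simp: l' J')
    have "k1 = k2" "\<not> incomp u v" using ni by (auto simp: m' J')
    then obtain x where x: "u = v @ x"
    proof -
      assume *: "\<And>x. u = v @ x \<Longrightarrow> thesis"
      from not_incomp[OF \<open>\<not> incomp u v\<close>] consider y where "v = u @ y" | y where "u = v @ y" by blast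
      then show thesis
      proof cases
        case (1 y)
        then have "length u + length y \<le> n" using ln by simp
        moreover have "n \<le> length u" using w(1,4) ln(1) by auto
        ultimately have "length y = 0" by linarith
        then have "y = []" by simp
        then show ?thesis using 1 *[of "[]"] by simp
      qed (use * in blast)
    qed
    have sub: "lcone m \<subseteq> lcone J"
      by (rule below_lio) (use x \<open>k1 = k2\<close> in \<open>auto simp: below_def m' J'\<close>)
    have col: "acol m = acol J" by (rule down_same_color[OF pJ Rd[OF mR] sub])
    have "length x + length v = length s + length w" using x w(1) by (metis add.commute length_append)
    then have "length x = n - length v \<or> length x = Suc (n - length v) \<and> (\<forall>f'. acol (k2, butlast u, f') \<noteq> acol J)"
      using w(2,3,4) ln col \<open>k1 = k2\<close> by auto
    then have "lev (n - len J) J m" using x col \<open>k1 = k2\<close> by (auto simp: lev_def m' J')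
    then show ?thesis unfolding js_def set_expand by simp
  qed
  define R2 where "R2 = filter (\<lambda>m. m \<notin> set js) R"
  define js1 where "js1 = filter (\<lambda>m. m \<in> set R) js"
  define js2 where "js2 = filter (\<lambda>m. m \<notin> set R) js"
  have R2J: "apart m J" if "m \<in> set R2" for m using key[of m] that by (cases "apart m J") (simp_all add: R2_def)
  have R2j: "apart m j" if "m \<in> set R2" "j \<in> set js" for m j
  proof -
    have "below J j" using expand_below[of j "n - len J" J] that(2) by (simp add: js_def)
    moreover have "apart J m" using R2J[OF that(1)] apart_sym by simp
    ultimately have "apart j m" by (rule below_apart)
    then show ?thesis using apart_sym by simp
  qed
  have sR2: "sorted_wrt apart R2" and sj1: "sorted_wrt apart js1" and sj2: "sorted_wrt apart js2"
    using sR sj by (auto simp: R2_def js1_def js2_def sorted_wrt_filter)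
  have eR: "prodY R = prodY js1 + prodY R2"
  proof -
    have "prodY (filter (\<lambda>m. m \<in> set js) R) = prodY js1"
      by (rule prodY_set_eq) (use sR sj1 in \<open>auto simp: js1_def sorted_wrt_filter\<close>)
    then show ?thesis using prodY_partition[OF sR, of "\<lambda>m. m \<in> set js"] by (simp add: R2_def)
  qed
  have ej: "prodY js = prodY js1 + prodY js2"
    using prodY_partition[OF sj, of "\<lambda>m. m \<in> set R"] by (simp add: js1_def js2_def)
  have c1: "com (Yl J) (prodY R2)"
  proof (rule com_prodY)
    show "com (Yl J) (Yl l)" if "l \<in> set R2" for l using com_sym[OF com_Yl[OF R2J[OF that]]] .
  qed
  have c2: "com (prodY R2) (prodY js)" "com (prodY R2) (prodY js1)"
    by (rule com_prodY2, rule R2j, simp_all add: js1_def)+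
  have c3: "com (prodY js1) (prodY js2)"
  proof (rule com_prodY2)
    fix x y assume xy: "x \<in> set js1" "y \<in> set js2"
    then have "x \<noteq> y" "x \<in> set js" "y \<in> set js" by (auto simp: js1_def js2_def)
    then show "apart x y" by (intro sorted_apart_mem[OF sj])
  qed
  define h where "h = Yl J - prodY js"
  have h: "h \<in> Thompson" unfolding h_def js_def by (rule Yl_expand)
  \<comment> \<open>Equals \<open>?p\<close> with the outer pieces \<open>R2\<close> and all pieces
    of \<open>J\<close> removed; it is ascending because \<open>h\<close> is a Thompson element.
    Multiplying by \<open>js2\<close> then restores exactly the pieces that should not have been
    removed.\<close>
  let ?r = "q - prodY R2 + h"
  have r: "?r = ?p + - prodY R2 + - prodY js"
  proof -
    have "- prodY R2 + Yl J = Yl J + - prodY R2" using com_minus[OF c1] by (simp add: com_def)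
    then have "q + (- prodY R2 + Yl J) + - prodY js = q + (Yl J + - prodY R2) + - prodY js" by simp
    then show ?thesis unfolding h_def by (simp only: free_simps)
  qed
  have "ascending (q - prodY R2)"
  proof (rule IH[OF sR2], rule ballI)
    fix m assume m: "m \<in> set R2"
    have dm: "down (\<pi> ?p) m" using Rd m by (simp add: R2_def)
    have "lcone m \<inter> lcone J = {}" using R2J[OF m] by (simp add: apart_iff)
    then have "t \<notin> lcone J" if "t \<in> lcone m" for t using that by auto
    then show "down (\<pi> q) m" by (intro down_cong[OF _ dm]) (simp add: hom' Yl_lcone(2))
  qed
  then have NNr: "ascending ?r" by (rule ascending_add_Thompson[OF h])
  \<comment> \<open>On the interval of \<open>m\<close> the element \<open>?r\<close> acts as
    \<open>?p\<close> followed backwards along \<open>m\<close> alone, so \<open>down_up\<close>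
    applies.\<close>
  have "up (\<pi> ?r) m" if m: "m \<in> set js2" for m
  proof -
    have mj: "m \<in> set js" using m by (simp add: js2_def)
    show ?thesis
    proof (rule up_cong)
      show "up (\<pi> ?p \<circ> \<pi> (Yl (lneg m))) m" by (rule down_up[OF jd[OF mj]])
      fix t assume t: "t \<in> lcone m"
      have 1: "\<pi> (- prodY js) t = \<pi> (Yl (lneg m)) t"
        unfolding minus_prodY by (rule prodY_in[OF sorted_rev_lneg[OF sj]]) (use mj t in auto)
      have 2: "\<pi> (Yl (lneg m)) t \<in> lcone m" using Yl_lcone(1)[of t "lneg m"] t by simp
      have 3: "\<pi> (- prodY R2) x = x" if x: "x \<in> lcone m" for x
        unfolding minus_prodY
      proof (rule prodY_out)
        fix l assume "l \<in> set (rev (map lneg R2))"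
        then obtain l' where l': "l' \<in> set R2" "l = lneg l'" by auto
        have "lcone l' \<inter> lcone m = {}" using R2j[OF l'(1) mj] by (simp add: apart_iff)
        then show "x \<notin> lcone l" using x l'(2) by auto
      qed
      show "(\<pi> ?p \<circ> \<pi> (Yl (lneg m))) t = \<pi> ?r t"
        unfolding r by (simp only: hom' comp_apply 1 3[OF 2])
    qed
  qed
  then have "ascending (?r + prodY js2)" by (intro ascending_prodY[OF NNr sj2] ballI)
  moreover have "?r + prodY js2 = ?p - prodY R"
  proof -
    have i1: "- prodY js + prodY js2 = - prodY js1"
    proof -
      have "prodY js = prodY js2 + prodY js1" using ej c3 by (simp add: com_def)
      then have "- prodY js = - prodY js1 + - prodY js2" by (simp only: minus_add)
      then show ?thesis by (simp only: free_simps)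
    qed
    have "?r + prodY js2 = ?p + - prodY R2 + (- prodY js + prodY js2)" unfolding r by (simp only: add.assoc)
    also have "\<dots> = ?p + - (prodY js1 + prodY R2)" unfolding i1 by (simp only: minus_add add.assoc)
    finally show ?thesis unfolding eR by (simp only: diff_conv_add_uminus)
  qed
  ultimately have "ascending (?p - prodY R)" by simp
  then show ?thesis by (rule minus_refine[OF refine_list[OF ls(1), of "\<lambda>l. n - len l", folded R_def]])
qed

lemma peel:
  "ascending p \<Longrightarrow> sorted_wrt apart ls \<Longrightarrow> \<forall>l\<in>set ls. down (\<pi> p) l \<Longrightarrow> ascending (p - prodY ls)"
proof (induction arbitrary: ls rule: ascending.induct)
  case ascending_0
  show ?case
  proof (cases ls)
    case (Cons l ls')
    then have "down (\<pi> 0) l" using ascending_0 by simp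
    \<comment> \<open>The identity matrix kills no nonzero vector mod 2, so no letter moves towards
      the base vertex from there.\<close>
    then obtain M where M: "moebius_on (\<pi> 0) (lcone l) M" "odd_mat M" "mker M (avec l)" unfolding down_def by blast
    have "moebius_on (\<pi> 0) (lcone l) (Mat 1 0 0 1)" by (simp add: \<pi>_0)
    moreover have "infinite (lcone l)" using infinite_cone by (cases l) simp
    ultimately have "mker (Mat 1 0 0 1) (avec l)"
      using mker_unique[OF M(1) _ M(2), of "Mat 1 0 0 1" "avec l"] M(3) by simp
    then have "acol l = (False, False)" by (cases "avec l") (simp add: acol_def par_def)
    then show ?thesis using acol_nonzero by blast
  qed (simp add: ascending.ascending_0)
next
  case (ascending_gen q y)
  show ?case by (rule peel_step[OF ascending_gen.IH ascending_gen.hyps(2) ascending_gen.prems])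
next
  case (ascending_up q l)
  show ?case by (rule peel_up[OF ascending_up.IH ascending_up.hyps(2) ascending_up.prems])
qed

lemma ascending_add_Yl:
  assumes p: "ascending p"
  shows "ascending (p + Yl l)"
proof -
  have "piecewise_moebius (\<pi> p)" using \<pi>_pp by (simp add: pp_homeo_def)
  then obtain D where D: "finite D" "D \<subseteq> \<rat>"
    "\<forall>u v. u < v \<longrightarrow> {u<..<v} \<inter> D = {} \<longrightarrow> (\<exists>M. moebius_on (\<pi> p) {u<..<v} M)"
    unfolding piecewise_moebius_def by blast
  \<comment> \<open>Below this depth no interval contains a break point of \<open>p\<close>, so each
    piece sees a single matrix.\<close>
  obtain n where n: "\<forall>k s. n \<le> length s \<longrightarrow> cone k s \<inter> D = {}" using cone_avoid[OF D(1,2)] by blast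
  have deep: "\<exists>M. moebius_on (\<pi> p) (lcone m) M \<and> odd_mat M" if len: "n \<le> len m" for m
  proof -
    obtain k s e where m: "m = (k, s, e)" by (cases m)
    have "\<exists>M. moebius_on (\<pi> p) {lp (cone_mat k s)<..<rp (cone_mat k s)} M"
      using D(3) farey_less[OF farey_cone_mat, of k s] n len by (simp add: m cone_def interval_def)
    then show ?thesis using moebius_on_odd_mat by (simp add: m cone_def interval_def) blast
  qed
  \<comment> \<open>Subdividing the inverse letter and inverting back puts the Thompson correction
    on the right, where an ascending product absorbs it.\<close>
  define E where "E = expand n (lneg l)"
  define ms where "ms = rev (map lneg E)"
  have "Yl (lneg l) - prodY E \<in> Thompson" unfolding E_def by (rule Yl_expand)
  then have "- (Yl (lneg l) - prodY E) \<in> Thompson" by (rule Thompson_minus)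
  moreover have "- (Yl (lneg l) - prodY E) = - prodY ms + Yl l"
  proof -
    have "- prodY ms = prodY E" unfolding ms_def minus_prodY by (simp add: rev_map o_def)
    then show ?thesis by (simp only: Yl_lneg free_simps)
  qed
  ultimately have x: "- prodY ms + Yl l \<in> Thompson" by simp
  have sms: "sorted_wrt apart ms" unfolding ms_def E_def by (intro sorted_rev_lneg sorted_expand)
  have len: "n \<le> len m" if mm: "m \<in> set ms" for m
  proof -
    obtain m' where m': "m' \<in> set E" "m = lneg m'" using mm by (auto simp: ms_def)
    have "n \<le> len m'" using expand_below[of m' n "lneg l"] m'(1) by (simp add: E_def)
    then show ?thesis using m'(2) by (cases m') simp
  qed
  \<comment> \<open>If the matrix of \<open>p\<close> kills the anchor of \<open>lneg m\<close>,
    adding \<open>m\<close> is a retraction, which \<open>peel\<close> performs; otherwise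
    \<open>m\<close> moves away from the base vertex and is appended.\<close>
  define P where "P m \<longleftrightarrow> down (\<pi> p) (lneg m)" for m
  define U where "U = filter (\<lambda>m. \<not> P m) ms"
  define V where "V = filter P ms"
  have sU: "sorted_wrt apart U" and sV: "sorted_wrt apart V" using sms by (auto simp: U_def V_def sorted_wrt_filter)
  have "ascending (p - prodY (rev (map lneg V)))"
    by (rule peel[OF p sorted_rev_lneg[OF sV]]) (auto simp: V_def P_def)
  moreover have "- prodY (rev (map lneg V)) = prodY V" unfolding minus_prodY by (simp add: rev_map o_def)
  ultimately have NV: "ascending (p + prodY V)" by (simp only: diff_conv_add_uminus)
  have "up (\<pi> (p + prodY V)) m" if m: "m \<in> set U" for m
  proof (rule up_cong)
    have m': "m \<in> set ms" "\<not> P m" using m by (auto simp: U_def)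
    obtain M where M: "moebius_on (\<pi> p) (lcone m) M" "odd_mat M" using deep[OF len[OF m'(1)]] by blast
    then have "\<not> mker M (avec (lneg m))" using m'(2) unfolding P_def down_def by auto
    then show "up (\<pi> p) m" unfolding up_def using M by blast
    fix t assume t: "t \<in> lcone m"
    have "\<pi> (prodY V) t = t"
    proof (rule prodY_out)
      fix v assume v: "v \<in> set V"
      then have "v \<noteq> m" "v \<in> set ms" using m' by (auto simp: V_def)
      then have "apart v m" by (intro sorted_apart_mem[OF sms _ m'(1)])
      then show "t \<notin> lcone v" using t by (auto simp: apart_iff)
    qed
    then show "\<pi> p t = \<pi> (p + prodY V) t" by (simp add: hom')
  qed
  then have "ascending (p + prodY V + prodY U)" by (intro ascending_prodY[OF NV sU] ballI)
  moreover have "prodY V + prodY U = prodY ms"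
    using prodY_partition[OF sms, of P] by (simp add: U_def V_def)
  ultimately have "ascending (p + prodY ms)" by (simp add: add.assoc)
  then have "ascending (p + prodY ms + (- prodY ms + Yl l))" by (rule ascending_add_Thompson[OF x])
  then show ?thesis by (simp only: free_simps)
qed

text \<open>A new letter leaves its anchor as kernel, and a later Thompson generator carries the
  kernel along by a unimodular matrix. The condition on \<open>len\<close> keeps the interval small
  enough for the next generator.\<close>

lemma ascending_cases_kernel:
  "ascending p \<Longrightarrow> p \<in> Thompson \<or> (\<exists>l M v. len l \<noteq> 0 \<and> moebius_on (\<pi> p) (lcone l) M \<and> odd_mat M \<and> mker M v \<and> par v \<noteq> (False, False))"
proof (induction rule: ascending.induct)
  case ascending_0 then show ?case by (simp add: Thompson_0)
next
  case (ascending_gen q y)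
  show ?case
  proof (cases "q \<in> Thompson")
    case True then show ?thesis using Thompson_step ascending_gen.hyps(2) by blast
  next
    case False
    then obtain l M v where M: "len l \<noteq> 0" "moebius_on (\<pi> q) (lcone l) M" "odd_mat M" "mker M v" "par v \<noteq> (False, False)"
      using ascending_gen.IH by blast
    have my: "- y \<in> {A, - A, B, - B}" using ascending_gen.hyps(2) by auto
    define l1 where "l1 = hd (expand 1 l)"
    have l1: "l1 \<in> set (expand 1 l)" unfolding l1_def by (rule hd_in_set[OF expand_1_nonempty])
    have e: "below l l1" "len l1 \<noteq> 0" using expand_below[OF l1] by auto
    obtain m N where moves: "lmoves (- y) l1 m N" using lmoves_total[OF my e(2)] by blast
    note a = lmovesD[OF moves]
    have sub: "\<pi> y ` lcone m \<subseteq> lcone l"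
      unfolding a(2)[symmetric] using below_lio[OF e(1)] by (auto simp: image_image)
    have "moebius_on (\<pi> q \<circ> \<pi> y) (lcone m) (mmul M (madj N))"
      by (rule moebius_on_compose[OF _ M(2) sub]) (use a(3) in simp)
    have mk: "mker (mmul M (madj N)) (mvec N v)" using M(4) by (simp add: mker_mmul vec_madj[OF a(4)])
    have pn: "par (mvec N v) \<noteq> (False, False)"
    proof
      assume "par (mvec N v) = (False, False)"
      then have "mker (madj N) (mvec N v)" by (cases N; cases "mvec N v") (simp add: par_def)
      then have "par v = (False, False)" by (simp add: mker_iff_mvec vec_madj[OF a(4)] par_def)
      then show False using M(5) by simp
    qed
    define m1 where "m1 = hd (expand 1 m)"
    have m1: "m1 \<in> set (expand 1 m)" unfolding m1_def by (rule hd_in_set[OF expand_1_nonempty])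
    have e1: "below m m1" "len m1 \<noteq> 0" using expand_below[OF m1] by auto
    have "moebius_on (\<pi> (q + y)) (lcone m1) (mmul M (madj N))"
      using moebius_on_subset[OF \<open>moebius_on (\<pi> q \<circ> \<pi> y) (lcone m) (mmul M (madj N))\<close> below_lio[OF e1(1)]]
      by (simp add: hom)
    then show ?thesis using e1(2) odd_mat_madj[OF M(3) a(4)] mk pn by blast
  qed
next
  case (ascending_up q l)
  have "down (\<pi> (q + Yl l)) l" using up_down[OF ascending_up.hyps(2)] by (simp add: hom)
  define l1 where "l1 = hd (expand 1 l)"
  have l1: "l1 \<in> set (expand 1 l)" unfolding l1_def by (rule hd_in_set[OF expand_1_nonempty])
  have "down (\<pi> (q + Yl l)) l1" by (rule down_expand[OF \<open>down (\<pi> (q + Yl l)) l\<close> l1])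
  moreover have "len l1 \<noteq> 0" using expand_below[OF l1] by simp
  moreover have "par (avec l1) \<noteq> (False, False)" using acol_nonzero[of l1] by (simp add: acol_def)
  ultimately show ?case unfolding down_def by blast
qed

lemma ascending_faithful:
  assumes "ascending p" "\<And>t. \<pi> p t = t"
  shows "p = 0"
proof (cases "p \<in> Thompson")
  case True then show ?thesis using Thompson_faithful assms(2) by blast
next
  case False
  then obtain l M v where M: "moebius_on (\<pi> p) (lcone l) M" "odd_mat M" "mker M v" "par v \<noteq> (False, False)"
    using ascending_cases_kernel[OF assms(1)] by blast
  have "moebius_on (\<pi> p) (lcone l) (Mat 1 0 0 1)" by (simp add: assms(2))
  moreover have "infinite (lcone l)" using infinite_cone by (cases l) simp
  ultimately have "mker (Mat 1 0 0 1) v"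
    using mker_unique[OF M(1) _ M(2), of "Mat 1 0 0 1" v] M(3) by simp
  then have "par v = (False, False)" by (cases v) (simp add: par_def)
  then show ?thesis using M(4) by simp
qed

lemma ascending_add_gen: "ascending p \<Longrightarrow> y \<in> {A, - A, B, - B, C, - C} \<Longrightarrow> ascending (p + y)"
  using ascending_gen[of p y] ascending_add_Yl[of p "(0, [], True)"] ascending_add_Yl[of p "(0, [], False)"]
  by (auto simp: Yl_def Y_0)

end

section \<open>Relations in \<open>G\<^sub>0\<close>\<close>

lemma map_b_le: "map_b t \<le> t + 1"
proof -
  consider "t \<le> 0" | "0 < t" "t \<le> 1/2" | "1/2 < t" "t \<le> 1" | "1 < t" by linarith
  then show ?thesis
  proof cases
    case 2
    then have "t * t \<le> 1/2 * (1/2)" by (intro mult_mono) auto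
    then have "t \<le> (t + 1) * (1 - t)" using 2 by (simp add: algebra_simps)
    then show ?thesis using 2 by (simp add: map_b_left pos_divide_le_eq)
  next
    case 3
    have "0 \<le> (t - 1)\<^sup>2" by simp
    then have "(2 - t) * t \<le> 1" by (simp add: power2_eq_square algebra_simps)
    then have "2 - t \<le> 1 / t" using 3 by (simp add: pos_le_divide_eq)
    then show ?thesis using 3 by (simp add: map_b_right)
  qed (simp_all add: map_b_def)
qed

lemma map_b_shift: "t \<ge> 1 \<Longrightarrow> map_b t = t + 1" and map_b_fix: "t \<le> 0 \<Longrightarrow> map_b t = t"
  by (auto simp: map_b_def)

lemma map_c_fix: "t \<le> 0 \<Longrightarrow> map_c t = t" "t \<ge> 1 \<Longrightarrow> map_c t = t"
  by (auto simp: map_c_def)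

lemma inv_c_fix: "t \<le> 0 \<Longrightarrow> inv_c t = t" "t \<ge> 1 \<Longrightarrow> inv_c t = t"
  by (auto simp: inv_c_def)

lemma map_c_le_1: "t \<le> 1 \<Longrightarrow> map_c t \<le> 1" and map_c_ge_0: "0 \<le> t \<Longrightarrow> 0 \<le> map_c t"
  by (auto simp: map_c_def divide_simps)

lemma rel_BB: "n \<ge> 1 \<Longrightarrow> map_b (map_b (t - n) + n) = map_b (map_b t - (n + 1)) + (n + 1)"
proof (cases "t \<le> n")
  case True
  then show ?thesis using map_b_le[of t] by (simp add: map_b_fix)
next
  case False
  assume n: "n \<ge> 1"
  have "map_b (t - n) \<ge> t - n" by (rule map_b_ge)
  then show ?thesis using False n by (simp add: map_b_shift)
qed

lemma rel_CB: "n \<ge> 1 \<Longrightarrow> map_c (map_b (t - n) + n) = map_b (map_c t - n) + n"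
proof (cases "t \<le> n")
  case True
  assume n: "n \<ge> 1"
  have "map_c t \<le> n" using map_c_le_1[of t] map_c_fix(2)[of t] n True by (cases "t \<le> 1") auto
  then show ?thesis using True by (simp add: map_b_fix)
next
  case False
  assume n: "n \<ge> 1"
  have "map_b (t - n) \<ge> t - n" by (rule map_b_ge)
  then show ?thesis using False n by (simp add: map_c_fix)
qed

lemma rel_CE: "n \<ge> 1 \<Longrightarrow> map_c (map_b (t + n) - n - 1) = map_b (map_c t + n) - n - 1"
proof (cases "t \<ge> 0")
  case True
  assume n: "n \<ge> 1"
  then show ?thesis using True map_c_ge_0[OF True] by (simp add: map_b_shift)
next
  case False
  have "map_b (t + n) - n - 1 \<le> t" using map_b_le[of "t + n"] by simp
  then show ?thesis using False by (simp add: map_c_fix)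
qed

lemma rel_CC: "n \<ge> 1 \<Longrightarrow> map_c (map_c (t - n) + n) = map_c (map_c t - n) + n"
proof -
  assume n: "n \<ge> 1"
  consider "t \<le> 1" | "1 < t" "t \<le> n" | "1 < t" "n < t" by linarith
  then show ?thesis
  proof cases
    case 1 then show ?thesis using n map_c_le_1[of t] by (simp add: map_c_fix(1))
  next
    case 2 then show ?thesis by (simp add: map_c_fix)
  next
    case 3
    then show ?thesis using n map_c_ge_0[of "t - n"] by (simp add: map_c_fix)
  qed
qed

text \<open>The cases are cut where formulas change: \<open>b\<close> breaks at \<open>1/2\<close>,
  and both \<open>b\<close> and \<open>c\<close> send \<open>1/3\<close> to
  \<open>1/2\<close>.\<close>

lemma rel_BBC:
  "map_b (map_b (map_c t) - 1) + 1 = map_c (inv_c (map_c (map_b (map_b t) - 2) + 2 - 1) + 1)"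
proof -
  consider "t \<le> 0" | "0 < t" "t \<le> 1/3" | "1/3 < t" "t \<le> 1/2" | "1/2 < t" "t \<le> 1" | "1 < t" by linarith
  then show ?thesis
  proof cases
    case 1 then show ?thesis by (simp add: map_c_fix map_b_fix inv_c_fix)
  next
    case 2
    have 1: "map_c t = 2 * t / (1 + t)" using 2 by (simp add: map_c_def)
    have 2: "0 \<le> 2 * t / (1 + t)" "2 * t / (1 + t) \<le> 1/2" "2 * t / (1 - t) \<le> 1"
      "0 \<le> t / (1 - t)" "t / (1 - t) \<le> 1/2" "0 \<le> t / (1 - 2 * t)" "t / (1 - 2 * t) \<le> 1"
      using 2 by (auto simp: divide_simps)
    have 3: "2 * t / (1 + t) / (1 - 2 * t / (1 + t)) = 2 * t / (1 - t)"
    proof -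
      have "1 - 2 * t / (1 + t) = (1 - t) / (1 + t)"
        using \<open>0 < t\<close> by (simp add: diff_divide_eq_iff)
      then show ?thesis using \<open>0 < t\<close> by simp
    qed
    have 4: "t / (1 - t) / (1 - t / (1 - t)) = t / (1 - 2 * t)"
    proof -
      have "1 - t / (1 - t) = (1 - 2 * t) / (1 - t)"
        using \<open>t \<le> 1/3\<close> by (simp add: diff_divide_eq_iff)
      then show ?thesis using \<open>t \<le> 1/3\<close> by simp
    qed
    have 5: "2 * (t / (1 - 2 * t)) / (1 + t / (1 - 2 * t)) = 2 * t / (1 - t)"
    proof -
      have "1 + t / (1 - 2 * t) = (1 - t) / (1 - 2 * t)"
        using \<open>t \<le> 1/3\<close> by (simp add: add_divide_eq_iff)
      then show ?thesis using \<open>t \<le> 1/3\<close> by simp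
    qed
    have b: "map_b (map_c t) = 2 * t / (1 - t)" using map_b_left[OF 2(1,2)] 1 3 by simp
    have "map_b t = t / (1 - t)" using \<open>0 < t\<close> \<open>t \<le> 1/3\<close> by (simp add: map_b_left)
    then have bb: "map_b (map_b t) = t / (1 - 2 * t)" using map_b_left[OF 2(4,5)] 4 by simp
    have c: "map_c (t / (1 - 2 * t)) = 2 * t / (1 - t)" using 2(6,7) 5 by (simp add: map_c_def)
    show ?thesis unfolding b bb using 2(3,7) c by (simp add: map_b_fix map_c_fix(1) inv_c_fix(1))
  next
    case 3
    have c: "map_c t = 2 * t / (1 + t)" using 3 by (simp add: map_c_def)
    have c2: "1/2 \<le> 2 * t / (1 + t)" "2 * t / (1 + t) \<le> 1" using 3 by (auto simp: divide_simps)
    have v: "3 - 1 / (2 * t / (1 + t)) - 1 = (3 * t - 1) / (2 * t)" using 3 by (simp add: field_simps)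
    have v2: "0 \<le> (3 * t - 1) / (2 * t)" "(3 * t - 1) / (2 * t) \<le> 1/2" using 3 by (auto simp: divide_simps)
    have l: "(3 * t - 1) / (2 * t) / (1 - (3 * t - 1) / (2 * t)) = (3 * t - 1) / (1 - t)"
    proof -
      have "1 - (3 * t - 1) / (2 * t) = (1 - t) / (2 * t)" using 3 by (simp add: field_simps)
      then show ?thesis using 3 by simp
    qed
    have lhs: "map_b (map_b (map_c t) - 1) + 1 = (3 * t - 1) / (1 - t) + 1"
      unfolding c map_b_right[OF c2] v map_b_left[OF v2] l ..
    have b: "map_b t = t / (1 - t)" using 3 by (simp add: map_b_left)
    have b2: "1/2 \<le> t / (1 - t)" "t / (1 - t) \<le> 1" using 3 by (auto simp: divide_simps)
    have bb: "map_b (map_b t) = (4 * t - 1) / t" unfolding b map_b_right[OF b2] using 3 by (simp add: field_simps)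
    have s: "(4 * t - 1) / t - 2 \<le> 0" using 3 by (simp add: divide_simps)
    have w: "(4 * t - 1) / t - 2 + 2 - 1 = (3 * t - 1) / t" using 3 by (simp add: field_simps)
    have w2: "0 \<le> (3 * t - 1) / t" "(3 * t - 1) / t \<le> 1" using 3 by (auto simp: divide_simps)
    have i: "inv_c ((3 * t - 1) / t) = (3 * t - 1) / (1 - t)"
    proof -
      have "2 - (3 * t - 1) / t = (1 - t) / t" using 3 by (simp add: field_simps)
      then show ?thesis using w2 3 by (simp add: inv_c_def)
    qed
    have "1 \<le> (3 * t - 1) / (1 - t) + 1" using 3 by simp
    then show ?thesis unfolding lhs bb map_c_fix(1)[OF s] w i by (simp add: map_c_fix(2))
  next
    case 4
    have c: "map_c t = 2 * t / (1 + t)" using 4 by (simp add: map_c_def)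
    have c2: "1/2 \<le> 2 * t / (1 + t)" "2 * t / (1 + t) \<le> 1" using 4 by (auto simp: divide_simps)
    have v: "3 - 1 / (2 * t / (1 + t)) - 1 = (3 * t - 1) / (2 * t)" using 4 by (simp add: field_simps)
    have v2: "1/2 \<le> (3 * t - 1) / (2 * t)" "(3 * t - 1) / (2 * t) \<le> 1" using 4 by (auto simp: divide_simps)
    have lhs: "map_b (map_b (map_c t) - 1) + 1 = 4 - 2 * t / (3 * t - 1)"
      unfolding c map_b_right[OF c2] v map_b_right[OF v2] by simp
    have b: "map_b t = 3 - 1 / t" using 4 by (simp add: map_b_right)
    have bb: "map_b (map_b t) = 4 - 1 / t" unfolding b using 4 by (subst map_b_shift) (auto simp: divide_simps)
    have w: "4 - 1 / t - 2 = (2 * t - 1) / t" using 4 by (simp add: field_simps)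
    have w2: "0 \<le> (2 * t - 1) / t" "(2 * t - 1) / t \<le> 1" using 4 by (auto simp: divide_simps)
    have cw: "map_c ((2 * t - 1) / t) = 2 * (2 * t - 1) / (3 * t - 1)"
    proof -
      have "1 + (2 * t - 1) / t = (3 * t - 1) / t" using 4 by (simp add: field_simps)
      then show ?thesis using w2 4 by (simp add: map_c_def)
    qed
    have g: "0 \<le> 2 * (2 * t - 1) / (3 * t - 1)" using 4 by simp
    have "2 * (2 * t - 1) / (3 * t - 1) + 2 = 4 - 2 * t / (3 * t - 1)" using 4 by (simp add: field_simps)
    then show ?thesis unfolding lhs bb w cw using g by (simp add: map_c_fix(2) inv_c_fix(2))
  next
    case 5 then show ?thesis by (simp add: map_c_fix map_b_shift inv_c_fix)
  qed
qed

section \<open>Finite presentation\<close>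

fun letter_map :: "nat \<times> bool \<Rightarrow> real \<Rightarrow> real" where
  "letter_map (x, e) = (if x = 0 then if e then map_a else (\<lambda>t. t - 1)
     else if x = 1 then if e then map_b else inv_b else if e then map_c else inv_c)"

definition word_map :: "nat word \<Rightarrow> real \<Rightarrow> real" where
  "word_map w = foldr (\<lambda>l f. letter_map l \<circ> f) w id"

definition winv :: "nat word \<Rightarrow> nat word" where
  "winv w = rev (map (\<lambda>(x, e). (x, \<not> e)) w)"

lemma word_map_simps [simp]: "word_map [] = id" "word_map (l # w) = letter_map l \<circ> word_map w"
  by (simp_all add: word_map_def)

lemma word_map_append: "word_map (u @ v) = word_map u \<circ> word_map v"
  by (induction u) (auto simp: comp_assoc)

lemma letter_map_inv: "letter_map (x, e) (letter_map (x, \<not> e) t) = t"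
  by (simp add: map_a_def map_b_inv_b inv_b_map_b map_c_inv_c inv_c_map_c)

lemma word_map_equiv: "free_equiv S u v \<Longrightarrow> word_map u = word_map v"
proof (induction rule: free_equiv.induct)
  case (cancel u v x e)
  show ?case
    by (rule ext) (simp only: word_map_append word_map_simps append.simps comp_apply letter_map_inv)
qed simp_all

lemma word_map_winv: "word_map (w @ winv w) = id"
proof (induction w)
  case (Cons l w)
  obtain x e where l: "l = (x, e)" by (cases l)
  have "word_map ((l # w) @ winv (l # w)) = letter_map (x, e) \<circ> (word_map (w @ winv w) \<circ> letter_map (x, \<not> e))"
    by (simp add: l winv_def word_map_append comp_assoc del: letter_map.simps)
  then show ?case using Cons letter_map_inv by (simp only: id_comp) (rule ext, simp only: comp_apply id_apply)
qed (simp add: winv_def)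

lemma letter_map_G0: "letter_map l \<in> carrier G0"
proof -
  interpret group G0 by (rule group_G0)
  have "inv\<^bsub>homeo_group\<^esub> map_a = (\<lambda>t. t - 1)"
    by (rule inv_homeo_group[OF map_a_homeo]) (simp add: map_a_def fun_eq_iff)
  then have "(\<lambda>t. t - 1) \<in> carrier G0" unfolding carrier_G0 by (metis generate.inv insertI1)
  then show ?thesis using G0_gens by (cases l) simp
qed

lemma G0_one: "\<one>\<^bsub>G0\<^esub> = id"
  by (simp add: G0_def homeo_group_def)

lemma word_map_G0: "word_map w \<in> carrier G0"
proof (induction w)
  case Nil
  interpret group G0 by (rule group_G0)
  show ?case unfolding word_map_simps G0_one[symmetric] by (rule one_closed)
next
  case (Cons l w)
  interpret group G0 by (rule group_G0)
  show ?case unfolding word_map_simps G0_mult[symmetric] by (rule m_closed[OF letter_map_G0 Cons])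
qed

abbreviation "gens3 \<equiv> {..<3 :: nat}"

lemma words_gens3: "w \<in> words gens3 \<longleftrightarrow> (\<forall>(x, e)\<in>set w. x < 3)"
  by (auto simp: words_def in_lists_conv_set)

lemma word_map_surj:
  assumes "g \<in> carrier G0" shows "\<exists>w\<in>words gens3. word_map w = g"
  using assms unfolding carrier_G0
proof (induction rule: generate.induct)
  case one
  have "\<one>\<^bsub>homeo_group\<^esub> = (id :: real \<Rightarrow> real)" by (simp add: homeo_group_def)
  then show ?case by (intro bexI[of _ "[]"]) (auto simp: words_gens3)
next
  case (incl h)
  have "\<exists>x<3. h = letter_map (x, True)"
    using incl by (elim insertE emptyE) (rule exI[of _ 0], simp, rule exI[of _ 1], simp, rule exI[of _ 2], simp)
  then obtain x where "x < 3" "h = letter_map (x, True)" by blast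
  then show ?case by (intro bexI[of _ "[(x, True)]"]) (auto simp: words_gens3)
next
  case (inv h)
  have "\<exists>x<3. h = letter_map (x, True)"
    using inv by (elim insertE emptyE) (rule exI[of _ 0], simp, rule exI[of _ 1], simp, rule exI[of _ 2], simp)
  then obtain x where x: "x < 3" "h = letter_map (x, True)" by blast
  have "h \<in> carrier homeo_group" using inv map_a_homeo map_b_homeo map_c_homeo by auto
  then have "inv\<^bsub>homeo_group\<^esub> h = letter_map (x, False)"
    by (rule inv_homeo_group) (rule ext, use letter_map_inv[of x False] x(2) in simp)
  then show ?case using x(1) by (intro bexI[of _ "[(x, False)]"]) (auto simp: words_gens3)
next
  case (eng h1 h2)
  then obtain u v where "u \<in> words gens3" "word_map u = h1" "v \<in> words gens3" "word_map v = h2" by blast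
  then show ?case by (intro bexI[of _ "u @ v"]) (auto simp: word_map_append homeo_group_def words_gens3)
qed

text \<open>The relations, with \<open>b\<^sub>n = a\<^sup>n b a\<^sup>-\<^sup>n\<close>, \<open>c\<^sub>n = a\<^sup>n c a\<^sup>-\<^sup>n\<close>: the two relations of Thompson's group between
  \<open>a\<close> and \<open>b\<close>; \<open>c\<close> commutes with \<open>b\<^sub>1\<close>, \<open>b\<^sub>2\<close>, with \<open>a\<^sup>-\<^sup>1 b\<^sub>-\<^sub>1\<close>, \<open>a\<^sup>-\<^sup>1 b\<^sub>-\<^sub>2\<close> (supported to the left of \<open>0\<close>)
  and with \<open>c\<^sub>1\<close>, \<open>c\<^sub>2\<close>; and the subdivision relation \<open>b\<^sub>1 b c = c c\<^sub>1\<^sup>-\<^sup>1 c\<^sub>2 b b\<close>.\<close>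

definition rel_pairs :: "(nat word \<times> nat word) list" where
  "rel_pairs = (let a = (0, True); a' = (0, False); b = (1, True); c = (2, True); c' = (2, False) in
    [([b, a, b, a'], [a, a, b, a', a', b]),
     ([b, a, a, b, a', a'], [a, a, a, b, a', a', a', b]),
     ([c, a, b, a'], [a, b, a', c]),
     ([c, a, a, b, a', a'], [a, a, b, a', a', c]),
     ([c, a', a', b, a], [a', a', b, a, c]),
     ([c, a', a', a', b, a, a], [a', a', a', b, a, a, c]),
     ([c, a, c, a'], [a, c, a', c]),
     ([c, a, a, c, a', a'], [a, a, c, a', a', c]),
     ([a, b, a', b, c], [c, a, c', a', a, a, c, a', a', b, b])])"

lemma rel_pairs_words: "(u, v) \<in> set rel_pairs \<Longrightarrow> u \<in> words gens3 \<and> v \<in> words gens3"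
  by (auto simp: rel_pairs_def Let_def words_gens3)

lemma rel_pairs_hold:
  assumes "(u, v) \<in> set rel_pairs" shows "word_map u = word_map v"
proof (rule ext)
  fix t :: real
  have "\<forall>(u, v)\<in>set rel_pairs. word_map u t = word_map v t"
    using rel_BB[of 1 t] rel_BB[of 2 t] rel_CB[of 1 t] rel_CB[of 2 t] rel_CE[of 1 t] rel_CE[of 2 t]
      rel_CC[of 1 t] rel_CC[of 2 t] rel_BBC[of t]
    by (simp add: rel_pairs_def Let_def map_a_def algebra_simps)
  then show "word_map u t = word_map v t" using assms by blast
qed

section \<open>The homomorphism from the free group onto \<open>G0\<close>\<close>

abbreviation "free3 \<equiv> free_group gens3"

definition cls :: "nat word \<Rightarrow> nat word set" where
  "cls w = free_rel gens3 `` {w}"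

definition relators :: "nat word set set" where
  "relators = (\<lambda>(u, v). cls (u @ winv v)) ` set rel_pairs"

abbreviation "rel_closure \<equiv> normal_closure free3 relators"

lemma winv_words: "w \<in> words gens3 \<Longrightarrow> winv w \<in> words gens3"
  by (auto simp: words_gens3 winv_def)

lemma append_words: "u \<in> words gens3 \<Longrightarrow> v \<in> words gens3 \<Longrightarrow> u @ v \<in> words gens3"
  by (auto simp: words_gens3)

lemma Nil_words: "[] \<in> words gens3"
  by (simp add: words_gens3)

lemma carrier_free3: "carrier free3 = cls ` words gens3"
  by (simp add: carrier_free_group cls_def[abs_def])

lemma cls_mult: "u \<in> words gens3 \<Longrightarrow> v \<in> words gens3 \<Longrightarrow> cls u \<otimes>\<^bsub>free3\<^esub> cls v = cls (u @ v)"
  by (simp add: cls_def free_group_mult)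

lemma cls_one: "\<one>\<^bsub>free3\<^esub> = cls []"
  by (simp add: cls_def one_free_group)

lemma relators_carrier: "relators \<subseteq> carrier free3"
proof
  fix X assume "X \<in> relators"
  then obtain u v where uv: "(u, v) \<in> set rel_pairs" "X = cls (u @ winv v)" by (auto simp: relators_def)
  then have "u @ winv v \<in> words gens3" using rel_pairs_words append_words winv_words by blast
  then show "X \<in> carrier free3" unfolding carrier_free3 uv(2) by (rule imageI)
qed

lemma normal_rel_closure: "rel_closure \<lhd> free3" and relators_closure: "relators \<subseteq> rel_closure"
  using group.normal_closure_normal[OF group_free_group relators_carrier] .

definition class_map :: "nat word set \<Rightarrow> real \<Rightarrow> real" where
  "class_map X = word_map (SOME w. w \<in> X)"

lemma class_map_cls: "w \<in> words gens3 \<Longrightarrow> class_map (cls w) = word_map w"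
proof -
  assume w: "w \<in> words gens3"
  then have "w \<in> cls w" by (simp add: cls_def free_rel_def free_equiv.refl)
  then have "(SOME w'. w' \<in> cls w) \<in> cls w" by (rule someI)
  then have "free_equiv gens3 w (SOME w'. w' \<in> cls w)" by (simp add: cls_def free_rel_def)
  then show ?thesis unfolding class_map_def by (rule word_map_equiv[symmetric])
qed

lemma group_hom_class_map: "group_hom free3 G0 class_map"
proof (rule group_hom.intro[OF group_free_group group_G0], unfold group_hom_axioms_def hom_def, safe)
  fix X Y assume XY: "X \<in> carrier free3" "Y \<in> carrier free3"
  then obtain u v where u: "u \<in> words gens3" "X = cls u" and v: "v \<in> words gens3" "Y = cls v"
    by (auto simp: carrier_free3)
  show "class_map X \<in> carrier G0" unfolding u(2) class_map_cls[OF u(1)] by (rule word_map_G0)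
  show "class_map (X \<otimes>\<^bsub>free3\<^esub> Y) = class_map X \<otimes>\<^bsub>G0\<^esub> class_map Y"
    unfolding u(2) v(2) cls_mult[OF u(1) v(1)] class_map_cls[OF u(1)] class_map_cls[OF v(1)]
      class_map_cls[OF append_words[OF u(1) v(1)]] G0_mult by (rule word_map_append)
qed

lemma word_map_rel: 
  assumes "word_map u = word_map v" shows "word_map (u @ winv v) = id"
  using word_map_winv[of v] assms by (simp only: word_map_append)

lemma word_map_rel':
  assumes "word_map (u @ winv v) = id" shows "word_map u = word_map v"
proof -
  have "word_map (winv v) \<circ> word_map v = id"
  proof -
    have "winv (winv v) = v" by (simp add: winv_def rev_map o_def case_prod_unfold)
    then show ?thesis using word_map_winv[of "winv v"] by (simp only: word_map_append)
  qed
  then have "word_map u = (word_map u \<circ> word_map (winv v)) \<circ> word_map v" by (simp only: comp_assoc comp_id)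
  then show ?thesis using assms by (simp only: word_map_append id_comp)
qed

lemma rel_closure_kernel: "rel_closure \<subseteq> kernel free3 G0 class_map"
proof -
  interpret group_hom free3 G0 class_map by (rule group_hom_class_map)
  have "relators \<subseteq> kernel free3 G0 class_map"
  proof
    fix X assume X: "X \<in> relators"
    then obtain u v where uv: "(u, v) \<in> set rel_pairs" "X = cls (u @ winv v)" by (auto simp: relators_def)
    have "u @ winv v \<in> words gens3" using rel_pairs_words[OF uv(1)] append_words winv_words by blast
    then have "class_map X = id" using uv(2) class_map_cls word_map_rel[OF rel_pairs_hold[OF uv(1)]] by simp
    then show "X \<in> kernel free3 G0 class_map"
      using X relators_carrier by (auto simp: kernel_def G0_one)
  qed
  then show ?thesis using normal_kernel unfolding normal_closure_def by (intro Inter_lower) simp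
qed

text \<open>The presented group is made a type in order to be an instance of
  \<open>group_add\<close>, over which the locales above are stated.\<close>

typedef pgrp = "carrier (free3 Mod rel_closure)"
  using group.is_monoid[OF normal.factorgroup_is_group[OF normal_rel_closure]] monoid.one_closed by blast

lemma group_quotient: "group (free3 Mod rel_closure)"
  by (rule normal.factorgroup_is_group[OF normal_rel_closure])

instantiation pgrp :: group_add
begin

definition "0 = Abs_pgrp \<one>\<^bsub>free3 Mod rel_closure\<^esub>"
definition "p + q = Abs_pgrp (Rep_pgrp p \<otimes>\<^bsub>free3 Mod rel_closure\<^esub> Rep_pgrp q)"
definition "- p = Abs_pgrp (inv\<^bsub>free3 Mod rel_closure\<^esub> Rep_pgrp p)"
definition "p - q = p + - (q :: pgrp)"

instance
proof
  define Q where "Q = free3 Mod rel_closure"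
  interpret Q: group Q unfolding Q_def by (rule group_quotient)
  note [simp] = Abs_pgrp_inverse[folded Q_def] Rep_pgrp[folded Q_def] Rep_pgrp_inverse
    plus_pgrp_def[folded Q_def] zero_pgrp_def[folded Q_def] uminus_pgrp_def[folded Q_def]
  fix p q r :: pgrp
  show "p + q + r = p + (q + r)" by (simp add: Q.m_assoc)
  show "0 + p = p" by simp
  show "p + 0 = p" by simp
  show "- p + p = 0" by simp
  show "p + - q = p - q" by (simp add: minus_pgrp_def)
qed

end

definition wcls :: "nat word \<Rightarrow> pgrp" where
  "wcls w = Abs_pgrp (rel_closure #>\<^bsub>free3\<^esub> cls w)"

lemma Rep_wcls: "w \<in> words gens3 \<Longrightarrow> Rep_pgrp (wcls w) = rel_closure #>\<^bsub>free3\<^esub> cls w"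
  unfolding wcls_def by (rule Abs_pgrp_inverse) (auto simp: FactGroup_def RCOSETS_def carrier_free3)

lemma wcls_surj: "\<exists>w\<in>words gens3. p = wcls w"
proof -
  have "Rep_pgrp p \<in> carrier (free3 Mod rel_closure)" by (rule Rep_pgrp)
  then obtain w where w: "w \<in> words gens3" "Rep_pgrp p = rel_closure #>\<^bsub>free3\<^esub> cls w"
    by (auto simp: FactGroup_def RCOSETS_def carrier_free3)
  then have "p = wcls w" by (metis Rep_pgrp_inverse wcls_def)
  then show ?thesis using w(1) by blast
qed

lemma wcls_append:
  assumes "u \<in> words gens3" "v \<in> words gens3"
  shows "wcls (u @ v) = wcls u + wcls v"
proof -
  have "cls u \<in> carrier free3" "cls v \<in> carrier free3" using assms by (auto simp: carrier_free3)
  then have "(rel_closure #>\<^bsub>free3\<^esub> cls u) <#>\<^bsub>free3\<^esub> (rel_closure #>\<^bsub>free3\<^esub> cls v)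
      = rel_closure #>\<^bsub>free3\<^esub> cls (u @ v)"
    using normal.rcos_sum[OF normal_rel_closure] assms by (simp add: cls_mult)
  then show ?thesis using assms by (simp add: plus_pgrp_def Rep_wcls wcls_def[of "u @ v"])
qed

lemma wcls_eq_0_iff:
  assumes "w \<in> words gens3"
  shows "wcls w = 0 \<longleftrightarrow> cls w \<in> rel_closure"
proof -
  interpret group free3 by (rule group_free_group)
  have sub: "subgroup rel_closure free3" by (rule normal_imp_subgroup[OF normal_rel_closure])
  have c: "cls w \<in> carrier free3" using assms by (auto simp: carrier_free3)
  have "wcls w = 0 \<longleftrightarrow> rel_closure #>\<^bsub>free3\<^esub> cls w = rel_closure"
  proof
    assume "wcls w = 0"
    then have "Rep_pgrp (wcls w) = Rep_pgrp 0" by simp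
    then show "rel_closure #>\<^bsub>free3\<^esub> cls w = rel_closure"
      using group.is_monoid[OF group_quotient] monoid.one_closed[of "free3 Mod rel_closure"]
      by (simp add: Rep_wcls[OF assms] zero_pgrp_def Abs_pgrp_inverse)
  next
    assume "rel_closure #>\<^bsub>free3\<^esub> cls w = rel_closure"
    then show "wcls w = 0" by (simp add: wcls_def zero_pgrp_def FactGroup_def)
  qed
  also have "\<dots> \<longleftrightarrow> cls w \<in> rel_closure"
    using coset_join1[OF _ c sub] coset_join2[OF c sub] subgroup.subset[OF sub] by blast
  finally show ?thesis .
qed

lemma wcls_equiv: "free_equiv gens3 u v \<Longrightarrow> wcls u = wcls v"
proof -
  assume e: "free_equiv gens3 u v"
  then have "cls u = cls v"
    unfolding cls_def using free_rel_class_eq_iff free_equiv_words by blast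
  then show ?thesis by (simp add: wcls_def)
qed

lemma wcls_Nil: "wcls [] = 0"
proof -
  interpret subgroup rel_closure free3 by (rule normal_imp_subgroup[OF normal_rel_closure])
  show ?thesis using one_closed by (simp add: wcls_eq_0_iff[OF Nil_words] cls_one)
qed

lemma wcls_winv:
  assumes "w \<in> words gens3" shows "wcls (winv w) = - wcls w"
proof -
  have "wcls (winv w @ w) = 0"
    using wcls_equiv[OF free_equiv_inverse[OF assms]] wcls_Nil by (simp add: winv_def)
  then show ?thesis using wcls_append[OF winv_words[OF assms] assms] by (simp add: eq_neg_iff_add_eq_0)
qed

lemma wcls_word_map:
  assumes "u \<in> words gens3" "v \<in> words gens3" "wcls u = wcls v"
  shows "word_map u = word_map v"
proof (rule word_map_rel')
  have w: "u @ winv v \<in> words gens3" using assms append_words winv_words by simp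
  have "wcls (u @ winv v) = 0" using assms wcls_append winv_words wcls_winv by simp
  then have "cls (u @ winv v) \<in> kernel free3 G0 class_map"
    using wcls_eq_0_iff[OF w] rel_closure_kernel by blast
  then show "word_map (u @ winv v) = id" by (simp add: kernel_def G0_one class_map_cls[OF w])
qed

definition pA :: pgrp where "pA = wcls [(0, True)]"
definition pB :: pgrp where "pB = wcls [(1, True)]"
definition pC :: pgrp where "pC = wcls [(2, True)]"

definition pmap :: "pgrp \<Rightarrow> real \<Rightarrow> real" where
  "pmap p = word_map (SOME w. w \<in> words gens3 \<and> p = wcls w)"

lemma pmap_wcls:
  assumes "w \<in> words gens3" shows "pmap (wcls w) = word_map w"
proof -
  let ?u = "SOME u. u \<in> words gens3 \<and> wcls w = wcls u"
  have "?u \<in> words gens3 \<and> wcls w = wcls ?u" by (rule someI[of _ w]) (use assms in simp)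
  then show ?thesis unfolding pmap_def using wcls_word_map[of w ?u] assms by simp
qed

fun lval :: "nat \<times> bool \<Rightarrow> pgrp" where
  "lval (x, e) = (let g = (if x = 0 then pA else if x = 1 then pB else pC) in if e then g else - g)"

lemma wcls_letter: "x < 3 \<Longrightarrow> wcls [(x, e)] = lval (x, e)"
proof -
  assume x: "x < 3"
  then have w: "[(x, True)] \<in> words gens3" by (simp add: words_gens3)
  have "wcls [(x, False)] = - wcls [(x, True)]" using wcls_winv[OF w] by (simp add: winv_def)
  moreover have "x = 0 \<or> x = 1 \<or> x = 2" using x by auto
  ultimately show ?thesis by (cases e) (auto simp: Let_def pA_def pB_def pC_def)
qed

lemma wcls_eval: "w \<in> words gens3 \<Longrightarrow> wcls w = sum_list (map lval w)"
proof (induction w)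
  case (Cons l w)
  obtain x e where l: "l = (x, e)" by (cases l)
  have "x < 3" "w \<in> words gens3" using Cons.prems by (auto simp: l words_gens3)
  then have "wcls ([(x, e)] @ w) = lval (x, e) + wcls w"
    by (subst wcls_append) (auto simp: words_gens3 wcls_letter simp del: lval.simps)
  then show ?case using Cons.IH \<open>w \<in> words gens3\<close> by (simp add: l del: lval.simps)
qed (simp add: wcls_Nil)

lemma rel_pairs_eval:
  assumes "(u, v) \<in> set rel_pairs"
  shows "sum_list (map lval u) = sum_list (map lval v)"
proof -
  have w: "u \<in> words gens3" "v \<in> words gens3" using rel_pairs_words[OF assms] by auto
  have "cls (u @ winv v) \<in> relators" unfolding relators_def using assms by force
  then have "wcls (u @ winv v) = 0"
    using wcls_eq_0_iff[OF append_words[OF w(1) winv_words[OF w(2)]]] relators_closure by blast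
  then have "wcls u = wcls v" using wcls_append[OF w(1) winv_words[OF w(2)]] wcls_winv[OF w(2)] by simp
  then show ?thesis using wcls_eval w by simp
qed

lemma zp_small: "zp x 2 = x + x" "zp x 3 = x + x + x" "zp x (- 1) = - x" "zp x (- 2) = - x - x"
  by (simp_all add: zp_def numeral_eq_Suc add.assoc)

interpretation pg: presented pA pB pC .

lemma relations_pgrp: "relations pA pB pC"
proof -
  have "\<forall>(u, v)\<in>set rel_pairs. sum_list (map lval u) = sum_list (map lval v)"
    using rel_pairs_eval by blast
  then have r: "pB + (pA + (pB + - pA)) = pA + (pA + (pB + (- pA + (- pA + pB))))"
    "pB + (pA + (pA + (pB + (- pA + - pA)))) = pA + (pA + (pA + (pB + (- pA + (- pA + (- pA + pB))))))"
    "pC + (pA + (pB + - pA)) = pA + (pB + (- pA + pC))"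
    "pC + (pA + (pA + (pB + (- pA + - pA)))) = pA + (pA + (pB + (- pA + (- pA + pC))))"
    "pC + (- pA + (- pA + (pB + pA))) = - pA + (- pA + (pB + (pA + pC)))"
    "pC + (- pA + (- pA + (- pA + (pB + (pA + pA))))) = - pA + (- pA + (- pA + (pB + (pA + (pA + pC)))))"
    "pC + (pA + (pC + - pA)) = pA + (pC + (- pA + pC))"
    "pC + (pA + (pA + (pC + (- pA + - pA)))) = pA + (pA + (pC + (- pA + (- pA + pC))))"
    "pA + (pB + (- pA + (pB + pC))) = pC + (pA + (- pC + (- pA + (pA + (pA + (pC + (- pA + (- pA + (pB + pB)))))))))"
    by (simp_all add: rel_pairs_def Let_def del: add_uminus_conv_diff)
  show ?thesis
    by unfold_locales
      (simp_all only: com_def pg.En_def pg.Bn_def pg.cj_def zp_small zp_1 minus_minus free_simps r)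
qed

interpretation pg: realized pA pB pC pmap
proof (rule realized.intro[OF relations_pgrp], unfold_locales)
  fix x y :: pgrp
  obtain u v where u: "u \<in> words gens3" "x = wcls u" and v: "v \<in> words gens3" "y = wcls v"
    using wcls_surj by metis
  show "pmap (x + y) = pmap x \<circ> pmap y"
    unfolding u(2) v(2) wcls_append[OF u(1) v(1), symmetric]
    by (simp only: pmap_wcls u(1) v(1) append_words word_map_append)
  show "pmap x \<in> carrier G0" unfolding u(2) pmap_wcls[OF u(1)] by (rule word_map_G0)
  show "pmap pA = map_a" "pmap pB = map_b" "pmap pC = map_c"
    by (simp_all add: pA_def pB_def pC_def pmap_wcls words_gens3)
qed

text \<open>Every element of the presented group is a word in the generators, so
  \<open>ascending_faithful\<close> applies to all of them and the action has trivial
  kernel.\<close>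

lemma ascending_wcls: "w \<in> words gens3 \<Longrightarrow> pg.ascending (wcls w)"
proof (induction w rule: rev_induct)
  case Nil show ?case by (simp add: wcls_Nil pg.ascending_0)
next
  case (snoc l w)
  obtain x e where l: "l = (x, e)" by (cases l)
  have w: "w \<in> words gens3" "x < 3" using snoc.prems by (auto simp: words_gens3 l)
  have "wcls (w @ [l]) = wcls w + lval (x, e)"
    using wcls_append[of w "[l]"] w wcls_letter[OF w(2)] by (simp add: l words_gens3 del: lval.simps)
  moreover have "lval (x, e) \<in> {pA, - pA, pB, - pB, pC, - pC}" by (cases e) (auto simp: Let_def)
  ultimately show ?case using pg.ascending_add_gen[OF snoc.IH[OF w(1)]] by simp
qed

theorem G0_finitely_presented: "finitely_presented G0"
  unfolding finitely_presented_def
proof (intro exI conjI)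
  interpret group_hom free3 G0 class_map by (rule group_hom_class_map)
  show "finite relators" by (simp add: relators_def)
  show "relators \<subseteq> carrier free3" by (rule relators_carrier)
  have "kernel free3 G0 class_map \<subseteq> rel_closure"
  proof
    fix X assume X: "X \<in> kernel free3 G0 class_map"
    then obtain w where w: "w \<in> words gens3" "X = cls w" by (auto simp: kernel_def carrier_free3)
    then have "word_map w = id" using X class_map_cls[OF w(1)] by (simp add: kernel_def G0_one)
    then have "wcls w = 0" using pg.ascending_faithful[OF ascending_wcls[OF w(1)]] by (simp add: pmap_wcls[OF w(1)])
    then show "X \<in> rel_closure" using wcls_eq_0_iff[OF w(1)] w(2) by simp
  qed
  then have k: "kernel free3 G0 class_map = rel_closure" using rel_closure_kernel by blast
  have "class_map ` carrier free3 = carrier G0"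
  proof
    show "class_map ` carrier free3 \<subseteq> carrier G0" by (auto simp: carrier_free3 class_map_cls word_map_G0)
    show "carrier G0 \<subseteq> class_map ` carrier free3"
    proof
      fix g assume "g \<in> carrier G0"
      then obtain w where w: "w \<in> words gens3" "word_map w = g" using word_map_surj by blast
      then have "g = class_map (cls w)" by (simp add: class_map_cls)
      then show "g \<in> class_map ` carrier free3" using w(1) by (auto simp: carrier_free3)
    qed
  qed
  then have "free3 Mod kernel free3 G0 class_map \<cong> G0" by (rule FactGroup_iso)
  then show "G0 \<cong> free3 Mod rel_closure"
    unfolding k by (rule group.iso_sym[OF group_quotient])
qed

theorem theorem1p1:
  shows "\<not> amenable G0 \<and> finitely_presented G0"
  using G0_not_amenable G0_finitely_presented by blast

end
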